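(* Let $W$ be a graphon, let $d,p\ge1$, let $F=(F_1,\dots,F_d)$ be simple finite graphs with $V(F_m)=[p]$, let $\ell\in\mathcal{M}_p$ with $k=|\ell|$, and assume the Compatibility Condition holds. Then for every $g\in\mathcal{C}^2([0,1]^d)$, $$\sqrt n\big(\Gamma_n^{F,\ell}(g)-\Gamma^{F,\ell}(g)\big)\xrightarrow[n\to\infty]{(d)}\mathcal{N}\big(0,\sigma^{F,\ell}(g)^2\big),$$ where $\sigma^{F,\ell}(g)^2=\mathrm{Var}(\mathcal{U})$, $U$ is uniform on $[0,1]$, and $$\mathcal{U}=\sum_{i=1}^k\int_{[0,1]^k}\hat t_{R_i(x,U)}\Big(g\big(\tilde t_{R_i(x,U)}\big)-g(0)\Big)dx+\sum_{q\in[p]\setminus\{\ell_1,\dots,\ell_k\}}\int_{[0,1]^k}\big\langle t_{xU}(F^{\ell q},W),\nabla g(\tilde t_x)\big\rangle\,dx.$$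
   Context: A graphon is a symmetric measurable $W:[0,1]^2\to[0,1]$. $X=(X_i)_{i\ge1}$ i.i.d. uniform on $[0,1]$; $G_n$ is the random graph on $[n]$ where, conditionally on $X$, each $\{i,j\}$ is an edge independently with probability $W(X_i,X_j)$. $\mathcal{S}_{n,k}$: words of length $k$ with distinct characters in $[n]$; $\mathcal{M}_p=\bigcup_{k\in[p]}\mathcal{S}_{p,k}$. For $\ell\in\mathcal{S}_{p,k}$, $\alpha\in\mathcal{S}_{n,k}$: $\mathcal{S}^{\ell,\alpha}_{n,p}=\{\beta\in\mathcal{S}_{n,p}:\beta_{\ell_i}=\alpha_i\ \forall i\}$ and $t_{\rm inj}(F_m^\ell,G^\alpha)=|\mathcal{S}^{\ell,\alpha}_{n,p}|^{-1}\#\{\beta\in\mathcal{S}^{\ell,\alpha}_{n,p}:\{\beta_i,\beta_j\}\in E(G)\ \forall\{i,j\}\in E(F_m)\}$; $t_{\rm inj}(F^\ell,G^\alpha)$ is the vector over $m\in[d]$. Compatibility Condition: for $m,m'\in[d]$ and $i,i'$ among the labels $\ell_1,\dots,\ell_k$, $\{i,i'\}\in E(F_m)\iff\{i,i'\}\in E(F_{m'})$; $E^{[\ell]}$ is this common set of label–label edges. For $x\in[0,1]^k$: $\hat t_x=\prod_{\{\ell_i,\ell_j\}\in E^{[\ell]}}W(x_i,x_j)$; $\tilde t_x$ is the vector with entries $\int\prod_{\{i,j\}\in E(F_m)\setminus E^{[\ell]}}W(y_i,y_j)\prod_{q\notin\ell}dy_q$ with $y_{\ell_i}=x_i$; $\hat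 t=\int\hat t_x dx$. More generally, for a word $\lambda\in\mathcal{M}_p$ of length $r$ and $z\in[0,1]^r$, $t_z(F_m^\lambda,W)=\int\prod_{\{i,j\}\in E(F_m)}W(y_i,y_j)\prod_{q\notin\lambda}dy_q$ with $y_{\lambda_i}=z_i$, and $t_z(F^\lambda,W)$ is the vector over $m$. $\ell q$ is the word $\ell$ followed by $q$, $xU=(x_1,\dots,x_k,U)$, and $R_i(x,u)$ is $x$ with its $i$-th coordinate replaced by $u$. $\Gamma_n^{F,\ell}(g)=|\mathcal{S}_{n,k}|^{-1}\sum_{\alpha\in\mathcal{S}_{n,k}}g(t_{\rm inj}(F^\ell,G_n^\alpha))$ and $\Gamma^{F,\ell}(g)=\int_{[0,1]^k}\hat t_x g(\tilde t_x)dx+(1-\hat t)g(0)$. *)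

theory Defs
  imports "HOL-Probability.Probability"
begin

definition graphon :: "(real \<Rightarrow> real \<Rightarrow> real) \<Rightarrow> bool" where
  "graphon W \<longleftrightarrow> (\<forall>x y. W x y = W y x \<and> 0 \<le> W x y \<and> W x y \<le> 1)
      \<and> (\<lambda>z. W (fst z) (snd z)) \<in> borel_measurable borel"

definition unif :: "real measure" where
  "unif = uniform_measure lborel {0..1}"

text \<open>Common probability space: coordinates Inl i are the latent variables X_i,
  coordinates Inr (i,j), i<j, are auxiliary uniforms used to draw the edges.\<close>
definition Omega :: "(nat + nat \<times> nat \<Rightarrow> real) measure" where
  "Omega = PiM UNIV (\<lambda>_. unif)"

definition Xv :: "(nat + nat \<times> nat \<Rightarrow> real) \<Rightarrow> nat \<Rightarrow> real" where
  "Xv \<omega> i = \<omega> (Inl i)"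

text \<open>Edge \{i,j\} of G (i \<noteq> j): present iff U_ij < W(X_i,X_j); conditionally on X
  these are independent Bernoulli(W(X_i,X_j)).\<close>
definition Gedge :: "(real \<Rightarrow> real \<Rightarrow> real) \<Rightarrow> (nat + nat \<times> nat \<Rightarrow> real) \<Rightarrow> nat \<Rightarrow> nat \<Rightarrow> bool" where
  "Gedge W \<omega> i j \<longleftrightarrow> i \<noteq> j \<and> \<omega> (Inr (min i j, max i j)) < W (Xv \<omega> i) (Xv \<omega> j)"

definition words :: "nat \<Rightarrow> nat \<Rightarrow> nat list set" where
  "words n k = {\<beta>. length \<beta> = k \<and> distinct \<beta> \<and> set \<beta> \<subseteq> {..<n}}"

definition Mwords :: "nat \<Rightarrow> nat list set" where
  "Mwords p = (\<Union>k\<in>{1..p}. words p k)"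

definition ext_words :: "nat \<Rightarrow> nat \<Rightarrow> nat list \<Rightarrow> nat list \<Rightarrow> nat list set" where
  "ext_words n p l \<alpha> = {\<beta> \<in> words n p. \<forall>i<length l. \<beta> ! (l ! i) = \<alpha> ! i}"

definition simple_graph :: "nat \<Rightarrow> (nat \<Rightarrow> nat \<Rightarrow> bool) \<Rightarrow> bool" where
  "simple_graph p E \<longleftrightarrow> (\<forall>i j. E i j \<longrightarrow> i < p \<and> j < p \<and> i \<noteq> j \<and> E j i)"

definition edges :: "(nat \<Rightarrow> nat \<Rightarrow> bool) \<Rightarrow> (nat \<times> nat) set" where
  "edges E = {(i,j). i < j \<and> E i j}"

definition t_inj :: "(nat \<Rightarrow> nat \<Rightarrow> bool) \<Rightarrow> nat \<Rightarrow> nat \<Rightarrow> nat list \<Rightarrow> nat list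
    \<Rightarrow> (nat \<Rightarrow> nat \<Rightarrow> bool) \<Rightarrow> real" where
  "t_inj Fm p n l \<alpha> G =
     real (card {\<beta> \<in> ext_words n p l \<alpha>. \<forall>(i,j)\<in>edges Fm. G (\<beta> ! i) (\<beta> ! j)})
       / real (card (ext_words n p l \<alpha>))"

definition compatible :: "('d \<Rightarrow> nat \<Rightarrow> nat \<Rightarrow> bool) \<Rightarrow> nat list \<Rightarrow> bool" where
  "compatible F l \<longleftrightarrow> (\<forall>m m' i i'. i \<in> set l \<longrightarrow> i' \<in> set l \<longrightarrow> (F m i i' \<longleftrightarrow> F m' i i'))"

definition Elab :: "('d \<Rightarrow> nat \<Rightarrow> nat \<Rightarrow> bool) \<Rightarrow> nat list \<Rightarrow> (nat \<times> nat) set" where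
  "Elab F l = {(i,j). i < j \<and> i \<in> set l \<and> j \<in> set l \<and> (\<forall>m. F m i j)}"

definition pos :: "nat list \<Rightarrow> nat \<Rightarrow> nat" where
  "pos lam q = (THE i. i < length lam \<and> lam ! i = q)"

definition ext_pt :: "nat list \<Rightarrow> (nat \<Rightarrow> real) \<Rightarrow> (nat \<Rightarrow> real) \<Rightarrow> nat \<Rightarrow> real" where
  "ext_pt lam z w q = (if q \<in> set lam then z (pos lam q) else w q)"

definition prodW :: "(real \<Rightarrow> real \<Rightarrow> real) \<Rightarrow> (nat \<times> nat) set \<Rightarrow> (nat \<Rightarrow> real) \<Rightarrow> real" where
  "prodW W E y = (\<Prod>(i,j)\<in>E. W (y i) (y j))"

definition tint :: "(real \<Rightarrow> real \<Rightarrow> real) \<Rightarrow> (nat \<times> nat) set \<Rightarrow> nat \<Rightarrow> nat list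
    \<Rightarrow> (nat \<Rightarrow> real) \<Rightarrow> real" where
  "tint W E p lam z = (\<integral>w. prodW W E (ext_pt lam z w) \<partial>(PiM ({..<p} - set lam) (\<lambda>_. unif)))"

definition cube :: "nat \<Rightarrow> (nat \<Rightarrow> real) measure" where
  "cube k = PiM {..<k} (\<lambda>_. unif)"

definition t_hat_x :: "(real \<Rightarrow> real \<Rightarrow> real) \<Rightarrow> ('d \<Rightarrow> nat \<Rightarrow> nat \<Rightarrow> bool) \<Rightarrow> nat list
    \<Rightarrow> (nat \<Rightarrow> real) \<Rightarrow> real" where
  "t_hat_x W F l x = (\<Prod>(i,j)\<in>Elab F l. W (x (pos l i)) (x (pos l j)))"

definition t_tilde_x :: "(real \<Rightarrow> real \<Rightarrow> real) \<Rightarrow> ('d::finite \<Rightarrow> nat \<Rightarrow> nat \<Rightarrow> bool) \<Rightarrow> nat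
    \<Rightarrow> nat list \<Rightarrow> (nat \<Rightarrow> real) \<Rightarrow> real ^ 'd" where
  "t_tilde_x W F p l x = (\<chi> m. tint W (edges (F m) - Elab F l) p l x)"

definition t_hat :: "(real \<Rightarrow> real \<Rightarrow> real) \<Rightarrow> ('d \<Rightarrow> nat \<Rightarrow> nat \<Rightarrow> bool) \<Rightarrow> nat list \<Rightarrow> real" where
  "t_hat W F l = (\<integral>x. t_hat_x W F l x \<partial>cube (length l))"

definition t_z :: "(real \<Rightarrow> real \<Rightarrow> real) \<Rightarrow> ('d::finite \<Rightarrow> nat \<Rightarrow> nat \<Rightarrow> bool) \<Rightarrow> nat
    \<Rightarrow> nat list \<Rightarrow> (nat \<Rightarrow> real) \<Rightarrow> real ^ 'd" where
  "t_z W F p lam z = (\<chi> m. tint W (edges (F m)) p lam z)"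

definition Gamma_n :: "(real \<Rightarrow> real \<Rightarrow> real) \<Rightarrow> ('d::finite \<Rightarrow> nat \<Rightarrow> nat \<Rightarrow> bool) \<Rightarrow> nat
    \<Rightarrow> nat list \<Rightarrow> (real ^ 'd \<Rightarrow> real) \<Rightarrow> nat \<Rightarrow> (nat + nat \<times> nat \<Rightarrow> real) \<Rightarrow> real" where
  "Gamma_n W F p l g n \<omega> =
     (\<Sum>\<alpha>\<in>words n (length l). g (\<chi> m. t_inj (F m) p n l \<alpha> (Gedge W \<omega>)))
       / real (card (words n (length l)))"

definition Gamma :: "(real \<Rightarrow> real \<Rightarrow> real) \<Rightarrow> ('d::finite \<Rightarrow> nat \<Rightarrow> nat \<Rightarrow> bool) \<Rightarrow> nat
    \<Rightarrow> nat list \<Rightarrow> (real ^ 'd \<Rightarrow> real) \<Rightarrow> real" where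
  "Gamma W F p l g =
     (\<integral>x. t_hat_x W F l x * g (t_tilde_x W F p l x) \<partial>cube (length l))
       + (1 - t_hat W F l) * g 0"

text \<open>The random variable script-U as a function of U = u; nabla is the gradient of g.\<close>
definition Ufun :: "(real \<Rightarrow> real \<Rightarrow> real) \<Rightarrow> ('d::finite \<Rightarrow> nat \<Rightarrow> nat \<Rightarrow> bool) \<Rightarrow> nat
    \<Rightarrow> nat list \<Rightarrow> (real ^ 'd \<Rightarrow> real) \<Rightarrow> (real ^ 'd \<Rightarrow> real ^ 'd) \<Rightarrow> real \<Rightarrow> real" where
  "Ufun W F p l g nabla u =
     (\<Sum>i<length l. \<integral>x. t_hat_x W F l (x(i := u))
          * (g (t_tilde_x W F p l (x(i := u))) - g 0) \<partial>cube (length l))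
   + (\<Sum>q\<in>{..<p} - set l. \<integral>x. t_z W F p (l @ [q]) (x(length l := u))
          \<bullet> nabla (t_tilde_x W F p l x) \<partial>cube (length l))"

definition sigma2 :: "(real \<Rightarrow> real \<Rightarrow> real) \<Rightarrow> ('d::finite \<Rightarrow> nat \<Rightarrow> nat \<Rightarrow> bool) \<Rightarrow> nat
    \<Rightarrow> nat list \<Rightarrow> (real ^ 'd \<Rightarrow> real) \<Rightarrow> (real ^ 'd \<Rightarrow> real ^ 'd) \<Rightarrow> real" where
  "sigma2 W F p l g nabla =
     (\<integral>u. (Ufun W F p l g nabla u - (\<integral>v. Ufun W F p l g nabla v \<partial>unif))\<^sup>2 \<partial>unif)"

definition normal_law :: "real \<Rightarrow> real measure" where
  "normal_law s2 = (if s2 = 0 then return borel 0 else density lborel (normal_density 0 (sqrt s2)))"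

end

theory Submission
  imports Defs
begin

text \<open>Expand \<open>g\<close> to first order at the vector \<open>t_tilde_x\<close> of densities conditional on the latent
  positions of the labels. Given these positions the number of label extensions is an average of
  terms that are uncorrelated unless they share an unlabelled vertex, so the quadratic remainder is
  \<open>O(1/n)\<close> in \<open>L1\<close>. What is left is a U-statistic over words of length \<open>p\<close>, whose kernel depends on
  the latent variables and the edge coins of the word. After subtracting its projections onto single
  latent variables, the kernels of two words sharing at most one letter are uncorrelated, so their
  average is \<open>O(1/n)\<close> in \<open>L2\<close>. The projections sum up to \<open>Ufun\<close> minus its mean, to which the classical
  central limit theorem applies; characteristic functions absorb the error terms.\<close>

section \<open>Resampling calculus on the product space\<close>

text \<open>\<open>t_inj\<close> itself does not concentrate: whether the edges between labels are
  present stays random as n grows. Compatibility makes this a common factor A of all motifs, so the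
  vector \<open>t_inj\<close> is A times a vector \<open>t_rest\<close> that does concentrate. Since
  A is 0 or 1, g(A y) = g(0) + A (g(y) - g(0)); this is the origin of g(0) in the limit and allows
  the expansion to be applied to \<open>t_rest\<close> alone. Edge coins leave no trace in the
  limiting variance: two words share a coin only if they share two letters, which happens for a
  fraction of order 1/n^2 of the pairs, whereas sharing one letter has order 1/n. After
  multiplication by sqrt n both errors are of order 1/sqrt n in L1.\<close>

lemma sets_unif [simp, measurable_cong]: "sets unif = sets borel"
  by (simp add: unif_def)

lemma space_unif [simp]: "space unif = UNIV"
  by (simp add: unif_def)

lemma prob_space_unif: "prob_space unif"
  unfolding unif_def by (rule prob_space_uniform_measure) auto

interpretation unif: prob_space unif by (rule prob_space_unif)

interpretation unifP: product_prob_space "\<lambda>_. unif" I for I :: "'i set"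
  by unfold_locales

interpretation Omega: prob_space Omega
  unfolding Omega_def by (rule prob_space_PiM) (rule prob_space_unif)

lemma space_Omega [simp]: "space Omega = UNIV"
  by (simp add: Omega_def space_PiM)

lemma prob_Omega_UNIV [simp]: "Omega.prob UNIV = 1"
  using Omega.prob_space by simp

lemma measurable_Omega_component [measurable (raw)]:
  assumes "f \<in> measurable N Omega"
  shows "(\<lambda>x. f x i) \<in> borel_measurable N"
proof -
  have "(\<lambda>\<omega>. \<omega> i) \<in> measurable Omega unif"
    unfolding Omega_def by measurable
  then have "(\<lambda>\<omega>. \<omega> i) \<in> borel_measurable Omega"
    by (simp cong: measurable_cong_sets)
  from measurable_compose[OF assms this] show ?thesis .
qed

lemma measurable_OmegaI:
  assumes "\<And>i. (\<lambda>x. f x i) \<in> borel_measurable N"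
  shows "f \<in> measurable N Omega"
proof -
  have "(\<lambda>x. \<lambda>i\<in>UNIV. f x i) \<in> measurable N Omega"
    unfolding Omega_def
    by (rule measurable_restrict) (use assms in \<open>simp cong: measurable_cong_sets\<close>)
  then show ?thesis by (simp add: restrict_def)
qed

lemma measurable_override_on [measurable (raw)]:
  assumes [measurable]: "f \<in> measurable N Omega" "h \<in> measurable N Omega"
  shows "(\<lambda>x. override_on (f x) (h x) C) \<in> measurable N Omega"
  by (rule measurable_OmegaI) (simp add: override_on_def)

text \<open>The preimage of a cylinder over \<open>J\<close> is a rectangle: the constraints in
  \<open>J \<inter> C\<close> fall on the first copy, those in \<open>J - C\<close> on the second,
  and the masses multiply back to the full product. This is the source of the tower property and of
  independence below.\<close>

lemma distr_override_on:
  "distr (Omega \<Otimes>\<^sub>M Omega) Omega (\<lambda>(\<omega>, \<omega>'). override_on \<omega>' \<omega> C) = Omega" (is "?D = _")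
proof -
  interpret pair_prob_space Omega Omega ..
  have "?D = PiM UNIV (\<lambda>_. unif)"
  proof (rule unifP.PiM_eq)
    show "sets ?D = sets (PiM UNIV (\<lambda>_. unif))" by (simp add: Omega_def)
    fix J :: "(nat + nat \<times> nat) set" and E
    assume J: "finite J" "J \<subseteq> UNIV" and E: "\<And>j. j \<in> J \<Longrightarrow> E j \<in> sets unif"
    let ?em = "\<lambda>K. prod_emb UNIV (\<lambda>_. unif) K (Pi\<^sub>E K E)"
    have em: "?em K \<in> sets Omega" "emeasure Omega (?em K) = (\<Prod>j\<in>K. emeasure unif (E j))"
      if "K \<subseteq> J" for K
      using that J E unfolding Omega_def
      by (auto intro!: sets_PiM_I unifP.emeasure_PiM_emb intro: finite_subset simp del: sets_unif)
    have em_eq: "?em K = {\<omega>. \<forall>j\<in>K. \<omega> j \<in> E j}" for K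
      by (auto simp: prod_emb_def space_PiM PiE_iff)
    have "emeasure ?D (?em J)
        = emeasure (Omega \<Otimes>\<^sub>M Omega) ((\<lambda>(\<omega>, \<omega>'). override_on \<omega>' \<omega> C) -` ?em J \<inter> space (Omega \<Otimes>\<^sub>M Omega))"
      by (rule emeasure_distr) (use em[of J] in auto)
    also have "(\<lambda>(\<omega>, \<omega>'). override_on \<omega>' \<omega> C) -` ?em J \<inter> space (Omega \<Otimes>\<^sub>M Omega)
        = ?em (J \<inter> C) \<times> ?em (J - C)"
      unfolding em_eq by (auto simp: override_on_def space_pair_measure)
    also have "emeasure (Omega \<Otimes>\<^sub>M Omega) \<dots> = emeasure Omega (?em (J \<inter> C)) * emeasure Omega (?em (J - C))"
      by (rule Omega.emeasure_pair_measure_Times) (auto intro: em)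
    also have "\<dots> = (\<Prod>j\<in>J \<inter> C. emeasure unif (E j)) * (\<Prod>j\<in>J - C. emeasure unif (E j))"
      by (simp add: em(2))
    also have "\<dots> = (\<Prod>j\<in>J. emeasure unif (E j))"
      by (metis J(1) prod.Int_Diff)
    finally show "emeasure ?D (?em J) = (\<Prod>j\<in>J. emeasure unif (E j))" .
  qed
  then show ?thesis by (simp add: Omega_def)
qed

text \<open>The bound holds at every point, not almost everywhere, so that for each frozen point the
  section \<open>f (override_on \<omega>' \<omega> C)\<close> is bounded by the same constant and
  integrable.\<close>

definition bmeas :: "((nat + nat \<times> nat \<Rightarrow> real) \<Rightarrow> real) \<Rightarrow> bool" where
  "bmeas f \<longleftrightarrow> f \<in> borel_measurable Omega \<and> (\<exists>B. \<forall>\<omega>. \<bar>f \<omega>\<bar> \<le> B)"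

lemma bmeasI: "f \<in> borel_measurable Omega \<Longrightarrow> (\<And>\<omega>. \<bar>f \<omega>\<bar> \<le> B) \<Longrightarrow> bmeas f"
  unfolding bmeas_def by blast

lemma bmeas_measurable [measurable_dest]: "bmeas f \<Longrightarrow> f \<in> borel_measurable Omega"
  unfolding bmeas_def by blast

lemma bmeas_bound:
  assumes "bmeas f" obtains B where "0 \<le> B" "\<And>\<omega>. \<bar>f \<omega>\<bar> \<le> B"
  using assms unfolding bmeas_def by (meson abs_ge_zero order_trans)

lemma bmeas_integrable: "bmeas f \<Longrightarrow> integrable Omega f"
  unfolding bmeas_def by (elim conjE exE, rule Omega.integrable_const_bound) auto

lemma bmeas_const [intro, simp]: "bmeas (\<lambda>_. c)"
  by (rule bmeasI[of _ "\<bar>c\<bar>"]) auto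

lemma bmeas_add [intro]: assumes "bmeas f" "bmeas g" shows "bmeas (\<lambda>\<omega>. f \<omega> + g \<omega>)"
proof -
  obtain B C where "\<And>\<omega>. \<bar>f \<omega>\<bar> \<le> B" "\<And>\<omega>. \<bar>g \<omega>\<bar> \<le> C" using assms by (meson bmeas_bound)
  with assms show ?thesis
    by (intro bmeasI[of _ "B + C"]) (auto intro: order_trans[OF abs_triangle_ineq add_mono])
qed

lemma bmeas_mult [intro]: assumes "bmeas f" "bmeas g" shows "bmeas (\<lambda>\<omega>. f \<omega> * g \<omega>)"
proof -
  obtain B C where "0 \<le> B" "\<And>\<omega>. \<bar>f \<omega>\<bar> \<le> B" "\<And>\<omega>. \<bar>g \<omega>\<bar> \<le> C" using assms by (meson bmeas_bound)
  with assms show ?thesis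
    by (intro bmeasI[of _ "B * C"]) (auto simp: abs_mult intro!: mult_mono)
qed

lemma bmeas_divide_const: "bmeas f \<Longrightarrow> bmeas (\<lambda>\<omega>. f \<omega> / c)"
  using bmeas_mult[OF _ bmeas_const[of "inverse c"]] by (simp add: divide_inverse)

lemma bmeas_diff [intro]: assumes "bmeas f" "bmeas g" shows "bmeas (\<lambda>\<omega>. f \<omega> - g \<omega>)"
  using bmeas_add[OF assms(1) bmeas_mult[OF bmeas_const[of "-1"] assms(2)]] by simp

lemma bmeas_sum [intro]: "(\<And>i. i \<in> A \<Longrightarrow> bmeas (f i)) \<Longrightarrow> bmeas (\<lambda>\<omega>. \<Sum>i\<in>A. f i \<omega>)"
  by (induction A rule: infinite_finite_induct) auto

lemma bmeas_prod [intro]: "(\<And>i. i \<in> A \<Longrightarrow> bmeas (f i)) \<Longrightarrow> bmeas (\<lambda>\<omega>. \<Prod>i\<in>A. f i \<omega>)"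
  by (induction A rule: infinite_finite_induct) auto

lemma bmeas_power [intro]: "bmeas f \<Longrightarrow> bmeas (\<lambda>\<omega>. f \<omega> ^ n)"
  by (induction n) auto

lemma bmeas_abs [intro]: "bmeas f \<Longrightarrow> bmeas (\<lambda>\<omega>. \<bar>f \<omega>\<bar>)"
  unfolding bmeas_def by auto

text \<open>The pointwise counterpart of measurability for the sigma-algebra of the coordinates in
  \<open>J\<close>; being exact, it gives identities for \<open>cE\<close> at every point.\<close>

definition dep :: "(nat + nat \<times> nat) set \<Rightarrow> ((nat + nat \<times> nat \<Rightarrow> real) \<Rightarrow> 'b) \<Rightarrow> bool" where
  "dep J f \<longleftrightarrow> (\<forall>\<omega> \<omega>'. (\<forall>i\<in>J. \<omega> i = \<omega>' i) \<longrightarrow> f \<omega> = f \<omega>')"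

lemma depD: "dep J f \<Longrightarrow> (\<And>i. i \<in> J \<Longrightarrow> \<omega> i = \<omega>' i) \<Longrightarrow> f \<omega> = f \<omega>'"
  unfolding dep_def by blast

lemma depI: "(\<And>\<omega> \<omega>'. (\<And>i. i \<in> J \<Longrightarrow> \<omega> i = \<omega>' i) \<Longrightarrow> f \<omega> = f \<omega>') \<Longrightarrow> dep J f"
  unfolding dep_def by blast

lemma dep_mono: "dep J f \<Longrightarrow> J \<subseteq> K \<Longrightarrow> dep K f"
  unfolding dep_def by blast

lemma dep_const [simp, intro]: "dep J (\<lambda>_. c)"
  unfolding dep_def by blast

lemma dep_comb2: "dep J f \<Longrightarrow> dep J g \<Longrightarrow> dep J (\<lambda>\<omega>. h (f \<omega>) (g \<omega>))"
  unfolding dep_def by metis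

lemma dep_add [intro]: "dep J f \<Longrightarrow> dep J g \<Longrightarrow> dep J (\<lambda>\<omega>. f \<omega> + g \<omega> :: real)"
  and dep_diff [intro]: "dep J f \<Longrightarrow> dep J g \<Longrightarrow> dep J (\<lambda>\<omega>. f \<omega> - g \<omega> :: real)"
  and dep_mult [intro]: "dep J f \<Longrightarrow> dep J g \<Longrightarrow> dep J (\<lambda>\<omega>. f \<omega> * g \<omega> :: real)"
  by (rule dep_comb2; assumption)+

lemma dep_sum [intro]: "(\<And>i. i \<in> A \<Longrightarrow> dep J (f i)) \<Longrightarrow> dep J (\<lambda>\<omega>. \<Sum>i\<in>A. f i \<omega> :: real)"
  by (intro depI sum.cong refl) (rule depD)

text \<open>Conditional expectation given the coordinates in \<open>C\<close>, realised pointwise by resampling the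
  remaining coordinates; this avoids sigma-algebras and almost-everywhere statements altogether.\<close>

definition cE :: "(nat + nat \<times> nat) set \<Rightarrow> ((nat + nat \<times> nat \<Rightarrow> real) \<Rightarrow> real)
    \<Rightarrow> (nat + nat \<times> nat \<Rightarrow> real) \<Rightarrow> real" where
  "cE C f \<omega> = (\<integral>\<omega>'. f (override_on \<omega>' \<omega> C) \<partial>Omega)"

lemma bmeas_override_on:
  assumes "bmeas f" shows "bmeas (\<lambda>\<omega>'. f (override_on \<omega>' \<omega> C))"
proof -
  obtain B where B: "\<And>\<omega>. \<bar>f \<omega>\<bar> \<le> B" using assms bmeas_bound by blast
  note [measurable] = bmeas_measurable[OF assms]
  show ?thesis by (rule bmeasI[of _ B]) (auto intro: B)
qed

lemma bmeas_cE [intro]: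
  assumes "bmeas f" shows "bmeas (cE C f)"
proof -
  obtain B where B: "0 \<le> B" "\<And>\<omega>. \<bar>f \<omega>\<bar> \<le> B" using assms bmeas_bound by blast
  note [measurable] = bmeas_measurable[OF assms]
  have "\<bar>cE C f \<omega>\<bar> \<le> B" for \<omega>
  proof -
    have "\<bar>cE C f \<omega>\<bar> \<le> (\<integral>\<omega>'. \<bar>f (override_on \<omega>' \<omega> C)\<bar> \<partial>Omega)"
      unfolding cE_def by (rule integral_abs_bound)
    also have "\<dots> \<le> (\<integral>\<omega>'. B \<partial>Omega)"
      by (rule integral_mono) (auto intro!: bmeas_integrable bmeas_override_on bmeas_abs assms B)
    finally show ?thesis by (simp add: Omega.prob_space)
  qed
  then show ?thesis
    by (intro bmeasI[of _ B]) (simp_all add: cE_def[abs_def])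
qed

text \<open>Total expectation: the coordinates in \<open>C\<close> drawn first and the others
  afterwards form one draw from \<open>Omega\<close> by \<open>distr_override_on\<close>, and Fubini
  separates the two stages.\<close>

lemma integral_cE:
  assumes "bmeas f" shows "(\<integral>\<omega>. cE C f \<omega> \<partial>Omega) = (\<integral>\<omega>. f \<omega> \<partial>Omega)"
proof -
  interpret pair_prob_space Omega Omega ..
  obtain B where B: "\<And>\<omega>. \<bar>f \<omega>\<bar> \<le> B" using assms bmeas_bound by blast
  note [measurable] = bmeas_measurable[OF assms]
  have "(\<integral>\<omega>. f \<omega> \<partial>Omega) = (\<integral>\<omega>. f \<omega> \<partial>distr (Omega \<Otimes>\<^sub>M Omega) Omega (\<lambda>(\<omega>, \<omega>'). override_on \<omega>' \<omega> C))"
    by (simp add: distr_override_on)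
  also have "\<dots> = (\<integral>z. f (override_on (snd z) (fst z) C) \<partial>(Omega \<Otimes>\<^sub>M Omega))"
    by (subst integral_distr) (auto simp: split_beta)
  also have "\<dots> = (\<integral>\<omega>. \<integral>\<omega>'. f (override_on \<omega>' \<omega> C) \<partial>Omega \<partial>Omega)"
    using B by (subst integral_fst'[symmetric]) (auto intro!: P.integrable_const_bound[of _ B])
  finally show ?thesis by (simp add: cE_def)
qed

lemma cE_empty: "cE {} f \<omega> = (\<integral>\<omega>. f \<omega> \<partial>Omega)"
  by (simp add: cE_def)

lemma cE_eq_self: "dep C f \<Longrightarrow> cE C f \<omega> = f \<omega>"
proof -
  assume "dep C f"
  then have "f (override_on \<omega>' \<omega> C) = f \<omega>" for \<omega>'
    by (rule depD) (simp add: override_on_def)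
  then show ?thesis by (simp add: cE_def Omega.prob_space)
qed

lemma cE_tower:
  assumes "bmeas f" "C \<subseteq> D" shows "cE C (cE D f) \<omega> = cE C f \<omega>"
proof -
  \<comment> \<open>Because \<open>C\<close> lies in \<open>D\<close>, freezing \<open>C\<close>
    commutes with resampling outside \<open>D\<close>, so the tower property is total expectation
    for the section with \<open>C\<close> frozen.\<close>
  have [simp]: "override_on \<omega>2 (override_on \<omega>1 \<omega> C) D = override_on (override_on \<omega>2 \<omega>1 D) \<omega> C" for \<omega>1 \<omega>2
    using assms(2) by (auto simp: override_on_def fun_eq_iff)
  have "cE C (cE D f) \<omega> = (\<integral>\<omega>'. cE D (\<lambda>\<omega>2. f (override_on \<omega>2 \<omega> C)) \<omega>' \<partial>Omega)"
    by (simp add: cE_def)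
  also have "\<dots> = cE C f \<omega>"
    by (subst integral_cE) (auto intro: bmeas_override_on assms simp: cE_def)
  finally show ?thesis .
qed

lemma cE_add: "bmeas f \<Longrightarrow> bmeas g \<Longrightarrow> cE C (\<lambda>\<omega>. f \<omega> + g \<omega>) \<omega> = cE C f \<omega> + cE C g \<omega>"
  and cE_diff: "bmeas f \<Longrightarrow> bmeas g \<Longrightarrow> cE C (\<lambda>\<omega>. f \<omega> - g \<omega>) \<omega> = cE C f \<omega> - cE C g \<omega>"
  by (simp_all add: cE_def bmeas_integrable bmeas_override_on)

lemma cE_sum: "(\<And>i. i \<in> A \<Longrightarrow> bmeas (f i)) \<Longrightarrow> cE C (\<lambda>\<omega>. \<Sum>i\<in>A. f i \<omega>) \<omega> = (\<Sum>i\<in>A. cE C (f i) \<omega>)"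
  by (simp add: cE_def bmeas_integrable bmeas_override_on)

lemma cE_const: "cE C (\<lambda>_. c) \<omega> = c"
  by (simp add: cE_def Omega.prob_space)

lemma cE_pull_out: "dep C f \<Longrightarrow> cE C (\<lambda>\<omega>. f \<omega> * g \<omega>) \<omega> = f \<omega> * cE C g \<omega>"
proof -
  assume "dep C f"
  then have "f (override_on \<omega>' \<omega> C) = f \<omega>" for \<omega>'
    by (rule depD) (simp add: override_on_def)
  then show ?thesis by (simp add: cE_def)
qed

lemma dep_override_on: "dep J f \<Longrightarrow> dep (J - C) (\<lambda>\<omega>'. f (override_on \<omega>' \<omega> C))"
  by (rule depI, erule depD) (simp add: override_on_def)

text \<open>Conditioning on \<open>J\<close> freezes \<open>f\<close>, while \<open>g\<close> does
  not see \<open>J\<close> and integrates to its mean.\<close>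

lemma integral_indep:
  assumes "bmeas f" "bmeas g" "dep J f" "dep K g" "J \<inter> K = {}"
  shows "(\<integral>\<omega>. f \<omega> * g \<omega> \<partial>Omega) = (\<integral>\<omega>. f \<omega> \<partial>Omega) * (\<integral>\<omega>. g \<omega> \<partial>Omega)"
proof -
  have "(\<integral>\<omega>. f \<omega> * g \<omega> \<partial>Omega) = (\<integral>\<omega>. cE J (\<lambda>\<omega>. f \<omega> * g \<omega>) \<omega> \<partial>Omega)"
    by (rule integral_cE[symmetric]) (intro bmeas_mult assms)
  also have "\<dots> = (\<integral>\<omega>. f \<omega> * cE J g \<omega> \<partial>Omega)"
    by (simp add: cE_pull_out[OF assms(3)])
  also have "\<dots> = (\<integral>\<omega>. f \<omega> * (\<integral>\<omega>. g \<omega> \<partial>Omega) \<partial>Omega)"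
  proof -
    have "g (override_on \<omega>' \<omega> J) = g \<omega>'" for \<omega> \<omega>'
      by (rule depD[OF assms(4)]) (use assms(5) in \<open>auto simp: override_on_def\<close>)
    then show ?thesis by (simp add: cE_def)
  qed
  finally show ?thesis by simp
qed

text \<open>With \<open>C\<close> frozen the two sections depend on \<open>J - C\<close> and
  \<open>K - C\<close>, which are disjoint, so conditional independence reduces to
  independence.\<close>

lemma cE_indep:
  assumes "bmeas f" "bmeas g" "dep J f" "dep K g" "J \<inter> K \<subseteq> C"
  shows "cE C (\<lambda>\<omega>. f \<omega> * g \<omega>) \<omega> = cE C f \<omega> * cE C g \<omega>"
  unfolding cE_def
  by (rule integral_indep[where J = "J - C" and K = "K - C"])
    (use assms in \<open>auto simp: bmeas_override_on dep_override_on\<close>)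

text \<open>The orthogonality criterion behind both variance bounds: it suffices that one factor is
  centred given a set \<open>C\<close> containing all shared coordinates.\<close>

lemma integral_mult_eq_0:
  assumes "bmeas f" "bmeas g" "dep J f" "dep K g" "J \<inter> K \<subseteq> C" "\<And>\<omega>. cE C f \<omega> = 0"
  shows "(\<integral>\<omega>. f \<omega> * g \<omega> \<partial>Omega) = 0"
  using integral_cE[OF bmeas_mult[OF assms(1,2)], of C] cE_indep[OF assms(1-5)] assms(6) by simp

section \<open>Counting words\<close>

lemma pos_nth: "distinct lam \<Longrightarrow> i < length lam \<Longrightarrow> pos lam (lam ! i) = i"
  unfolding pos_def by (rule the_equality) (auto simp: nth_eq_iff_index_eq)

lemma pos_less: "distinct lam \<Longrightarrow> q \<in> set lam \<Longrightarrow> pos lam q < length lam"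
  and nth_pos: "distinct lam \<Longrightarrow> q \<in> set lam \<Longrightarrow> lam ! pos lam q = q"
  by (auto simp: in_set_conv_nth pos_nth)

lemma finite_words [simp]: "finite (words n k)"
  unfolding words_def by (rule finite_subset[OF _ finite_lists_length_eq[of "{..<n}" k]]) auto

lemma finite_ext_words [simp]: "finite (ext_words n p l \<alpha>)"
  unfolding ext_words_def by auto

lemma ext_words_subset: "ext_words n p l \<alpha> \<subseteq> words n p"
  unfolding ext_words_def by auto

lemma ext_words_Nil: "ext_words n p [] [] = words n p"
  by (simp add: ext_words_def)

lemma words_nth_less: "\<beta> \<in> words n p \<Longrightarrow> i < p \<Longrightarrow> \<beta> ! i < n"
  unfolding words_def using nth_mem by fastforce

lemma words_nth_eq_iff: "\<beta> \<in> words n p \<Longrightarrow> i < p \<Longrightarrow> j < p \<Longrightarrow> \<beta> ! i = \<beta> ! j \<longleftrightarrow> i = j"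
  unfolding words_def by (auto simp: nth_eq_iff_index_eq)

lemma words_card_set: "\<beta> \<in> words n p \<Longrightarrow> card (set \<beta>) = p"
  by (auto simp: words_def distinct_card)

lemma words_length_le: "l \<in> words p k \<Longrightarrow> k \<le> p"
  using card_mono[of "{..<p}" "set l"] words_card_set[of l p k] by (auto simp: words_def)

text \<open>An extension is determined by its letters at the p - k unlabelled positions, and these
  form an arbitrary word of distinct letters outside \<alpha>. The resulting falling factorial
  depends on \<alpha> only through its length, which all later averaging identities exploit.\<close>

lemma card_ext_words:
  assumes l: "l \<in> words p k" and \<alpha>: "\<alpha> \<in> words n k" and "p \<le> n"
  shows "card (ext_words n p l \<alpha>) = \<Prod>{n - p + 1..n - k}"
proof -
  \<comment> \<open>\<open>c\<close> lists the unlabelled positions in increasing order;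
    \<open>?f\<close> reads off the letters there and \<open>?g\<close> puts them back between the
    prescribed ones.\<close>
  define c where "c = filter (\<lambda>i. i \<notin> set l) [0..<p]"
  define A where "A = {..<n} - set \<alpha>"
  let ?L = "{xs. length xs = p - k \<and> distinct xs \<and> set xs \<subseteq> A}"
  let ?f = "\<lambda>\<beta>. map ((!) \<beta>) c"
  let ?g = "\<lambda>\<gamma>. map (\<lambda>i. if i \<in> set l then \<alpha> ! pos l i else \<gamma> ! pos c i) [0..<p]"
  have dl: "distinct l" "length l = k" "set l \<subseteq> {..<p}" using l by (auto simp: words_def)
  have d\<alpha>: "distinct \<alpha>" "length \<alpha> = k" "set \<alpha> \<subseteq> {..<n}" using \<alpha> by (auto simp: words_def)
  have c: "distinct c" "set c = {..<p} - set l" by (auto simp: c_def)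
  have lenc: "length c = p - k"
    using c dl by (metis card_Diff_subset card_lessThan distinct_card finite_set)
  have "bij_betw ?f (ext_words n p l \<alpha>) ?L"
  proof (rule bij_betw_byWitness[where f' = ?g])
    show "\<forall>\<beta>\<in>ext_words n p l \<alpha>. ?g (?f \<beta>) = \<beta>"
    proof
      fix \<beta> assume b: "\<beta> \<in> ext_words n p l \<alpha>"
      then have len: "length \<beta> = p" and ext: "\<And>i. i < k \<Longrightarrow> \<beta> ! (l ! i) = \<alpha> ! i"
        using dl by (auto simp: ext_words_def words_def)
      show "?g (?f \<beta>) = \<beta>"
      proof (rule nth_equalityI)
        fix i assume "i < length (?g (?f \<beta>))"
        then have i: "i < p" by simp
        show "?g (?f \<beta>) ! i = \<beta> ! i"
          using i ext[of "pos l i"] c dl pos_less[of l i] nth_pos[of l i] pos_less[of c i] nth_pos[of c i]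
          by auto
      qed (simp add: len)
    qed
    show "\<forall>\<gamma>\<in>?L. ?f (?g \<gamma>) = \<gamma>"
    proof
      fix \<gamma> assume g: "\<gamma> \<in> ?L"
      show "?f (?g \<gamma>) = \<gamma>"
      proof (rule nth_equalityI)
        fix i assume "i < length (?f (?g \<gamma>))"
        then have i: "i < length c" by simp
        then have "c ! i \<in> {..<p} - set l" using c nth_mem by blast
        then show "?f (?g \<gamma>) ! i = \<gamma> ! i" using i c by (simp add: pos_nth)
      qed (use g lenc in simp)
    qed
    show "?f ` ext_words n p l \<alpha> \<subseteq> ?L"
    proof safe
      fix \<beta> assume b: "\<beta> \<in> ext_words n p l \<alpha>"
      then have w: "\<beta> \<in> words n p" and ext: "\<And>i. i < k \<Longrightarrow> \<beta> ! (l ! i) = \<alpha> ! i"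
        using dl by (auto simp: ext_words_def)
      show "length (?f \<beta>) = p - k" by (simp add: lenc)
      show "distinct (?f \<beta>)"
        using c words_nth_eq_iff[OF w] by (auto simp: distinct_map inj_on_def)
      fix x assume "x \<in> set (?f \<beta>)"
      then obtain i where i: "i < p" "i \<notin> set l" "x = \<beta> ! i" using c by auto
      have "x \<notin> set \<alpha>"
      proof
        assume "x \<in> set \<alpha>"
        then obtain j where j: "j < k" "x = \<alpha> ! j" using d\<alpha> by (metis in_set_conv_nth)
        then have "l ! j < p" "l ! j \<in> set l" using dl nth_mem by blast+
        have "\<beta> ! i = \<beta> ! (l ! j)" using i(3) j(2) ext[OF j(1)] by metis
        then have "i = l ! j" using words_nth_eq_iff[OF w i(1) \<open>l ! j < p\<close>] by blast
        then show False using i(2) \<open>l ! j \<in> set l\<close> by blast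
      qed
      then show "x \<in> A" using words_nth_less[OF w i(1)] i by (simp add: A_def)
    qed
    show "?g ` ?L \<subseteq> ext_words n p l \<alpha>"
    proof safe
      fix \<gamma> assume g: "length \<gamma> = p - k" "distinct \<gamma>" "set \<gamma> \<subseteq> A"
      have 1: "i \<in> set l \<Longrightarrow> \<alpha> ! pos l i \<in> set \<alpha>" for i using pos_less[of l i] dl d\<alpha> by auto
      have 2: "i < p \<Longrightarrow> i \<notin> set l \<Longrightarrow> \<gamma> ! pos c i \<in> A" for i
        using pos_less[of c i] c g lenc nth_mem[of "pos c i" \<gamma>] by auto
      have inj: "inj_on (\<lambda>i. if i \<in> set l then \<alpha> ! pos l i else \<gamma> ! pos c i) {..<p}"
      proof (rule inj_onI)
        fix i j assume ij: "i \<in> {..<p}" "j \<in> {..<p}"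
          and eq: "(if i \<in> set l then \<alpha> ! pos l i else \<gamma> ! pos c i) = (if j \<in> set l then \<alpha> ! pos l j else \<gamma> ! pos c j)"
        \<comment> \<open>Letters of \<alpha> and letters of \<open>A\<close> never coincide, so a
          labelled and an unlabelled position cannot collide.\<close>
        consider "i \<in> set l" "j \<in> set l" | "i \<notin> set l" "j \<notin> set l"
          using eq 1[of i] 1[of j] 2[of i] 2[of j] ij by (auto simp: A_def split: if_splits)
        then show "i = j"
        proof cases
          case 1
          then have "pos l i = pos l j"
            using eq d\<alpha> dl pos_less[of l] by (simp add: nth_eq_iff_index_eq)
          then show ?thesis using 1 dl nth_pos by metis
        next
          case 2
          then have ic: "i \<in> set c" "j \<in> set c" using ij c by auto
          then have "pos c i = pos c j"
            using 2 eq g c lenc pos_less[of c] by (simp add: nth_eq_iff_index_eq)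
          then show ?thesis using ic c nth_pos by metis
        qed
      qed
      have "?g \<gamma> \<in> words n p"
        using inj 1 2 d\<alpha>(3) by (auto simp: words_def distinct_map A_def lessThan_atLeast0 subset_iff)
      moreover have "?g \<gamma> ! (l ! i) = \<alpha> ! i" if "i < k" for i
      proof -
        have "l ! i \<in> set l" "l ! i < p" using that dl nth_mem[of i l] by blast+
        then show ?thesis using that dl by (simp add: pos_nth)
      qed
      ultimately show "?g \<gamma> \<in> ext_words n p l \<alpha>" using dl by (simp add: ext_words_def)
    qed
  qed
  then have "card (ext_words n p l \<alpha>) = card ?L" by (rule bij_betw_same_card)
  also have "\<dots> = \<Prod>{card A - (p - k) + 1..card A}"
  proof (rule card_lists_distinct_length_eq)
    show "finite A" by (simp add: A_def)
    have "card A = n - k" using d\<alpha> by (simp add: A_def card_Diff_subset distinct_card)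
    then show "p - k \<le> card A" using \<open>p \<le> n\<close> by simp
  qed
  also have "card A = n - k" using d\<alpha> by (simp add: A_def card_Diff_subset distinct_card)
  also have "n - k - (p - k) = n - p" using words_length_le[OF l] \<open>p \<le> n\<close> by simp
  finally show ?thesis .
qed

lemma card_ext_words_pos:
  assumes "l \<in> words p k" "\<alpha> \<in> words n k" "p \<le> n"
  shows "0 < card (ext_words n p l \<alpha>)"
  unfolding card_ext_words[OF assms] by (rule prod_pos) simp

lemma Nil_words [simp]: "[] \<in> words n 0"
  by (simp add: words_def)

lemma snoc_words: "l \<in> words p k \<Longrightarrow> c < p \<Longrightarrow> c \<notin> set l \<Longrightarrow> l @ [c] \<in> words p (Suc k)"
  by (simp add: words_def)

text \<open>Prescribing one more letter removes the top factor n - k of the falling factorial. The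
  product form avoids division of natural numbers.\<close>

lemma card_ext_words_snoc:
  assumes l: "l \<in> words p k" "c < p" "c \<notin> set l" and \<alpha>: "\<alpha> \<in> words n k" "v < n" "v \<notin> set \<alpha>"
    and "p \<le> n"
  shows "card (ext_words n p (l @ [c]) (\<alpha> @ [v])) * (n - k) = card (ext_words n p l \<alpha>)"
proof -
  have kp: "Suc k \<le> p" using words_length_le[OF snoc_words[OF l]] .
  then have "{n - p + 1..n - k} = insert (n - k) {n - p + 1..n - Suc k}" using \<open>p \<le> n\<close> by auto
  then have "\<Prod>{n - p + 1..n - k} = (n - k) * \<Prod>{n - p + 1..n - Suc k}"
    using kp \<open>p \<le> n\<close> by (subst \<open>_ = insert _ _\<close>, subst prod.insert) auto
  then show ?thesis
    using card_ext_words[OF snoc_words[OF l] snoc_words[OF \<alpha>] \<open>p \<le> n\<close>] card_ext_words[OF l(1) \<alpha>(1) \<open>p \<le> n\<close>]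
    by simp
qed

text \<open>Exhibits the extensions as a fibre of the map that reads off the letters at the labels,
  the form in which a sum over words can be grouped by label part.\<close>

lemma ext_words_eq:
  assumes l: "l \<in> words p k" and \<alpha>: "\<alpha> \<in> words n k"
  shows "ext_words n p l \<alpha> = {\<beta> \<in> words n p. map ((!) \<beta>) l = \<alpha>}"
  using assms by (auto simp: ext_words_def words_def list_eq_iff_nth_eq)

lemma map_nth_words:
  assumes l: "l \<in> words p k" and b: "\<beta> \<in> words n p"
  shows "map ((!) \<beta>) l \<in> words n k"
proof -
  have "set l \<subseteq> {..<p}" using l by (simp add: words_def)
  then show ?thesis
    using l words_nth_less[OF b] words_nth_eq_iff[OF b]
    by (auto simp: words_def distinct_map inj_on_def subset_iff)
qed

lemma sum_ext_words:
  fixes f :: "nat list \<Rightarrow> real"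
  assumes l: "l \<in> words p k"
  shows "(\<Sum>\<alpha>\<in>words n k. \<Sum>\<beta>\<in>ext_words n p l \<alpha>. f \<beta>) = (\<Sum>\<beta>\<in>words n p. f \<beta>)"
proof -
  have "(\<Sum>\<alpha>\<in>words n k. \<Sum>\<beta>\<in>ext_words n p l \<alpha>. f \<beta>)
      = (\<Sum>\<alpha>\<in>words n k. sum f {\<beta> \<in> words n p. map ((!) \<beta>) l = \<alpha>})"
    by (intro sum.cong refl) (simp add: ext_words_eq[OF l])
  also have "\<dots> = (\<Sum>\<beta>\<in>words n p. f \<beta>)"
    by (rule sum.group) (auto intro: map_nth_words[OF l])
  finally show ?thesis .
qed

text \<open>All fibres have equal size by \<open>card_ext_words\<close>, which is why an average
  over \<alpha> of averages over extensions is a plain average over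
  \<open>words n p\<close>.\<close>

lemma card_words_eq_mult:
  assumes l: "l \<in> words p k" and \<alpha>: "\<alpha> \<in> words n k" and pn: "p \<le> n"
  shows "real (card (words n p)) = real (card (words n k)) * real (card (ext_words n p l \<alpha>))"
proof -
  have "(\<Sum>\<beta>\<in>words n p. 1::real) = (\<Sum>\<alpha>'\<in>words n k. \<Sum>\<beta>\<in>ext_words n p l \<alpha>'. 1)"
    by (rule sum_ext_words[OF l, symmetric])
  also have "\<dots> = (\<Sum>\<alpha>'\<in>words n k. real (card (ext_words n p l \<alpha>)))"
    using card_ext_words[OF l _ pn] \<alpha> by (intro sum.cong) auto
  finally show ?thesis by simp
qed

lemma singleton_words: "i < p \<Longrightarrow> [i] \<in> words p (Suc 0)"
  by (simp add: words_def)

text \<open>By symmetry every vertex occupies position i in the same number of words, so averaging a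
  function of one letter over words is averaging it over vertices.\<close>

lemma sum_words_nth:
  fixes f :: "nat \<Rightarrow> real"
  assumes "i < p" "p \<le> n"
  shows "(\<Sum>\<beta>\<in>words n p. f (\<beta> ! i)) * real n = real (card (words n p)) * (\<Sum>v<n. f v)"
proof -
  have "(\<Sum>\<beta>\<in>words n p. f (\<beta> ! i)) = (\<Sum>v<n. \<Sum>\<beta>\<in>{\<beta> \<in> words n p. \<beta> ! i = v}. f (\<beta> ! i))"
    by (rule sum.group[symmetric]) (use words_nth_less assms in auto)
  also have "\<dots> = (\<Sum>v<n. real (card (ext_words n p [i] [v])) * f v)"
    by (rule sum.cong[OF refl], subst ext_words_eq[of _ _ "Suc 0"]) (use assms in \<open>auto simp: singleton_words\<close>)
  finally have "(\<Sum>\<beta>\<in>words n p. f (\<beta> ! i)) * real n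
      = (\<Sum>v<n. real (card (ext_words n p [i] [v]) * n) * f v)"
    by (simp add: sum_distrib_left mult_ac)
  also have "\<dots> = (\<Sum>v<n. real (card (words n p)) * f v)"
  proof (intro sum.cong refl)
    fix v assume "v \<in> {..<n}"
    then have "card (ext_words n p [i] [v]) * n = card (words n p)"
      using card_ext_words_snoc[of "[]" p 0 i "[]" n v] assms by (simp add: ext_words_Nil)
    then show "real (card (ext_words n p [i] [v]) * n) * f v = real (card (words n p)) * f v" by simp
  qed
  finally show ?thesis by (simp add: sum_distrib_left)
qed

text \<open>Union bound: a violating word carries at some unlabelled position c a letter v of
  \<beta> outside \<alpha>. There are at most \<open>p * p\<close> pairs (c, v), and each prescribes
  one more letter, leaving a fraction 1 / (n - k) of the extensions.\<close>

lemma card_ext_words_overlap: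
  assumes l: "l \<in> words p k" and \<alpha>: "\<alpha> \<in> words n k" and "p \<le> n"
    and b: "\<beta> \<in> ext_words n p l \<alpha>"
  shows "card {\<beta>' \<in> ext_words n p l \<alpha>. \<not> set \<beta> \<inter> set \<beta>' \<subseteq> set \<alpha>} * (n - k) \<le> p * p * card (ext_words n p l \<alpha>)"
proof -
  have w: "\<beta> \<in> words n p" using b by (simp add: ext_words_def)
  let ?B = "{\<beta>' \<in> ext_words n p l \<alpha>. \<not> set \<beta> \<inter> set \<beta>' \<subseteq> set \<alpha>}"
  let ?I = "({..<p} - set l) \<times> (set \<beta> - set \<alpha>)"
  let ?E = "\<lambda>(c, v). ext_words n p (l @ [c]) (\<alpha> @ [v])"
  have "?B \<subseteq> (\<Union>z\<in>?I. ?E z)"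
  proof
    fix \<beta>' assume b': "\<beta>' \<in> ?B"
    then obtain v where v: "v \<in> set \<beta>" "v \<in> set \<beta>'" "v \<notin> set \<alpha>" by auto
    then obtain c where c: "c < p" "\<beta>' ! c = v"
      using b' by (auto simp: ext_words_def words_def in_set_conv_nth)
    have "c \<notin> set l"
    proof
      assume "c \<in> set l"
      then obtain i where "i < k" "c = l ! i" using l by (auto simp: words_def in_set_conv_nth)
      then have "v = \<alpha> ! i" "i < length \<alpha>" using b' c l \<alpha> by (auto simp: ext_words_def words_def)
      then show False using v(3) nth_mem by blast
    qed
    moreover have "\<beta>' \<in> ?E (c, v)"
      using b' c l \<alpha> by (auto simp: ext_words_def words_def nth_append less_Suc_eq)
    ultimately show "\<beta>' \<in> (\<Union>z\<in>?I. ?E z)" using v c by blast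
  qed
  then have "card ?B * (n - k) \<le> card (\<Union>z\<in>?I. ?E z) * (n - k)"
    by (intro mult_right_mono card_mono) auto
  also have "\<dots> \<le> (\<Sum>z\<in>?I. card (?E z)) * (n - k)"
    by (intro mult_right_mono card_UN_le) auto
  also have "\<dots> = (\<Sum>z\<in>?I. card (?E z) * (n - k))"
    by (rule sum_distrib_right)
  also have "\<dots> = (\<Sum>z\<in>?I. card (ext_words n p l \<alpha>))"
  proof (intro sum.cong refl)
    fix z assume z: "z \<in> ?I"
    then have "snd z < n" using w by (auto simp: words_def)
    then show "card (?E z) * (n - k) = card (ext_words n p l \<alpha>)"
      using card_ext_words_snoc[OF l _ _ \<alpha> _ _ \<open>p \<le> n\<close>, of "fst z" "snd z"] z by (auto simp: split_beta)
  qed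
  also have "\<dots> = card ?I * card (ext_words n p l \<alpha>)" by simp
  also have "\<dots> \<le> p * p * card (ext_words n p l \<alpha>)"
  proof (rule mult_right_mono)
    have "card ({..<p} - set l) \<le> p" using card_mono[of "{..<p}" "{..<p} - set l"] by simp
    moreover have "card (set \<beta> - set \<alpha>) \<le> p"
      using card_mono[of "set \<beta>" "set \<beta> - set \<alpha>"] words_card_set[OF w] by simp
    ultimately show "card ?I \<le> p * p" by (simp add: card_cartesian_product mult_mono)
  qed simp
  finally show ?thesis .
qed

text \<open>The same union bound with two shared letters v, w at positions c, d of the second word:
  at most p^4 choices, each leaving a fraction 1 / (n (n - 1)) of the words. This quadratic rate
  makes the edge coins negligible.\<close>

lemma card_words_overlap2:
  assumes "p \<le> n" and b: "\<beta> \<in> words n p"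
  shows "card {\<beta>' \<in> words n p. 2 \<le> card (set \<beta> \<inter> set \<beta>')} * (n * (n - 1)) \<le> p ^ 4 * card (words n p)"
proof -
  let ?B = "{\<beta>' \<in> words n p. 2 \<le> card (set \<beta> \<inter> set \<beta>')}"
  let ?I = "{z \<in> ({..<p} \<times> {..<p}) \<times> (set \<beta> \<times> set \<beta>). fst (fst z) \<noteq> snd (fst z) \<and> fst (snd z) \<noteq> snd (snd z)}"
  let ?E = "\<lambda>z. ext_words n p [fst (fst z), snd (fst z)] [fst (snd z), snd (snd z)]"
  have finI: "finite ?I" by (rule finite_subset[of _ "({..<p} \<times> {..<p}) \<times> (set \<beta> \<times> set \<beta>)"]) auto
  have "?B \<subseteq> (\<Union>z\<in>?I. ?E z)"
  proof
    fix \<beta>' assume b': "\<beta>' \<in> ?B"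
    then have "\<not> card (set \<beta> \<inter> set \<beta>') \<le> Suc 0" by simp
    then obtain v w where vw: "v \<in> set \<beta>" "v \<in> set \<beta>'" "w \<in> set \<beta>" "w \<in> set \<beta>'" "v \<noteq> w"
      by (subst (asm) card_le_Suc0_iff_eq) auto
    then obtain c d where c: "c < p" "\<beta>' ! c = v" "d < p" "\<beta>' ! d = w"
      using b' by (auto simp: words_def in_set_conv_nth)
    have "\<beta>' \<in> ?E ((c, d), (v, w))"
      using b' c by (auto simp: ext_words_def less_Suc_eq)
    moreover have "((c, d), (v, w)) \<in> ?I" using vw c by auto
    ultimately show "\<beta>' \<in> (\<Union>z\<in>?I. ?E z)" by blast
  qed
  then have "card ?B * (n * (n - 1)) \<le> card (\<Union>z\<in>?I. ?E z) * (n * (n - 1))"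
    using finI by (intro mult_right_mono card_mono) auto
  also have "\<dots> \<le> (\<Sum>z\<in>?I. card (?E z)) * (n * (n - 1))"
    using finI by (intro mult_right_mono card_UN_le) auto
  also have "\<dots> = (\<Sum>z\<in>?I. card (?E z) * (n * (n - 1)))"
    by (rule sum_distrib_right)
  also have "\<dots> = (\<Sum>z\<in>?I. card (words n p))"
  proof (intro sum.cong refl)
    fix z assume z: "z \<in> ?I"
    obtain c d v w where [simp]: "z = ((c, d), (v, w))" by (metis surj_pair)
    have vw: "c < p" "d < p" "c \<noteq> d" "v < n" "w < n" "v \<noteq> w" using z b by (auto simp: words_def)
    have "card (ext_words n p [c, d] [v, w]) * (n - 1) = card (ext_words n p [c] [v])"
      using card_ext_words_snoc[of "[c]" p "Suc 0" d "[v]" n w] vw assms by (simp add: singleton_words)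
    moreover have "card (ext_words n p [c] [v]) * n = card (words n p)"
      using card_ext_words_snoc[of "[]" p 0 c "[]" n v] vw assms by (simp add: ext_words_Nil)
    ultimately show "card (?E z) * (n * (n - 1)) = card (words n p)"
      by (simp add: mult_ac)
  qed
  also have "\<dots> = card ?I * card (words n p)" by simp
  also have "\<dots> \<le> p ^ 4 * card (words n p)"
  proof (rule mult_right_mono)
    have "card ?I \<le> card (({..<p} \<times> {..<p}) \<times> (set \<beta> \<times> set \<beta>))"
      by (rule card_mono) auto
    also have "\<dots> = p ^ 4" by (simp add: card_cartesian_product words_card_set[OF b] eval_nat_numeral)
    finally show "card ?I \<le> p ^ 4" .
  qed simp
  finally show ?thesis .
qed

lemma words_nonempty: "p \<le> n \<Longrightarrow> words n p \<noteq> {}"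
  using card_ext_words_pos[of "[]" p 0 "[]" n] by (auto simp: ext_words_Nil)

section \<open>Edge products\<close>

lemma measure_unif_lessThan:
  assumes "0 \<le> w" "w \<le> 1" shows "measure unif {..<w} = w"
proof -
  have "{0..1} \<inter> {..<w} = {0..<w}" using assms by auto
  then show ?thesis
    unfolding unif_def using assms by (simp add: measure_uniform_measure)
qed

lemma integral_Omega_coord_less:
  assumes "0 \<le> w" "w \<le> 1"
  shows "(\<integral>\<omega>. of_bool (\<omega> c < w) \<partial>Omega) = (w :: real)"
proof -
  have 1: "(\<lambda>\<omega>. \<omega> c) \<in> measurable Omega unif"
    unfolding Omega_def by measurable
  have 2: "indicat_real {..<w} \<in> borel_measurable unif"
    by (rule borel_measurable_indicator) simp
  have "(\<integral>\<omega>. (of_bool (\<omega> c < w) :: real) \<partial>Omega) = (\<integral>x. indicator {..<w} x \<partial>distr Omega unif (\<lambda>\<omega>. \<omega> c))"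
    by (subst integral_distr[OF 1 2]) (simp add: indicator_def of_bool_def)
  also have "distr Omega unif (\<lambda>\<omega>. \<omega> c) = unif"
    unfolding Omega_def by (rule unifP.PiM_component) simp
  finally show ?thesis using measure_unif_lessThan[OF assms] by simp
qed

lemma distr_Omega_reindex:
  assumes "inj_on f J"
  shows "distr Omega (PiM J (\<lambda>_. unif)) (\<lambda>\<omega>. \<lambda>q\<in>J. \<omega> (f q)) = PiM J (\<lambda>_. unif)"
  unfolding Omega_def using distr_PiM_reindex[of UNIV "\<lambda>_. unif" f J] assms prob_space_unif by simp

text \<open>Carries integrals over the common space to those in \<open>tint\<close> and
  \<open>cube\<close>. Injectivity will come from the distinct letters of a word: distinct vertices
  have independent latent variables.\<close>

lemma integral_Omega_reindex:
  fixes h :: "('q \<Rightarrow> real) \<Rightarrow> real"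
  assumes "inj_on f J" and h: "h \<in> borel_measurable (PiM J (\<lambda>_. unif))"
  shows "(\<integral>\<omega>. h (\<lambda>q\<in>J. \<omega> (f q)) \<partial>Omega) = (\<integral>w. h w \<partial>PiM J (\<lambda>_. unif))"
proof -
  have [measurable]: "(\<lambda>\<omega>. \<lambda>q\<in>J. \<omega> (f q)) \<in> measurable Omega (PiM J (\<lambda>_. unif))"
    by (rule measurable_restrict) (simp add: measurable_cong_sets[OF refl sets_unif])
  show ?thesis
    by (subst distr_Omega_reindex[OF assms(1), symmetric]) (intro integral_distr[symmetric] h, measurable)
qed

lemma measurable_Gedge_arg:
  assumes W: "graphon W" and [measurable]: "f \<in> borel_measurable N" "h \<in> borel_measurable N"
  shows "(\<lambda>x. W (f x) (h x)) \<in> borel_measurable N"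
proof -
  have "(\<lambda>x. (f x, h x)) \<in> measurable N borel"
    by (simp add: borel_prod[symmetric])
  moreover have "(\<lambda>z. W (fst z) (snd z)) \<in> borel_measurable borel"
    using W unfolding graphon_def by blast
  ultimately show ?thesis
    using measurable_compose[of "\<lambda>x. (f x, h x)" N borel "\<lambda>z. W (fst z) (snd z)" borel] by simp
qed

lemma measurable_ext_pt:
  assumes "distinct lam" "\<And>i. i < length lam \<Longrightarrow> (\<lambda>x. f x i) \<in> borel_measurable N"
    "q \<notin> set lam \<Longrightarrow> (\<lambda>x. h x q) \<in> borel_measurable N"
  shows "(\<lambda>x. ext_pt lam (f x) (h x) q) \<in> borel_measurable N"
  using assms by (cases "q \<in> set lam") (simp_all add: ext_pt_def pos_less)

definition pairs :: "nat \<Rightarrow> (nat \<times> nat) set" where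
  "pairs p = {(i, j). i < j \<and> j < p}"

lemma finite_pairs: "finite (pairs p)"
  by (rule finite_subset[of _ "{..<p} \<times> {..<p}"]) (auto simp: pairs_def)

lemma measurable_prodW:
  assumes "graphon W" "E \<subseteq> pairs p" "\<And>q. q < p \<Longrightarrow> (\<lambda>x. f x q) \<in> borel_measurable N"
  shows "(\<lambda>x. prodW W E (f x)) \<in> borel_measurable N"
  unfolding prodW_def split_beta
proof (rule borel_measurable_prod)
  fix e assume "e \<in> E"
  then have "fst e < p" "snd e < p" using assms(2) by (auto simp: pairs_def)
  then show "(\<lambda>x. W (f x (fst e)) (f x (snd e))) \<in> borel_measurable N"
    by (intro measurable_Gedge_arg[OF assms(1)] assms(3))
qed

lemma prodW_bounds: "graphon W \<Longrightarrow> 0 \<le> prodW W E y \<and> prodW W E y \<le> 1"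
  unfolding prodW_def split_beta by (intro conjI prod_nonneg prod_le_1) (auto simp: graphon_def)

lemma prodW_cong:
  "E \<subseteq> pairs p \<Longrightarrow> (\<And>q. q < p \<Longrightarrow> y q = y' q) \<Longrightarrow> prodW W E y = prodW W E y'"
  unfolding prodW_def by (intro prod.cong refl) (auto simp: pairs_def)

lemma measurable_prodW_ext_pt:
  assumes "graphon W" "E \<subseteq> pairs p" "distinct lam"
    "\<And>i. i < length lam \<Longrightarrow> (\<lambda>x. f x i) \<in> borel_measurable N"
    "\<And>q. q < p \<Longrightarrow> q \<notin> set lam \<Longrightarrow> (\<lambda>x. h x q) \<in> borel_measurable N"
  shows "(\<lambda>x. prodW W E (ext_pt lam (f x) (h x))) \<in> borel_measurable N"
  by (rule measurable_prodW[OF assms(1,2)], rule measurable_ext_pt) (use assms in auto)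

lemma measurable_PiM_unif_component:
  "q \<in> J \<Longrightarrow> (\<lambda>w. w q) \<in> borel_measurable (PiM J (\<lambda>_. unif))"
  using measurable_component_singleton[of q J "\<lambda>_. unif"] by (simp cong: measurable_cong_sets)

lemma measurable_tint:
  assumes "graphon W" "E \<subseteq> pairs p" "distinct lam"
    "\<And>i. i < length lam \<Longrightarrow> (\<lambda>x. f x i) \<in> borel_measurable N"
  shows "(\<lambda>x. tint W E p lam (f x)) \<in> borel_measurable N"
proof -
  show ?thesis
    unfolding tint_def
    by (rule unifP.P.borel_measurable_lebesgue_integral, unfold split_beta,
        rule measurable_prodW_ext_pt[OF assms(1-3)])
      (auto intro!: measurable_compose[OF measurable_fst assms(4)]
        measurable_compose[OF measurable_snd measurable_PiM_unif_component])
qed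

lemma tint_bounds:
  assumes "graphon W" "E \<subseteq> pairs p" "distinct lam"
  shows "0 \<le> tint W E p lam z" "tint W E p lam z \<le> 1"
proof -
  have b: "0 \<le> prodW W E y" "prodW W E y \<le> 1" for y
    using prodW_bounds[OF assms(1)] by auto
  show "0 \<le> tint W E p lam z"
    unfolding tint_def by (rule integral_nonneg_AE) (simp add: b)
  have "(\<lambda>w. prodW W E (ext_pt lam z w)) \<in> borel_measurable (PiM ({..<p} - set lam) (\<lambda>_. unif))"
    by (rule measurable_prodW_ext_pt[OF assms]) (auto intro!: measurable_PiM_unif_component)
  then show "tint W E p lam z \<le> 1"
    unfolding tint_def
    by (intro unifP.P.integral_le_const unifP.P.integrable_const_bound[of _ 1]) (auto simp: b)
qed

lemma tint_cong:
  assumes "distinct lam" "\<And>i. i < length lam \<Longrightarrow> z i = z' i"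
  shows "tint W E p lam z = tint W E p lam z'"
proof -
  have "ext_pt lam z w = ext_pt lam z' w" for w
    using assms by (auto simp: ext_pt_def pos_less)
  then show ?thesis by (simp add: tint_def)
qed

text \<open>An edge between two labels does not involve the integrated variables, so its factor is
  constant under the integral.\<close>

lemma tint_pull_out:
  assumes "finite E" "E' \<subseteq> E" "E' \<subseteq> set lam \<times> set lam"
  shows "tint W E p lam z = (\<Prod>(i,j)\<in>E'. W (z (pos lam i)) (z (pos lam j))) * tint W (E - E') p lam z"
proof -
  have "prodW W E (ext_pt lam z w)
      = (\<Prod>(i,j)\<in>E'. W (z (pos lam i)) (z (pos lam j))) * prodW W (E - E') (ext_pt lam z w)" for w
  proof -
    have "prodW W E (ext_pt lam z w) = prodW W E' (ext_pt lam z w) * prodW W (E - E') (ext_pt lam z w)"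
      using prod.subset_diff[OF assms(2,1)] by (simp add: prodW_def mult.commute)
    also have "prodW W E' (ext_pt lam z w) = (\<Prod>(i,j)\<in>E'. W (z (pos lam i)) (z (pos lam j)))"
      unfolding prodW_def by (intro prod.cong refl) (use assms(3) in \<open>auto simp: ext_pt_def\<close>)
    finally show ?thesis .
  qed
  then show ?thesis by (simp add: tint_def)
qed

lemma tint_empty: "tint W {} p lam z = 1"
proof -
  show ?thesis using unifP.P.prob_space by (simp add: tint_def prodW_def)
qed

text \<open>Real-valued, so that disjoint edge sets multiply and \<open>t_inj\<close> is an average
  of these indicators (\<open>t_inj_eq\<close>).\<close>

definition gprod :: "(real \<Rightarrow> real \<Rightarrow> real) \<Rightarrow> (nat \<times> nat) set \<Rightarrow> nat list
    \<Rightarrow> (nat + nat \<times> nat \<Rightarrow> real) \<Rightarrow> real" where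
  "gprod W E \<beta> \<omega> = (\<Prod>(i,j)\<in>E. of_bool (Gedge W \<omega> (\<beta> ! i) (\<beta> ! j)))"

text \<open>The coin that \<open>Gedge\<close> reads for the image of \<open>e\<close>. The letters
  are sorted because \<beta> need not preserve the order of the endpoints.\<close>

definition edge_coord :: "nat list \<Rightarrow> nat \<times> nat \<Rightarrow> nat \<times> nat" where
  "edge_coord \<beta> e = (min (\<beta> ! fst e) (\<beta> ! snd e), max (\<beta> ! fst e) (\<beta> ! snd e))"

definition coords :: "(nat \<times> nat) set \<Rightarrow> nat list \<Rightarrow> (nat + nat \<times> nat) set" where
  "coords E \<beta> = Inl ` set \<beta> \<union> Inr ` edge_coord \<beta> ` E"

lemma gprod_bounds: "0 \<le> gprod W E \<beta> \<omega>" "gprod W E \<beta> \<omega> \<le> 1"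
  unfolding gprod_def split_beta by (intro prod_nonneg prod_le_1; simp)+

lemma Gedge_measurable:
  assumes W: "graphon W" shows "bmeas (\<lambda>\<omega>. of_bool (Gedge W \<omega> a b))"
proof (rule bmeasI[of _ 1])
  have [measurable]: "(\<lambda>\<omega>. W (\<omega> (Inl a)) (\<omega> (Inl b))) \<in> borel_measurable Omega"
    by (rule measurable_Gedge_arg[OF W]) auto
  show "(\<lambda>\<omega>. of_bool (Gedge W \<omega> a b)) \<in> borel_measurable Omega"
    unfolding Gedge_def Xv_def by measurable
qed simp

lemma bmeas_gprod: "graphon W \<Longrightarrow> bmeas (gprod W E \<beta>)"
  unfolding gprod_def[abs_def] split_beta by (intro bmeas_prod Gedge_measurable)

lemma dep_gprod:
  assumes "length \<beta> = p" "E \<subseteq> pairs p" shows "dep (coords E \<beta>) (gprod W E \<beta>)"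
proof (rule depI)
  fix \<omega> \<omega>' :: "nat + nat \<times> nat \<Rightarrow> real"
  assume eq: "\<And>c. c \<in> coords E \<beta> \<Longrightarrow> \<omega> c = \<omega>' c"
  have "Gedge W \<omega> (\<beta> ! i) (\<beta> ! j) = Gedge W \<omega>' (\<beta> ! i) (\<beta> ! j)" if "(i, j) \<in> E" for i j
  proof -
    have "i < length \<beta>" "j < length \<beta>" using that assms by (auto simp: pairs_def)
    then have "Inl (\<beta> ! i) \<in> coords E \<beta>" "Inl (\<beta> ! j) \<in> coords E \<beta>" by (auto simp: coords_def)
    moreover have "Inr (min (\<beta> ! i) (\<beta> ! j), max (\<beta> ! i) (\<beta> ! j)) \<in> coords E \<beta>"
      using that by (force simp: coords_def edge_coord_def)
    ultimately show ?thesis using eq by (simp add: Gedge_def Xv_def)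
  qed
  then show "gprod W E \<beta> \<omega> = gprod W E \<beta> \<omega>'"
    unfolding gprod_def by (intro prod.cong refl) auto
qed

text \<open>Equal coins mean equal unordered pairs of letters. As letters are distinct, the
  positions agree, and the swapped match contradicts the orientation i < j of both pairs.\<close>

lemma edge_coord_inj:
  assumes b: "\<beta> \<in> words n p" and "e \<in> pairs p" "e' \<in> pairs p" "edge_coord \<beta> e = edge_coord \<beta> e'"
  shows "e = e'"
proof -
  obtain i j i' j' where e: "e = (i, j)" "e' = (i', j')" by (metis surj_pair)
  have ij: "i < j" "j < p" "i' < j'" "j' < p" using assms e by (auto simp: pairs_def)
  have "\<beta> ! i = \<beta> ! i' \<and> \<beta> ! j = \<beta> ! j' \<or> \<beta> ! i = \<beta> ! j' \<and> \<beta> ! j = \<beta> ! i'"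
    using assms(4) e by (auto simp: edge_coord_def min_def max_def split: if_splits)
  then show ?thesis using ij e words_nth_eq_iff[OF b] by auto
qed

lemma cE_Gedge:
  assumes W: "graphon W" and "a \<noteq> b"
  shows "cE (range Inl) (\<lambda>\<omega>. of_bool (Gedge W \<omega> a b)) \<omega> = W (Xv \<omega> a) (Xv \<omega> b)"
proof -
  have "0 \<le> W (Xv \<omega> a) (Xv \<omega> b)" "W (Xv \<omega> a) (Xv \<omega> b) \<le> 1" using W by (auto simp: graphon_def)
  from integral_Omega_coord_less[OF this, of "Inr (min a b, max a b)"] \<open>a \<noteq> b\<close> show ?thesis
    by (simp add: cE_def Gedge_def Xv_def override_on_def image_iff)
qed

text \<open>Given all latent variables, different edges of the motif use different coins and are
  therefore independent, each with conditional mean W by \<open>cE_Gedge\<close>.\<close>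

lemma cE_gprod_range:
  assumes W: "graphon W" and b: "\<beta> \<in> words n p" and "E \<subseteq> pairs p"
  shows "cE (range Inl) (gprod W E \<beta>) \<omega> = prodW W E (\<lambda>i. Xv \<omega> (\<beta> ! i))"
proof -
  have len: "length \<beta> = p" using b by (simp add: words_def)
  have "finite E" using finite_subset[OF assms(3) finite_pairs] .
  then show ?thesis using assms(3)
  proof (induction E)
    case empty
    then show ?case by (simp add: gprod_def[abs_def] prodW_def cE_const)
  next
    case (insert e E)
    obtain i j where e: "e = (i, j)" by (metis surj_pair)
    have ij: "i < j" "j < p" using insert e by (auto simp: pairs_def)
    have gi: "gprod W {e} \<beta> = (\<lambda>\<omega>. of_bool (Gedge W \<omega> (\<beta> ! i) (\<beta> ! j)))"
      by (simp add: gprod_def fun_eq_iff e)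
    have "cE (range Inl) (gprod W (insert e E) \<beta>) \<omega> = cE (range Inl) (\<lambda>\<omega>. gprod W {e} \<beta> \<omega> * gprod W E \<beta> \<omega>) \<omega>"
      using insert by (simp add: gprod_def[abs_def])
    also have "\<dots> = cE (range Inl) (gprod W {e} \<beta>) \<omega> * cE (range Inl) (gprod W E \<beta>) \<omega>"
    proof (rule cE_indep)
      show "dep (coords {e} \<beta>) (gprod W {e} \<beta>)" "dep (coords E \<beta>) (gprod W E \<beta>)"
        using dep_gprod[OF len] insert.prems by auto
      have "edge_coord \<beta> e \<noteq> edge_coord \<beta> e'" if "e' \<in> E" for e'
        using edge_coord_inj[OF b, of e e'] that insert by auto
      then have "edge_coord \<beta> e \<notin> edge_coord \<beta> ` E" by blast
      then show "coords {e} \<beta> \<inter> coords E \<beta> \<subseteq> range Inl"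
        by (auto simp: coords_def simp del: image_eqI)
    qed (auto intro: bmeas_gprod W)
    also have "cE (range Inl) (gprod W {e} \<beta>) \<omega> = W (Xv \<omega> (\<beta> ! i)) (Xv \<omega> (\<beta> ! j))"
      unfolding gi by (rule cE_Gedge[OF W]) (use words_nth_eq_iff[OF b, of i j] ij in auto)
    finally show ?case using insert by (simp add: prodW_def e)
  qed
qed

text \<open>Two stages by the tower property: first the coins are averaged out, then the latent
  variables of the unlabelled letters, which are independent uniforms because \<beta> has distinct
  letters.\<close>

lemma cE_gprod:
  assumes W: "graphon W" and b: "\<beta> \<in> words n p" and E: "E \<subseteq> pairs p" and lam: "lam \<in> words p r"
  shows "cE (Inl ` set (map ((!) \<beta>) lam)) (gprod W E \<beta>) \<omega> = tint W E p lam (\<lambda>i. Xv \<omega> (\<beta> ! (lam ! i)))"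
proof -
  let ?C = "Inl ` set (map ((!) \<beta>) lam) :: (nat + nat \<times> nat) set"
  let ?z = "\<lambda>i. Xv \<omega> (\<beta> ! (lam ! i))"
  let ?J = "{..<p} - set lam"
  have lam': "distinct lam" "set lam \<subseteq> {..<p}" using lam by (auto simp: words_def)
  have "cE ?C (gprod W E \<beta>) \<omega> = cE ?C (cE (range Inl) (gprod W E \<beta>)) \<omega>"
    by (rule cE_tower[symmetric]) (auto intro: bmeas_gprod W)
  also have "\<dots> = (\<integral>\<omega>'. prodW W E (\<lambda>i. Xv (override_on \<omega>' \<omega> ?C) (\<beta> ! i)) \<partial>Omega)"
    by (subst cE_def) (simp only: cE_gprod_range[OF W b E])
  also have "\<dots> = (\<integral>\<omega>'. prodW W E (ext_pt lam ?z (\<lambda>q\<in>?J. \<omega>' (Inl (\<beta> ! q)))) \<partial>Omega)"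
  proof (intro Bochner_Integration.integral_cong refl prodW_cong[OF E])
    fix \<omega>' :: "nat + nat \<times> nat \<Rightarrow> real" and q assume q: "q < p"
    show "Xv (override_on \<omega>' \<omega> ?C) (\<beta> ! q) = ext_pt lam ?z (\<lambda>q\<in>?J. \<omega>' (Inl (\<beta> ! q))) q"
    proof (cases "q \<in> set lam")
      case True
      then show ?thesis using lam' by (auto simp: ext_pt_def nth_pos Xv_def override_on_def)
    next
      case False
      then have "\<beta> ! q \<notin> (!) \<beta> ` set lam"
        using words_nth_eq_iff[OF b q] lam' by auto
      then show ?thesis using False q by (auto simp: ext_pt_def Xv_def override_on_def)
    qed
  qed
  also have "\<dots> = tint W E p lam ?z"
    unfolding tint_def
  proof (rule integral_Omega_reindex)
    show "inj_on (\<lambda>q. Inl (\<beta> ! q)) ?J"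
      using words_nth_eq_iff[OF b] by (auto simp: inj_on_def)
    show "(\<lambda>w. prodW W E (ext_pt lam ?z w)) \<in> borel_measurable (PiM ?J (\<lambda>_. unif))"
      by (rule measurable_prodW_ext_pt[OF W E lam'(1)]) (auto intro!: measurable_PiM_unif_component)
  qed
  finally show ?thesis .
qed

lemma cE_cube:
  assumes \<alpha>: "\<alpha> \<in> words n k" and h: "h \<in> borel_measurable (cube k)"
    and hc: "\<And>x y. (\<And>i. i < k \<Longrightarrow> x i = y i) \<Longrightarrow> h x = h y"
    and C: "\<And>i. i < k \<Longrightarrow> Inl (\<alpha> ! i) \<in> C \<longleftrightarrow> i \<in> I"
  shows "cE C (\<lambda>\<omega>. h (\<lambda>i. Xv \<omega> (\<alpha> ! i))) \<omega> = (\<integral>x. h (override_on x (\<lambda>i. Xv \<omega> (\<alpha> ! i)) I) \<partial>cube k)"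
proof -
  let ?o = "\<lambda>x. override_on x (\<lambda>i. Xv \<omega> (\<alpha> ! i)) I"
  have "cE C (\<lambda>\<omega>. h (\<lambda>i. Xv \<omega> (\<alpha> ! i))) \<omega> = (\<integral>\<omega>'. h (?o (\<lambda>q\<in>{..<k}. \<omega>' (Inl (\<alpha> ! q)))) \<partial>Omega)"
    unfolding cE_def
    by (intro Bochner_Integration.integral_cong refl hc) (auto simp: override_on_def Xv_def C)
  also have "\<dots> = (\<integral>x. h (?o x) \<partial>cube k)"
    unfolding cube_def
  proof (rule integral_Omega_reindex)
    show "inj_on (\<lambda>q. Inl (\<alpha> ! q)) {..<k}"
      using words_nth_eq_iff[OF \<alpha>] by (auto simp: inj_on_def)
    \<comment> \<open>\<open>?o x\<close> may be non-extensional, hence outside the space on which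
      \<open>h\<close> is known to be measurable; restricting it to the first k coordinates leaves
      the value of \<open>h\<close> unchanged.\<close>
    have eq: "h (?o x) = h (\<lambda>i\<in>{..<k}. ?o x i)" for x by (rule hc) simp
    have "(\<lambda>x. \<lambda>i\<in>{..<k}. ?o x i) \<in> measurable (PiM {..<k} (\<lambda>_. unif)) (PiM {..<k} (\<lambda>_. unif))"
      by (rule measurable_restrict) (simp add: override_on_def)
    from measurable_compose[OF this h[unfolded cube_def]]
    show "(\<lambda>x. h (?o x)) \<in> borel_measurable (PiM {..<k} (\<lambda>_. unif))"
      by (subst eq)
  qed
  finally show ?thesis .
qed

section \<open>A quadratic Taylor bound and limit theorems\<close>

text \<open>The Euclidean norm is at most the sum of the absolute coordinates, each of which is a
  row product controlled by Cauchy-Schwarz. The dimension factor is crude but harmless.\<close>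

lemma onorm_matrix_vector_le:
  fixes A :: "real ^ 'n ^ 'm"
  shows "onorm (\<lambda>h. A *v h) \<le> real CARD('m) * norm A"
proof (rule onorm_bound)
  fix h :: "real ^ 'n"
  have "norm (A *v h) \<le> (\<Sum>i\<in>UNIV. \<bar>(A *v h) $ i\<bar>)" by (rule norm_le_l1_cart)
  also have "\<dots> \<le> (\<Sum>i\<in>(UNIV::'m set). norm A * norm h)"
  proof (rule sum_mono)
    fix i :: 'm
    have "\<bar>(A *v h) $ i\<bar> \<le> norm (A $ i) * norm h"
      unfolding matrix_vector_mul_component by (rule Cauchy_Schwarz_ineq2)
    also have "\<dots> \<le> norm A * norm h"
      by (intro mult_right_mono Finite_Cartesian_Product.norm_nth_le) simp
    finally show "\<bar>(A *v h) $ i\<bar> \<le> norm A * norm h" .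
  qed
  finally show "norm (A *v h) \<le> real CARD('m) * norm A * norm h" by simp
qed simp

text \<open>A Hessian bounded on the compact set makes \<open>nabla\<close> Lipschitz on the convex
  set; the mean value inequality for g minus its linear part then costs the Lipschitz constant times
  the squared distance.\<close>

lemma taylor_quadratic_bound:
  fixes g :: "real ^ 'd \<Rightarrow> real" and H :: "real ^ 'd \<Rightarrow> real ^ 'd ^ 'd"
  assumes "convex K" "compact K" "K \<subseteq> S"
    and g: "\<And>x. x \<in> S \<Longrightarrow> (g has_derivative (\<lambda>h. nabla x \<bullet> h)) (at x)"
    and nabla: "\<And>x. x \<in> S \<Longrightarrow> (nabla has_derivative (\<lambda>h. H x *v h)) (at x)"
    and H: "continuous_on S H"
  obtains B where "0 \<le> B"
    "\<And>x y. x \<in> K \<Longrightarrow> y \<in> K \<Longrightarrow> \<bar>g y - g x - nabla x \<bullet> (y - x)\<bar> \<le> B * (norm (y - x))\<^sup>2"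
proof -
  have "compact (H ` K)"
    by (intro compact_continuous_image continuous_on_subset[OF H]) fact+
  then obtain B0 where B0: "\<And>x. x \<in> K \<Longrightarrow> norm (H x) \<le> B0"
    using compact_imp_bounded bounded_iff by (metis imageI)
  \<comment> \<open>The maximum keeps \<open>B\<close> nonnegative also for empty \<open>K\<close>,
    where \<open>B0\<close> is arbitrary.\<close>
  define B where "B = max 0 (real CARD('d) * B0)"
  have lip: "norm (nabla u - nabla x) \<le> B * norm (u - x)" if "u \<in> K" "x \<in> K" for u x
  proof (rule differentiable_bound[OF \<open>convex K\<close> _ _ that])
    fix x assume x: "x \<in> K"
    show "(nabla has_derivative (\<lambda>h. H x *v h)) (at x within K)"
      using nabla x \<open>K \<subseteq> S\<close> has_derivative_at_withinI by blast
    have "onorm (\<lambda>h. H x *v h) \<le> real CARD('d) * norm (H x)" by (rule onorm_matrix_vector_le)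
    also have "\<dots> \<le> real CARD('d) * B0" using B0[OF x] by (intro mult_left_mono) auto
    finally show "onorm (\<lambda>h. H x *v h) \<le> B" by (simp add: B_def)
  qed
  show ?thesis
  proof
    show "0 \<le> B" by (simp add: B_def)
    fix x y assume xy: "x \<in> K" "y \<in> K"
    let ?T = "closed_segment x y"
    have T: "?T \<subseteq> K" using xy \<open>convex K\<close> by (simp add: closed_segment_subset)
    have "norm (g y - g x - nabla x \<bullet> (y - x)) \<le> norm (y - x) * (B * norm (y - x))"
    proof (rule differentiable_bound_linearization[where S = ?T and f' = "\<lambda>u h. nabla u \<bullet> h"])
      show "x + t *\<^sub>R (y - x) \<in> ?T" if "t \<in> {0..1}" for t :: real
        using that by (auto simp: closed_segment_def algebra_simps intro!: exI[of _ t])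
      show "(g has_derivative (\<lambda>h. nabla u \<bullet> h)) (at u within ?T)" if "u \<in> ?T" for u
        using that g T \<open>K \<subseteq> S\<close> has_derivative_at_withinI by blast
      fix u assume u: "u \<in> ?T"
      show "onorm ((\<lambda>h. nabla u \<bullet> h) - (\<lambda>h. nabla x \<bullet> h)) \<le> B * norm (y - x)"
      proof (rule onorm_bound)
        show "0 \<le> B * norm (y - x)" by (simp add: B_def)
        fix h
        have "norm (((\<lambda>h. nabla u \<bullet> h) - (\<lambda>h. nabla x \<bullet> h)) h) = \<bar>(nabla u - nabla x) \<bullet> h\<bar>"
          by (simp add: inner_diff_left)
        also have "\<dots> \<le> norm (nabla u - nabla x) * norm h" by (rule Cauchy_Schwarz_ineq2)
        also have "\<dots> \<le> (B * norm (u - x)) * norm h"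
          using lip[of u x] u T xy by (intro mult_right_mono) auto
        also have "\<dots> \<le> (B * norm (y - x)) * norm h"
          using segment_bound1[OF u] by (intro mult_right_mono mult_left_mono) (auto simp: B_def)
        finally show "norm (((\<lambda>h. nabla u \<bullet> h) - (\<lambda>h. nabla x \<bullet> h)) h) \<le> B * norm (y - x) * norm h" .
      qed
    qed simp
    then show "\<bar>g y - g x - nabla x \<bullet> (y - x)\<bar> \<le> B * (norm (y - x))\<^sup>2"
      by (simp add: power2_eq_square mult_ac)
  qed
qed

section \<open>Characteristic functions and the central limit theorem\<close>

lemma norm_iexp_diff_le: "norm (iexp a - iexp b) \<le> \<bar>a - b\<bar>"
proof -
  have "iexp a - iexp b = iexp b * (iexp (a - b) - 1)"
    by (simp add: algebra_simps exp_add[symmetric])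
  then have "norm (iexp a - iexp b) = 2 * \<bar>sin ((a - b) / 2)\<bar>"
    using dist_exp_i_1[of "a - b"] by (simp add: norm_mult)
  also have "\<dots> \<le> 2 * \<bar>(a - b) / 2\<bar>"
    using abs_sin_x_le_abs_x[of "(a - b) / 2"] by linarith
  finally show ?thesis by simp
qed

text \<open>A Slutsky-type statement: the characteristic functions at t differ by at most |t| times
  the L1 distance, so Levy's continuity theorem transfers the limit from \<open>Z\<close> to
  \<open>Y\<close>.\<close>

lemma (in prob_space) weak_conv_m_L1_perturb:
  fixes Y Z :: "nat \<Rightarrow> 'a \<Rightarrow> real"
  assumes Y: "\<And>n. random_variable borel (Y n)" and Z: "\<And>n. random_variable borel (Z n)"
    and int: "\<And>n. integrable M (\<lambda>\<omega>. \<bar>Y n \<omega> - Z n \<omega>\<bar>)"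
    and lim: "(\<lambda>n. expectation (\<lambda>\<omega>. \<bar>Y n \<omega> - Z n \<omega>\<bar>)) \<longlonglongrightarrow> 0"
    and conv: "weak_conv_m (\<lambda>n. distr M borel (Z n)) \<mu>" and \<mu>: "real_distribution \<mu>"
  shows "weak_conv_m (\<lambda>n. distr M borel (Y n)) \<mu>"
proof (rule levy_continuity)
  note [measurable] = Y Z
  show "real_distribution (distr M borel (Y n))" for n by simp
  fix t
  have char: "char (distr M borel X) t = (CLINT \<omega>|M. iexp (t * X \<omega>))"
    if [measurable]: "random_variable borel X" for X
    unfolding char_def by (subst integral_distr) auto
  have int_iexp: "complex_integrable M (\<lambda>\<omega>. iexp (t * X \<omega>))"
    if [measurable]: "random_variable borel X" for X
    by (rule integrable_const_bound[of _ 1]) auto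
  have "norm (char (distr M borel (Y n)) t - char (distr M borel (Z n)) t)
      \<le> \<bar>t\<bar> * expectation (\<lambda>\<omega>. \<bar>Y n \<omega> - Z n \<omega>\<bar>)" for n
  proof -
    have "norm (char (distr M borel (Y n)) t - char (distr M borel (Z n)) t)
        = norm (CLINT \<omega>|M. iexp (t * Y n \<omega>) - iexp (t * Z n \<omega>))"
      by (simp only: char Y Z Bochner_Integration.integral_diff[OF int_iexp[OF Y] int_iexp[OF Z]])
    also have "\<dots> \<le> (\<integral>\<omega>. norm (iexp (t * Y n \<omega>) - iexp (t * Z n \<omega>)) \<partial>M)"
      by (rule integral_norm_bound)
    also have "\<dots> \<le> (\<integral>\<omega>. \<bar>t\<bar> * \<bar>Y n \<omega> - Z n \<omega>\<bar> \<partial>M)"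
    proof (rule integral_mono)
      show "integrable M (\<lambda>\<omega>. norm (iexp (t * Y n \<omega>) - iexp (t * Z n \<omega>)))"
        by (intro integrable_norm Bochner_Integration.integrable_diff int_iexp Y Z)
      show "norm (iexp (t * Y n \<omega>) - iexp (t * Z n \<omega>)) \<le> \<bar>t\<bar> * \<bar>Y n \<omega> - Z n \<omega>\<bar>" for \<omega>
        using norm_iexp_diff_le[of "t * Y n \<omega>" "t * Z n \<omega>"]
        by (simp only: abs_mult[symmetric] right_diff_distrib)
    qed (use int in simp)
    finally show ?thesis by simp
  qed
  note bound = this
  have "(\<lambda>n. char (distr M borel (Y n)) t - char (distr M borel (Z n)) t) \<longlonglongrightarrow> 0"
    by (rule Lim_null_comparison[OF always_eventually[OF allI[OF bound]] tendsto_mult_right_zero[OF lim]])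
  moreover have "(\<lambda>n. char (distr M borel (Z n)) t) \<longlonglongrightarrow> char \<mu> t"
    by (rule levy_continuity1[OF _ \<mu> conv]) simp
  ultimately have "(\<lambda>n. (char (distr M borel (Y n)) t - char (distr M borel (Z n)) t)
      + char (distr M borel (Z n)) t) \<longlonglongrightarrow> 0 + char \<mu> t"
    by (rule tendsto_add)
  then show "(\<lambda>n. char (distr M borel (Y n)) t) \<longlonglongrightarrow> char \<mu> t" by simp
qed (rule \<mu>)

lemma real_distribution_normal_law:
  assumes "0 \<le> v" shows "real_distribution (normal_law v)"
proof (cases "v = 0")
  case True
  have "prob_space (return borel (0::real))" by (rule prob_space_return) simp
  with True show ?thesis
    by (auto simp: normal_law_def real_distribution_def real_distribution_axioms_def)
next
  case False
  then have "prob_space (density lborel (normal_density 0 (sqrt v)))"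
    using assms by (intro prob_space_normal_density) simp
  with False show ?thesis
    by (auto simp: normal_law_def real_distribution_def real_distribution_axioms_def)
qed

text \<open>Serves to compare characteristic functions: that of the scaled law at t is the standard
  one at \<open>s * t\<close>.\<close>

lemma normal_law_eq_distr:
  assumes "0 < s" shows "normal_law (s\<^sup>2) = distr std_normal_distribution borel (\<lambda>x. s * x)"
proof -
  interpret N: prob_space std_normal_distribution
    by (rule prob_space_normal_density) simp
  have "distributed std_normal_distribution lborel (\<lambda>x. x) std_normal_density"
    unfolding distributed_def by (auto simp: distr_id2)
  then have "distributed std_normal_distribution lborel (\<lambda>x. 0 + s * x) (normal_density (0 + s * 0) (\<bar>s\<bar> * 1))"
    by (rule N.normal_density_affine) (use assms in auto)
  then have "distr std_normal_distribution lborel (\<lambda>x. s * x) = density lborel (normal_density 0 s)"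
    using assms by (simp add: distributed_def)
  moreover have "distr std_normal_distribution borel (\<lambda>x. s * x) = distr std_normal_distribution lborel (\<lambda>x. s * x)"
    by (rule distr_cong) auto
  ultimately show ?thesis using assms by (simp add: normal_law_def)
qed

text \<open>Variance zero has to be covered, since the projections may be constant: then all
  \<open>X n\<close> vanish almost surely and every normalised sum already has the point mass as its
  law. Otherwise the standard theorem applies after rescaling.\<close>

lemma (in prob_space) central_limit_theorem_normal_law:
  fixes X :: "nat \<Rightarrow> 'a \<Rightarrow> real"
  assumes indep: "indep_vars (\<lambda>i. borel) X UNIV"
    and mean: "\<And>n. expectation (X n) = 0"
    and sq: "\<And>n. integrable M (\<lambda>x. (X n x)\<^sup>2)"
    and var: "\<And>n. expectation (\<lambda>x. (X n x)\<^sup>2) = v"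
    and distr: "\<And>n. distr M borel (X n) = \<mu>"
  shows "weak_conv_m (\<lambda>n. distr M borel (\<lambda>x. (\<Sum>i<n. X i x) / sqrt (real n))) (normal_law v)"
proof (cases "v = 0")
  case True
  have X[measurable]: "random_variable borel (X n)" for n
    using indep unfolding indep_vars_def2 by simp
  have "AE x in M. (X n x)\<^sup>2 = 0" for n
    using integral_nonneg_eq_0_iff_AE[OF sq, of n] var[of n] True by simp
  then have "AE x in M. \<forall>n. X n x = 0" by (simp add: AE_all_countable)
  then have "AE x in M. (\<Sum>i<n. X i x) / sqrt (real n) = 0" for n
    by eventually_elim simp
  then have "distr M borel (\<lambda>x. (\<Sum>i<n. X i x) / sqrt (real n)) = distr M borel (\<lambda>x. 0)" for n
    by (intro distr_cong_AE) auto
  also have "distr M borel (\<lambda>x. 0::real) = normal_law v"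
    using True by (simp add: normal_law_def distr_const)
  finally show ?thesis by (simp add: weak_conv_m_def weak_conv_def)
next
  case False
  have X[measurable]: "random_variable borel (X n)" for n
    using indep unfolding indep_vars_def2 by simp
  have "0 \<le> v" using var[of 0] by (metis Bochner_Integration.integral_nonneg zero_le_power2)
  define s where "s = sqrt v"
  have s: "0 < s" "v = s\<^sup>2" using False \<open>0 \<le> v\<close> by (auto simp: s_def)
  let ?S = "\<lambda>n x. (\<Sum>i<n. X i x) / sqrt (real n * s\<^sup>2)"
  have clt: "weak_conv_m (\<lambda>n. distr M borel (?S n)) std_normal_distribution"
    using mean sq var s by (intro central_limit_theorem_zero_mean[OF indep _ s(1) _ _ distr]) auto
  have [measurable]: "?S n \<in> borel_measurable M" for n by measurable
  show ?thesis
    unfolding s(2)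
  proof (rule levy_continuity)
    show "real_distribution (normal_law (s\<^sup>2))" by (rule real_distribution_normal_law) simp
    fix t
    \<comment> \<open>Normalising by sqrt(n s^2) instead of sqrt n is undone by evaluating the
      characteristic function at \<open>s * t\<close>.\<close>
    have "(\<lambda>n. char (distr M borel (?S n)) (s * t)) \<longlonglongrightarrow> char std_normal_distribution (s * t)"
      by (rule levy_continuity1[OF _ real_dist_normal_dist clt]) simp
    moreover have "char (distr M borel (?S n)) (s * t) = char (distr M borel (\<lambda>x. (\<Sum>i<n. X i x) / sqrt (real n))) t" for n
      unfolding char_def using s
      by (subst (1 2) integral_distr) (auto simp: real_sqrt_mult mult_ac)
    moreover have "char std_normal_distribution (s * t) = char (normal_law (s\<^sup>2)) t"
      unfolding char_def normal_law_eq_distr[OF s(1)] by (subst integral_distr) (auto simp: mult_ac)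
    ultimately show "(\<lambda>n. char (distr M borel (\<lambda>x. (\<Sum>i<n. X i x) / sqrt (real n))) t) \<longlonglongrightarrow> char (normal_law (s\<^sup>2)) t"
      by simp
  qed simp
qed

lemma distr_Omega_component: "distr Omega borel (\<lambda>\<omega>. \<omega> c) = unif"
proof -
  have "distr Omega borel (\<lambda>\<omega>. \<omega> c) = distr Omega unif (\<lambda>\<omega>. \<omega> c)"
    by (rule distr_cong) auto
  also have "\<dots> = unif"
    unfolding Omega_def by (rule unifP.PiM_component) simp
  finally show ?thesis .
qed

lemma integral_Xv:
  "f \<in> borel_measurable borel \<Longrightarrow> (\<integral>\<omega>. f (Xv \<omega> v) \<partial>Omega) = (\<integral>u. f u \<partial>unif)" for f :: "real \<Rightarrow> real"
  using distr_Omega_component[of "Inl v"] integral_distr[of "\<lambda>\<omega>. \<omega> (Inl v)" Omega borel f]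
  by (simp add: Xv_def)

lemma indep_vars_Xv: "Omega.indep_vars (\<lambda>_. borel) (\<lambda>i \<omega>. Xv \<omega> i) UNIV"
proof -
  have X: "(\<lambda>\<omega>. Xv \<omega> i) \<in> borel_measurable Omega" for i
    unfolding Xv_def by simp
  have "distr Omega (PiM UNIV (\<lambda>_. borel)) (\<lambda>\<omega>. \<lambda>i\<in>UNIV. Xv \<omega> i)
      = distr Omega (PiM UNIV (\<lambda>_. unif)) (\<lambda>\<omega>. \<lambda>i\<in>UNIV. \<omega> (Inl i))"
    by (rule distr_cong) (auto simp: Xv_def intro!: sets_PiM_cong)
  also have "\<dots> = PiM UNIV (\<lambda>_. unif)"
    by (rule distr_Omega_reindex) simp
  also have "\<dots> = PiM UNIV (\<lambda>i. distr Omega borel (\<lambda>\<omega>. Xv \<omega> i))"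
    unfolding Xv_def distr_Omega_component ..
  finally show ?thesis
    using X by (subst Omega.indep_vars_iff_distr_eq_PiM) auto
qed

lemma Omega_central_limit_theorem:
  assumes [measurable]: "\<theta> \<in> borel_measurable borel" and B: "\<And>u. \<bar>\<theta> u\<bar> \<le> B"
    and mean: "(\<integral>u. \<theta> u \<partial>unif) = 0"
  shows "weak_conv_m (\<lambda>n. distr Omega borel (\<lambda>\<omega>. (\<Sum>i<n. \<theta> (Xv \<omega> i)) / sqrt (real n)))
    (normal_law (\<integral>u. (\<theta> u)\<^sup>2 \<partial>unif))"
proof (rule Omega.central_limit_theorem_normal_law)
  have [measurable]: "(\<lambda>\<omega>. Xv \<omega> i) \<in> borel_measurable Omega" for i unfolding Xv_def by simp
  show "Omega.indep_vars (\<lambda>i. borel) (\<lambda>n \<omega>. \<theta> (Xv \<omega> n)) UNIV"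
    by (rule Omega.indep_vars_compose2[OF indep_vars_Xv]) simp
  show "(\<integral>\<omega>. \<theta> (Xv \<omega> n) \<partial>Omega) = 0" for n using integral_Xv[of \<theta> n] mean by simp
  show "(\<integral>\<omega>. (\<theta> (Xv \<omega> n))\<^sup>2 \<partial>Omega) = (\<integral>u. (\<theta> u)\<^sup>2 \<partial>unif)" for n using integral_Xv[of "\<lambda>u. (\<theta> u)\<^sup>2" n] by simp
  have "bmeas (\<lambda>\<omega>. \<theta> (Xv \<omega> n))" for n by (rule bmeasI[OF _ B]) simp
  then show "integrable Omega (\<lambda>\<omega>. (\<theta> (Xv \<omega> n))\<^sup>2)" for n by (intro bmeas_integrable bmeas_power)
  show "distr Omega borel (\<lambda>\<omega>. \<theta> (Xv \<omega> n)) = distr unif borel \<theta>" for n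
    using distr_distr[of \<theta> borel borel "\<lambda>\<omega>. Xv \<omega> n" Omega] distr_Omega_component[of "Inl n"]
    by (simp add: comp_def Xv_def)
qed

section \<open>Hoeffding decomposition of the linearised statistic\<close>

text \<open>In the expanded square only bad pairs contribute, each at most R^2, and for each i their
  share is at most M / N. The applications take N = n - k for the extensions of one word and N = n
  (n - 1) for the residuals.\<close>

lemma second_moment_average:
  fixes f :: "'i \<Rightarrow> (nat + nat \<times> nat \<Rightarrow> real) \<Rightarrow> real" and N M R :: real
  assumes "finite I" "I \<noteq> {}" and f: "\<And>i. i \<in> I \<Longrightarrow> bmeas (f i)"
    and R: "\<And>i \<omega>. i \<in> I \<Longrightarrow> \<bar>f i \<omega>\<bar> \<le> R" and "0 < N"
    and count: "\<And>i. i \<in> I \<Longrightarrow> real (card {j \<in> I. bad i j}) * N \<le> M * real (card I)"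
    and uncorrelated: "\<And>i j. i \<in> I \<Longrightarrow> j \<in> I \<Longrightarrow> \<not> bad i j \<Longrightarrow> (\<integral>\<omega>. f i \<omega> * f j \<omega> \<partial>Omega) = 0"
  shows "(\<integral>\<omega>. ((\<Sum>i\<in>I. f i \<omega>) / real (card I))\<^sup>2 \<partial>Omega) \<le> R\<^sup>2 * M / N"
proof -
  have card: "0 < real (card I)" using assms(1,2) by (simp add: card_gt_0_iff)
  have "(\<Sum>i\<in>I. f i \<omega>)\<^sup>2 = (\<Sum>i\<in>I. \<Sum>j\<in>I. f i \<omega> * f j \<omega>)" for \<omega>
    by (simp add: power2_eq_square sum_product)
  then have "(\<integral>\<omega>. (\<Sum>i\<in>I. f i \<omega>)\<^sup>2 \<partial>Omega) = (\<Sum>i\<in>I. \<Sum>j\<in>I. \<integral>\<omega>. f i \<omega> * f j \<omega> \<partial>Omega)"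
    by (simp add: Bochner_Integration.integral_sum bmeas_integrable bmeas_mult bmeas_sum f)
  also have "\<dots> \<le> (\<Sum>i\<in>I. R\<^sup>2 * (M * real (card I) / N))"
  proof (rule sum_mono)
    fix i assume i: "i \<in> I"
    have "(\<Sum>j\<in>I. \<integral>\<omega>. f i \<omega> * f j \<omega> \<partial>Omega) \<le> (\<Sum>j\<in>I. R\<^sup>2 * of_bool (bad i j))"
    proof (rule sum_mono)
      fix j assume j: "j \<in> I"
      have "f i \<omega> * f j \<omega> \<le> R\<^sup>2" for \<omega>
      proof -
        have "f i \<omega> * f j \<omega> \<le> \<bar>f i \<omega>\<bar> * \<bar>f j \<omega>\<bar>" by (metis abs_ge_self abs_mult)
        also have "\<dots> \<le> R * R"
          using R[OF i, of \<omega>] R[OF j, of \<omega>] by (intro mult_mono) linarith+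
        finally show ?thesis by (simp add: power2_eq_square)
      qed
      then have "(\<integral>\<omega>. f i \<omega> * f j \<omega> \<partial>Omega) \<le> R\<^sup>2"
        by (intro Omega.integral_le_const bmeas_integrable bmeas_mult f i j) auto
      then show "(\<integral>\<omega>. f i \<omega> * f j \<omega> \<partial>Omega) \<le> R\<^sup>2 * of_bool (bad i j)"
        using uncorrelated[OF i j] by auto
    qed
    also have "\<dots> = R\<^sup>2 * real (card {j \<in> I. bad i j})"
      using \<open>finite I\<close> by (simp add: sum_distrib_left[symmetric] sum.If_cases Int_def of_bool_def)
    also have "\<dots> \<le> R\<^sup>2 * (M * real (card I) / N)"
      using count[OF i] \<open>0 < N\<close> by (intro mult_left_mono) (auto simp: field_simps)
    finally show "(\<Sum>j\<in>I. \<integral>\<omega>. f i \<omega> * f j \<omega> \<partial>Omega) \<le> R\<^sup>2 * (M * real (card I) / N)" .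
  qed
  also have "\<dots> = (R\<^sup>2 * M / N) * (real (card I))\<^sup>2"
    by (simp add: power2_eq_square)
  finally have "(\<integral>\<omega>. (\<Sum>i\<in>I. f i \<omega>)\<^sup>2 \<partial>Omega) / (real (card I))\<^sup>2 \<le> R\<^sup>2 * M / N"
    using card by (simp add: divide_le_eq)
  then show ?thesis by (simp add: power_divide)
qed

text \<open>Points such as \<open>label_pt\<close> below are not extensional, so they lie outside the space of
  \<open>cube k\<close>; hence the requirement that only the coordinates below \<open>k\<close> matter.\<close>

definition label_fun :: "nat \<Rightarrow> ((nat \<Rightarrow> real) \<Rightarrow> real) \<Rightarrow> bool" where
  "label_fun k f \<longleftrightarrow> f \<in> borel_measurable (cube k) \<and> (\<exists>B. \<forall>x. \<bar>f x\<bar> \<le> B)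
     \<and> (\<forall>x y. (\<forall>i<k. x i = y i) \<longrightarrow> f x = f y)"

lemma label_funI:
  assumes "f \<in> borel_measurable (cube k)" "\<And>x. \<bar>f x\<bar> \<le> B"
    "\<And>x y. (\<And>i. i < k \<Longrightarrow> x i = y i) \<Longrightarrow> f x = f y"
  shows "label_fun k f"
  using assms unfolding label_fun_def by blast

lemma label_fun_cong: "label_fun k f \<Longrightarrow> (\<And>i. i < k \<Longrightarrow> x i = y i) \<Longrightarrow> f x = f y"
  unfolding label_fun_def by blast

lemma label_fun_measurable: "label_fun k f \<Longrightarrow> f \<in> borel_measurable (cube k)"
  unfolding label_fun_def by blast

lemma label_fun_bound:
  assumes "label_fun k f" obtains B where "0 \<le> B" "\<And>x. \<bar>f x\<bar> \<le> B"
  using assms unfolding label_fun_def by (meson abs_ge_zero order_trans)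

lemma prob_space_cube: "prob_space (cube k)"
  unfolding cube_def by (rule prob_space_PiM) (rule prob_space_unif)

interpretation cube: prob_space "cube k" for k by (rule prob_space_cube)

lemma label_fun_integrable: "label_fun k f \<Longrightarrow> integrable (cube k) f"
  unfolding label_fun_def by (elim conjE exE, rule cube.integrable_const_bound) auto

lemma label_fun_mult [intro]:
  assumes "label_fun k f" "label_fun k g" shows "label_fun k (\<lambda>x. f x * g x)"
proof -
  obtain B C where "0 \<le> B" "\<And>x. \<bar>f x\<bar> \<le> B" "\<And>x. \<bar>g x\<bar> \<le> C" using assms by (meson label_fun_bound)
  then show ?thesis
    using assms
    by (intro label_funI[of _ _ "B * C"] borel_measurable_times)
      (auto simp: abs_mult label_fun_measurable intro!: mult_mono arg_cong2[of _ _ _ _ "(*)"] elim: label_fun_cong)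
qed

lemma label_fun_add [intro]:
  assumes "label_fun k f" "label_fun k g" shows "label_fun k (\<lambda>x. f x + g x)"
proof -
  obtain B C where "\<And>x. \<bar>f x\<bar> \<le> B" "\<And>x. \<bar>g x\<bar> \<le> C" using assms by (meson label_fun_bound)
  then show ?thesis
    using assms
    by (intro label_funI[of _ _ "B + C"] borel_measurable_add)
      (auto simp: label_fun_measurable intro!: arg_cong2[of _ _ _ _ "(+)"] elim: label_fun_cong
        intro: order_trans[OF abs_triangle_ineq add_mono])
qed

lemma label_fun_const [intro]: "label_fun k (\<lambda>_. c)"
  by (rule label_funI[of _ _ "\<bar>c\<bar>"]) auto

lemma label_fun_diff [intro]:
  assumes "label_fun k f" "label_fun k g" shows "label_fun k (\<lambda>x. f x - g x)"
  using label_fun_add[OF assms(1) label_fun_mult[OF label_fun_const[of k "-1"] assms(2)]] by simp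

lemma label_fun_sum [intro]:
  "(\<And>i. i \<in> A \<Longrightarrow> label_fun k (f i)) \<Longrightarrow> label_fun k (\<lambda>x. \<Sum>i\<in>A. f i x)"
  by (induction A rule: infinite_finite_induct) auto

lemma measurable_cube_component: "i < k \<Longrightarrow> (\<lambda>x. x i) \<in> borel_measurable (cube k)"
  unfolding cube_def by (rule measurable_PiM_unif_component) simp

definition label_pt :: "nat list \<Rightarrow> nat list \<Rightarrow> (nat + nat \<times> nat \<Rightarrow> real) \<Rightarrow> nat \<Rightarrow> real" where
  "label_pt l \<beta> \<omega> = (\<lambda>i. Xv \<omega> (\<beta> ! (l ! i)))"

definition label_coords :: "nat list \<Rightarrow> nat list \<Rightarrow> (nat + nat \<times> nat) set" where
  "label_coords l \<beta> = Inl ` set (map ((!) \<beta>) l)"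

lemma bmeas_label_fun:
  assumes f: "label_fun k f" shows "bmeas (\<lambda>\<omega>. f (label_pt l \<beta> \<omega>))"
proof -
  obtain B where B: "\<And>x. \<bar>f x\<bar> \<le> B" using f label_fun_bound by blast
  have "(\<lambda>\<omega>. \<lambda>i\<in>{..<k}. label_pt l \<beta> \<omega> i) \<in> measurable Omega (cube k)"
    unfolding cube_def label_pt_def Xv_def
    by (rule measurable_restrict) (simp cong: measurable_cong_sets)
  from measurable_compose[OF this label_fun_measurable[OF f]]
  have "(\<lambda>\<omega>. f (\<lambda>i\<in>{..<k}. label_pt l \<beta> \<omega> i)) \<in> borel_measurable Omega" .
  moreover have "f (\<lambda>i\<in>{..<k}. label_pt l \<beta> \<omega> i) = f (label_pt l \<beta> \<omega>)" for \<omega>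
    by (rule label_fun_cong[OF f]) simp
  ultimately show ?thesis by (intro bmeasI[OF _ B]) simp
qed

lemma dep_label_fun:
  assumes f: "label_fun (length l) f"
  shows "dep (label_coords l \<beta>) (\<lambda>\<omega>. f (label_pt l \<beta> \<omega>))"
  by (rule depI, rule label_fun_cong[OF f]) (auto simp: label_pt_def label_coords_def Xv_def)

lemma cE_label_fun:
  assumes b: "\<beta> \<in> words n p" and l: "l \<in> words p k" and f: "label_fun k f"
    and C: "\<And>i. i < k \<Longrightarrow> Inl (\<beta> ! (l ! i)) \<in> C \<longleftrightarrow> i \<in> I"
  shows "cE C (\<lambda>\<omega>. f (label_pt l \<beta> \<omega>)) \<omega> = (\<integral>x. f (override_on x (label_pt l \<beta> \<omega>) I) \<partial>cube k)"
proof -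
  let ?\<alpha> = "map ((!) \<beta>) l"
  have len: "length l = k" using l by (simp add: words_def)
  have eq: "f (override_on x (label_pt l \<beta> \<omega>) J) = f (override_on x (\<lambda>i. Xv \<omega> (?\<alpha> ! i)) J)" for x \<omega> J
    by (rule label_fun_cong[OF f]) (simp add: override_on_def label_pt_def len)
  have "f (label_pt l \<beta> \<omega>) = f (\<lambda>i. Xv \<omega> (?\<alpha> ! i))" for \<omega>
    using eq[of undefined \<omega> UNIV] by (simp add: override_on_def)
  then have "cE C (\<lambda>\<omega>. f (label_pt l \<beta> \<omega>)) \<omega> = cE C (\<lambda>\<omega>. f (\<lambda>i. Xv \<omega> (?\<alpha> ! i))) \<omega>" by simp
  also have "\<dots> = (\<integral>x. f (override_on x (\<lambda>i. Xv \<omega> (?\<alpha> ! i)) I) \<partial>cube k)"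
    by (rule cE_cube[OF map_nth_words[OF l b] label_fun_measurable[OF f]])
      (use C len in \<open>auto intro: label_fun_cong[OF f]\<close>)
  finally show ?thesis by (simp add: eq)
qed

section \<open>Labelled motif families: label edges, remaining edges, conditional densities\<close>

locale graphon_motifs =
  fixes W :: "real \<Rightarrow> real \<Rightarrow> real" and F :: "'d::finite \<Rightarrow> nat \<Rightarrow> nat \<Rightarrow> bool"
    and p k :: nat and l :: "nat list"
  assumes W: "graphon W" and simple: "\<And>m. simple_graph p (F m)"
    and l: "l \<in> words p k" and compat: "compatible F l"
begin

lemma len_l [simp]: "length l = k" and distinct_l: "distinct l" and set_l: "set l \<subseteq> {..<p}"
  using l by (auto simp: words_def)

lemma l_nth: "j < k \<Longrightarrow> l ! j < p" "j < k \<Longrightarrow> l ! j \<in> set l"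
  using set_l nth_mem[of j l] by (auto simp del: nth_mem)

lemma edges_pairs: "edges (F m) \<subseteq> pairs p"
  using simple[of m] by (auto simp: edges_def pairs_def simple_graph_def)

lemma Elab_subset: "Elab F l \<subseteq> edges (F m)"
  by (auto simp: Elab_def edges_def)

lemma Elab_pairs: "Elab F l \<subseteq> pairs p"
  using Elab_subset edges_pairs by blast

lemma Elab_labels: "Elab F l \<subseteq> set l \<times> set l"
  by (auto simp: Elab_def)

text \<open>By compatibility an edge of one motif between two labels is an edge of all motifs, hence
  in \<open>Elab\<close>. The free endpoint of every other edge is what decorrelates extensions
  later.\<close>

lemma edges_not_Elab: "(i, j) \<in> edges (F m) - Elab F l \<Longrightarrow> \<not> (i \<in> set l \<and> j \<in> set l)"
  using compat by (auto simp: Elab_def edges_def compatible_def)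

lemma finite_edges: "finite (edges (F m))" "finite (Elab F l)"
  using edges_pairs Elab_pairs finite_pairs finite_subset by blast+

lemma snoc_l: "q < p \<Longrightarrow> q \<notin> set l \<Longrightarrow> l @ [q] \<in> words p (Suc k)"
  by (rule snoc_words[OF l])

lemma pos_snoc: "q \<notin> set l \<Longrightarrow> i \<in> set l \<Longrightarrow> pos (l @ [q]) i = pos l i"
  using pos_nth[of "l @ [q]" "pos l i"] distinct_l pos_less[of l i] nth_pos[of l i]
  by (auto simp: nth_append)

lemma pos_l_less: "i \<in> set l \<Longrightarrow> pos l i < k"
  using pos_less[OF distinct_l] by simp

lemma label_fun_t_hat: "label_fun k (t_hat_x W F l)"
proof (rule label_funI[of _ _ 1])
  have pk: "pos l (fst e) < k" "pos l (snd e) < k" if "e \<in> Elab F l" for e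
    using that Elab_labels pos_l_less by auto
  show "t_hat_x W F l \<in> borel_measurable (cube k)"
    unfolding t_hat_x_def[abs_def] split_beta
    by (intro borel_measurable_prod measurable_Gedge_arg[OF W] measurable_cube_component pk)
  show "\<bar>t_hat_x W F l x\<bar> \<le> 1" for x
  proof -
    have "0 \<le> t_hat_x W F l x" "t_hat_x W F l x \<le> 1"
      using W unfolding t_hat_x_def split_beta graphon_def by (intro prod_nonneg prod_le_1; simp)+
    then show ?thesis by simp
  qed
  show "t_hat_x W F l x = t_hat_x W F l y" if "\<And>i. i < k \<Longrightarrow> x i = y i" for x y
    unfolding t_hat_x_def using that pk by (intro prod.cong) auto
qed

lemma t_tilde_bounds: "0 \<le> t_tilde_x W F p l x $ m" "t_tilde_x W F p l x $ m \<le> 1"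
  unfolding t_tilde_x_def using edges_pairs by (auto intro!: tint_bounds W distinct_l)

lemma label_fun_t_tilde: "label_fun k (\<lambda>x. t_tilde_x W F p l x $ m)"
proof (rule label_funI[of _ _ 1])
  show "(\<lambda>x. t_tilde_x W F p l x $ m) \<in> borel_measurable (cube k)"
    unfolding t_tilde_x_def vec_lambda_beta
    by (rule measurable_tint[OF W _ distinct_l])
      (use edges_pairs in \<open>auto intro: measurable_cube_component\<close>)
  show "\<bar>t_tilde_x W F p l x $ m\<bar> \<le> 1" for x
    using t_tilde_bounds[of x m] by simp
  show "t_tilde_x W F p l x $ m = t_tilde_x W F p l y $ m" if "\<And>i. i < k \<Longrightarrow> x i = y i" for x y
    unfolding t_tilde_x_def vec_lambda_beta using that by (intro tint_cong distinct_l) simp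
qed

lemma tint_edges_l: "tint W (edges (F m)) p l x = t_hat_x W F l x * t_tilde_x W F p l x $ m"
  using tint_pull_out[OF finite_edges(1) Elab_subset Elab_labels]
  by (simp add: t_hat_x_def t_tilde_x_def)

lemma tint_Elab_l: "tint W (Elab F l) p l x = t_hat_x W F l x"
  using tint_pull_out[OF finite_edges(2) subset_refl Elab_labels, of W p x]
  by (simp add: t_hat_x_def tint_empty)

lemma tint_Elab_snoc:
  assumes "q \<notin> set l" shows "tint W (Elab F l) p (l @ [q]) z = t_hat_x W F l z"
proof -
  have "Elab F l \<subseteq> set (l @ [q]) \<times> set (l @ [q])" using Elab_labels by auto
  from tint_pull_out[OF finite_edges(2) subset_refl this, of W p z]
  have "tint W (Elab F l) p (l @ [q]) z
      = (\<Prod>(i,j)\<in>Elab F l. W (z (pos (l @ [q]) i)) (z (pos (l @ [q]) j)))"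
    by (simp add: tint_empty)
  also have "\<dots> = t_hat_x W F l z"
    unfolding t_hat_x_def
    by (intro prod.cong refl) (use Elab_labels pos_snoc[OF assms] in auto)
  finally show ?thesis .
qed

lemma label_fun_t_z:
  assumes "q < p" "q \<notin> set l"
  shows "label_fun k (\<lambda>x. t_z W F p (l @ [q]) (x(k := u)) $ m)"
proof (rule label_funI[of _ _ 1])
  have d: "distinct (l @ [q])" using distinct_l assms by simp
  show "(\<lambda>x. t_z W F p (l @ [q]) (x(k := u)) $ m) \<in> borel_measurable (cube k)"
    unfolding t_z_def vec_lambda_beta
    by (rule measurable_tint[OF W edges_pairs d])
      (auto simp: less_Suc_eq intro: measurable_cube_component)
  show "\<bar>t_z W F p (l @ [q]) (x(k := u)) $ m\<bar> \<le> 1" for x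
    using tint_bounds[OF W edges_pairs d] by (simp add: t_z_def)
  show "t_z W F p (l @ [q]) (x(k := u)) $ m = t_z W F p (l @ [q]) (y(k := u)) $ m"
    if "\<And>i. i < k \<Longrightarrow> x i = y i" for x y
    unfolding t_z_def vec_lambda_beta using that by (intro tint_cong d) (auto simp: less_Suc_eq)
qed

lemma cE_gprod_labels:
  assumes "\<beta> \<in> words n p"
  shows "cE (label_coords l \<beta>) (gprod W (edges (F m)) \<beta>) \<omega>
      = t_hat_x W F l (label_pt l \<beta> \<omega>) * t_tilde_x W F p l (label_pt l \<beta> \<omega>) $ m"
    and "cE (label_coords l \<beta>) (gprod W (Elab F l) \<beta>) \<omega> = t_hat_x W F l (label_pt l \<beta> \<omega>)"
    and "cE (label_coords l \<beta>) (gprod W (edges (F m) - Elab F l) \<beta>) \<omega>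
      = t_tilde_x W F p l (label_pt l \<beta> \<omega>) $ m"
proof -
  have "edges (F m) - Elab F l \<subseteq> pairs p" using edges_pairs by auto
  then show "cE (label_coords l \<beta>) (gprod W (edges (F m)) \<beta>) \<omega>
      = t_hat_x W F l (label_pt l \<beta> \<omega>) * t_tilde_x W F p l (label_pt l \<beta> \<omega>) $ m"
    "cE (label_coords l \<beta>) (gprod W (Elab F l) \<beta>) \<omega> = t_hat_x W F l (label_pt l \<beta> \<omega>)"
    "cE (label_coords l \<beta>) (gprod W (edges (F m) - Elab F l) \<beta>) \<omega>
      = t_tilde_x W F p l (label_pt l \<beta> \<omega>) $ m"
    unfolding label_coords_def label_pt_def
    using cE_gprod[OF W assms _ l] edges_pairs Elab_pairs tint_edges_l tint_Elab_l
    by (simp_all add: t_tilde_x_def)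
qed

text \<open>Freezing the letter at q as well amounts to labelling q. Its latent variable becomes
  coordinate k of the labelled point, the last one since coordinates start at 0.\<close>

lemma cE_gprod_snoc:
  assumes b: "\<beta> \<in> words n p" and q: "q < p" "q \<notin> set l"
  shows "cE (insert (Inl (\<beta> ! q)) (label_coords l \<beta>)) (gprod W (edges (F m)) \<beta>) \<omega>
      = t_z W F p (l @ [q]) ((label_pt l \<beta> \<omega>)(k := Xv \<omega> (\<beta> ! q))) $ m"
    and "cE (insert (Inl (\<beta> ! q)) (label_coords l \<beta>)) (gprod W (Elab F l) \<beta>) \<omega>
      = t_hat_x W F l (label_pt l \<beta> \<omega>)"
proof -
  have C: "insert (Inl (\<beta> ! q)) (label_coords l \<beta>) = Inl ` set (map ((!) \<beta>) (l @ [q]))"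
    by (auto simp: label_coords_def)
  have d: "distinct (l @ [q])" using distinct_l q by simp
  show "cE (insert (Inl (\<beta> ! q)) (label_coords l \<beta>)) (gprod W (edges (F m)) \<beta>) \<omega>
      = t_z W F p (l @ [q]) ((label_pt l \<beta> \<omega>)(k := Xv \<omega> (\<beta> ! q))) $ m"
    unfolding C cE_gprod[OF W b edges_pairs snoc_l[OF q]] t_z_def vec_lambda_beta
    by (rule tint_cong[OF d]) (auto simp: label_pt_def nth_append less_Suc_eq)
  show "cE (insert (Inl (\<beta> ! q)) (label_coords l \<beta>)) (gprod W (Elab F l) \<beta>) \<omega>
      = t_hat_x W F l (label_pt l \<beta> \<omega>)"
    unfolding C cE_gprod[OF W b Elab_pairs snoc_l[OF q]] tint_Elab_snoc[OF q(2)]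
    by (rule label_fun_cong[OF label_fun_t_hat]) (simp add: label_pt_def nth_append)
qed

end

section \<open>Projections and residuals of the linearised kernel\<close>

locale graphon_kernel = graphon_motifs W F p k l
  for W :: "real \<Rightarrow> real \<Rightarrow> real" and F :: "'d::finite \<Rightarrow> nat \<Rightarrow> nat \<Rightarrow> bool"
    and p k :: nat and l :: "nat list" +
  fixes \<phi> :: "(nat \<Rightarrow> real) \<Rightarrow> real" and \<psi> :: "(nat \<Rightarrow> real) \<Rightarrow> real ^ 'd"
  assumes \<phi>: "label_fun k \<phi>" and \<psi>: "\<And>m. label_fun k (\<lambda>x. \<psi> x $ m)"
begin

text \<open>The linearisation \<open>A (\<phi> + \<langle>\<psi>, Q - t\<rangle>)\<close>, where \<open>A\<close> indicates that all label edges are present and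
  \<open>Q m\<close> that all other edges of \<open>F m\<close> are; \<open>A * Q m\<close> is a product over all edges of \<open>F m\<close>.\<close>

definition ustat_kernel :: "nat list \<Rightarrow> (nat + nat \<times> nat \<Rightarrow> real) \<Rightarrow> real" where
  "ustat_kernel \<beta> \<omega> = \<phi> (label_pt l \<beta> \<omega>) * gprod W (Elab F l) \<beta> \<omega>
     + (\<Sum>m\<in>UNIV. \<psi> (label_pt l \<beta> \<omega>) $ m * gprod W (edges (F m)) \<beta> \<omega>
          - (\<psi> (label_pt l \<beta> \<omega>) $ m * t_tilde_x W F p l (label_pt l \<beta> \<omega>) $ m)
              * gprod W (Elab F l) \<beta> \<omega>)"

definition mean :: real where
  "mean = (\<integral>x. \<phi> x * t_hat_x W F l x \<partial>cube k)"

text \<open>The conditional expectation of the kernel given the latent variable of the letter at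
  position i, see \<open>cE_kernel_vertex\<close>. At a label the \<psi> part has averaged out and
  one coordinate is fixed at u. Elsewhere the \<phi> part does not see u and contributes
  \<open>mean\<close>, and only the \<psi> part varies.\<close>

definition proj :: "nat \<Rightarrow> real \<Rightarrow> real" where
  "proj i u = (if i \<in> set l
     then \<integral>x. \<phi> (x(pos l i := u)) * t_hat_x W F l (x(pos l i := u)) \<partial>cube k
     else mean + (\<integral>x. (\<Sum>m\<in>UNIV. \<psi> x $ m * t_z W F p (l @ [i]) (x(k := u)) $ m) \<partial>cube k)
       - (\<integral>x. (\<Sum>m\<in>UNIV. (\<psi> x $ m * t_tilde_x W F p l x $ m) * t_hat_x W F l x) \<partial>cube k))"

lemma \<psi>_t_tilde: "label_fun k (\<lambda>x. \<psi> x $ m * t_tilde_x W F p l x $ m)"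
  by (intro label_fun_mult \<psi> label_fun_t_tilde)

lemma bmeas_kernel: "bmeas (ustat_kernel \<beta>)"
  unfolding ustat_kernel_def[abs_def]
  by (intro bmeas_add bmeas_mult bmeas_sum bmeas_diff bmeas_gprod[OF W]
      bmeas_label_fun[OF \<phi>] bmeas_label_fun[OF \<psi>] bmeas_label_fun[OF label_fun_t_tilde])

text \<open>The bound is uniform in the word, as the second-moment estimate demands. Each component
  of \<psi> occurs in two terms, multiplied by factors in [0,1].\<close>

lemma kernel_bound: obtains B where "0 \<le> B" "\<And>\<beta> \<omega>. \<bar>ustat_kernel \<beta> \<omega>\<bar> \<le> B"
proof -
  obtain B0 where B0: "\<And>x. \<bar>\<phi> x\<bar> \<le> B0" using label_fun_bound[OF \<phi>] by blast
  have "\<exists>B. \<forall>x. \<bar>\<psi> x $ m\<bar> \<le> B" for m using label_fun_bound[OF \<psi>[of m]] by blast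
  then obtain B1 where B1: "\<And>m x. \<bar>\<psi> x $ m\<bar> \<le> B1 m" by metis
  have "\<bar>ustat_kernel \<beta> \<omega>\<bar> \<le> B0 + (\<Sum>m\<in>UNIV. B1 m + B1 m)" for \<beta> \<omega>
  proof -
    have a: "\<bar>a * b\<bar> \<le> B" if "\<bar>a\<bar> \<le> B" "0 \<le> b" "b \<le> 1" for a b B :: real
    proof -
      have "\<bar>a\<bar> * b \<le> \<bar>a\<bar> * 1" using that by (intro mult_left_mono) auto
      then show ?thesis using that by (simp add: abs_mult)
    qed
    have 1: "\<bar>\<phi> (label_pt l \<beta> \<omega>) * gprod W (Elab F l) \<beta> \<omega>\<bar> \<le> B0"
      by (intro a B0 gprod_bounds)
    have "\<bar>\<Sum>m\<in>UNIV. \<psi> (label_pt l \<beta> \<omega>) $ m * gprod W (edges (F m)) \<beta> \<omega>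
          - (\<psi> (label_pt l \<beta> \<omega>) $ m * t_tilde_x W F p l (label_pt l \<beta> \<omega>) $ m)
              * gprod W (Elab F l) \<beta> \<omega>\<bar> \<le> (\<Sum>m\<in>UNIV. B1 m + B1 m)"
      by (rule order_trans[OF sum_abs], rule sum_mono,
          rule order_trans[OF abs_triangle_ineq4], intro add_mono a B1 gprod_bounds t_tilde_bounds)
    with 1 show ?thesis
      unfolding ustat_kernel_def by (intro order_trans[OF abs_triangle_ineq] add_mono)
  qed
  then show ?thesis by (intro that[of "\<bar>B0 + (\<Sum>m\<in>UNIV. B1 m + B1 m)\<bar>"]) (auto intro: order_trans[OF _ abs_ge_self])
qed

lemma label_coords_subset:
  "\<beta> \<in> words n p \<Longrightarrow> label_coords l \<beta> \<subseteq> Inl ` set \<beta>"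
  using set_l by (auto simp: label_coords_def words_def)

lemma dep_kernel:
  assumes b: "\<beta> \<in> words n p" shows "dep (coords (pairs p) \<beta>) (ustat_kernel \<beta>)"
proof -
  have len: "length \<beta> = p" using b by (simp add: words_def)
  have g: "dep (coords (pairs p) \<beta>) (gprod W E \<beta>)" if "E \<subseteq> pairs p" for E
    by (rule dep_mono[OF dep_gprod[OF len that]]) (use that in \<open>auto simp: coords_def\<close>)
  have f: "dep (coords (pairs p) \<beta>) (\<lambda>\<omega>. f (label_pt l \<beta> \<omega>))" if "label_fun k f" for f
    by (rule dep_mono[OF dep_label_fun]) (use that label_coords_subset[OF b] in \<open>auto simp: coords_def\<close>)
  show ?thesis
    unfolding ustat_kernel_def[abs_def]
    by (intro dep_add dep_mult dep_sum dep_diff g f[OF \<phi>] f[OF \<psi>] f[OF label_fun_t_tilde] edges_pairs Elab_pairs)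
qed

lemma cE_kernel:
  assumes "label_coords l \<beta> \<subseteq> D"
  shows "cE D (ustat_kernel \<beta>) \<omega> = \<phi> (label_pt l \<beta> \<omega>) * cE D (gprod W (Elab F l) \<beta>) \<omega>
     + (\<Sum>m\<in>UNIV. \<psi> (label_pt l \<beta> \<omega>) $ m * cE D (gprod W (edges (F m)) \<beta>) \<omega>
          - (\<psi> (label_pt l \<beta> \<omega>) $ m * t_tilde_x W F p l (label_pt l \<beta> \<omega>) $ m)
              * cE D (gprod W (Elab F l) \<beta>) \<omega>)"
proof -
  have d: "dep D (\<lambda>\<omega>. f (label_pt l \<beta> \<omega>))" if "label_fun k f" for f
    using dep_mono[OF dep_label_fun assms] that by simp
  have b: "bmeas (\<lambda>\<omega>. f (label_pt l \<beta> \<omega>) * gprod W E \<beta> \<omega>)" if "label_fun k f" for f E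
    by (intro bmeas_mult bmeas_label_fun[OF that] bmeas_gprod[OF W])
  show ?thesis
    unfolding ustat_kernel_def[abs_def]
    by (simp add: cE_add cE_sum cE_diff bmeas_sum bmeas_diff b[OF \<phi>] b[OF \<psi>] b[OF \<psi>_t_tilde]
        cE_pull_out[OF d[OF \<phi>]] cE_pull_out[OF d[OF \<psi>]] cE_pull_out[OF d[OF \<psi>_t_tilde]])
qed

text \<open>Given the labels, \<open>A * Q m\<close> has mean \<open>t_hat_x\<close> times
  \<open>t_tilde_x\<close>, which is also the mean of \<open>A\<close> times
  \<open>t_tilde_x\<close>. So the \<psi> part is centred and only the \<phi> part survives.\<close>

lemma cE_kernel_labels:
  assumes b: "\<beta> \<in> words n p"
  shows "cE (label_coords l \<beta>) (ustat_kernel \<beta>) \<omega>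
    = \<phi> (label_pt l \<beta> \<omega>) * t_hat_x W F l (label_pt l \<beta> \<omega>)"
  by (simp add: cE_kernel[OF subset_refl] cE_gprod_labels[OF b] mult_ac)

lemma mean_kernel:
  assumes b: "\<beta> \<in> words n p" shows "(\<integral>\<omega>. ustat_kernel \<beta> \<omega> \<partial>Omega) = mean"
proof -
  have "(\<integral>\<omega>. ustat_kernel \<beta> \<omega> \<partial>Omega) = cE {} (cE (label_coords l \<beta>) (ustat_kernel \<beta>)) undefined"
    by (subst cE_tower[OF bmeas_kernel]) (auto simp: cE_empty)
  also have "\<dots> = cE {} (\<lambda>\<omega>. \<phi> (label_pt l \<beta> \<omega>) * t_hat_x W F l (label_pt l \<beta> \<omega>)) undefined"
    by (simp add: cE_def[of "{}"] cE_kernel_labels[OF b])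
  also have "\<dots> = mean"
    using cE_label_fun[OF b l label_fun_mult[OF \<phi> label_fun_t_hat], of "{}" "{}" undefined]
    by (simp add: mean_def)
  finally show ?thesis .
qed

text \<open>At a label, the tower property goes through all labels, where the \<psi> part has
  already vanished. At another position it goes through the labels together with that letter, and
  labelling i turns the motif densities into \<open>t_z\<close>.\<close>

lemma cE_kernel_vertex:
  assumes b: "\<beta> \<in> words n p" and i: "i < p"
  shows "cE {Inl (\<beta> ! i)} (ustat_kernel \<beta>) \<omega> = proj i (Xv \<omega> (\<beta> ! i))"
proof (cases "i \<in> set l")
  case True
  let ?C = "{Inl (\<beta> ! i)} :: (nat + nat \<times> nat) set"
  have sub: "?C \<subseteq> label_coords l \<beta>" using True by (auto simp: label_coords_def)
  have ip: "l ! pos l i = i" using nth_pos[OF distinct_l True] .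
  have "cE ?C (ustat_kernel \<beta>) \<omega> = cE ?C (cE (label_coords l \<beta>) (ustat_kernel \<beta>)) \<omega>"
    by (rule cE_tower[OF bmeas_kernel sub, symmetric])
  also have "\<dots> = cE ?C (\<lambda>\<omega>. \<phi> (label_pt l \<beta> \<omega>) * t_hat_x W F l (label_pt l \<beta> \<omega>)) \<omega>"
    by (simp add: cE_def[of ?C] cE_kernel_labels[OF b])
  also have "\<dots> = (\<integral>x. \<phi> (override_on x (label_pt l \<beta> \<omega>) {pos l i})
      * t_hat_x W F l (override_on x (label_pt l \<beta> \<omega>) {pos l i}) \<partial>cube k)"
  proof (rule cE_label_fun[OF b l label_fun_mult[OF \<phi> label_fun_t_hat]])
    fix j assume j: "j < k"
    then have "l ! j < p" by (rule l_nth)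
    then show "(Inl (\<beta> ! (l ! j)) \<in> ?C) = (j \<in> {pos l i})"
      using words_nth_eq_iff[OF b _ i] ip pos_nth[OF distinct_l] j by auto
  qed
  finally have "cE ?C (ustat_kernel \<beta>) \<omega> = (\<integral>x. \<phi> (override_on x (label_pt l \<beta> \<omega>) {pos l i})
      * t_hat_x W F l (override_on x (label_pt l \<beta> \<omega>) {pos l i}) \<partial>cube k)" .
  moreover have "override_on x (label_pt l \<beta> \<omega>) {pos l i} = x(pos l i := Xv \<omega> (\<beta> ! i))" for x
    by (auto simp: override_on_def label_pt_def ip)
  ultimately show ?thesis using True by (simp add: proj_def)
next
  case False
  let ?C = "{Inl (\<beta> ! i)} :: (nat + nat \<times> nat) set"
  let ?D = "insert (Inl (\<beta> ! i)) (label_coords l \<beta>)"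
  define u where "u = Xv \<omega> (\<beta> ! i)"
  define q where "q x = \<phi> x * t_hat_x W F l x
     + ((\<Sum>m\<in>UNIV. \<psi> x $ m * t_z W F p (l @ [i]) (x(k := u)) $ m)
      - (\<Sum>m\<in>UNIV. (\<psi> x $ m * t_tilde_x W F p l x $ m) * t_hat_x W F l x))" for x
  have q: "label_fun k (\<lambda>x. \<phi> x * t_hat_x W F l x)"
    "label_fun k (\<lambda>x. \<Sum>m\<in>UNIV. \<psi> x $ m * t_z W F p (l @ [i]) (x(k := u)) $ m)"
    "label_fun k (\<lambda>x. \<Sum>m\<in>UNIV. (\<psi> x $ m * t_tilde_x W F p l x $ m) * t_hat_x W F l x)"
    by (intro label_fun_add label_fun_diff label_fun_sum label_fun_mult \<phi> \<psi> label_fun_t_hat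
        label_fun_t_tilde label_fun_t_z i False)+
  have "cE ?C (ustat_kernel \<beta>) \<omega> = cE ?C (cE ?D (ustat_kernel \<beta>)) \<omega>"
    by (rule cE_tower[OF bmeas_kernel, symmetric]) auto
  also have "\<dots> = cE ?C (\<lambda>\<omega>. q (label_pt l \<beta> \<omega>)) \<omega>"
    unfolding cE_def[of ?C]
  proof (rule Bochner_Integration.integral_cong[OF refl])
    fix \<omega>'
    \<comment> \<open>The letter at i stays frozen during the resampling, so \<open>q\<close>, which
      carries u as a parameter, is a fixed function of the label point.\<close>
    have "Xv (override_on \<omega>' \<omega> ?C) (\<beta> ! i) = u" by (simp add: override_on_def Xv_def u_def)
    then show "cE ?D (ustat_kernel \<beta>) (override_on \<omega>' \<omega> ?C) = q (label_pt l \<beta> (override_on \<omega>' \<omega> ?C))"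
      by (simp add: cE_kernel[OF subset_insertI] cE_gprod_snoc[OF b i False] q_def sum_subtractf)
  qed
  also have "\<dots> = (\<integral>x. q (override_on x (label_pt l \<beta> \<omega>) {}) \<partial>cube k)"
  proof (rule cE_label_fun[OF b l])
    show "label_fun k q" unfolding q_def[abs_def] by (intro label_fun_add label_fun_diff q)
    fix j assume j: "j < k"
    then have "l ! j < p" "l ! j \<noteq> i" using l_nth False by auto
    then show "(Inl (\<beta> ! (l ! j)) \<in> ?C) = (j \<in> {})"
      using words_nth_eq_iff[OF b _ i] by auto
  qed
  also have "\<dots> = proj i u"
    using False q[THEN label_fun_integrable] by (simp add: q_def proj_def mean_def)
  finally show ?thesis by (simp add: u_def)
qed

text \<open>Inherited from \<open>cE\<close>: \<open>proj i\<close> is the conditional expectation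
  for the identity word, evaluated at constant points, and these depend measurably on u.\<close>

lemma proj_measurable: "proj i \<in> borel_measurable borel"
  and proj_bound: "\<exists>B. \<forall>u. \<bar>proj i u\<bar> \<le> B" if "i < p"
proof -
  have w: "[0..<p] \<in> words p p" by (auto simp: words_def)
  have eq: "proj i u = cE {Inl i} (ustat_kernel [0..<p]) (\<lambda>_. u)" for u
    using cE_kernel_vertex[OF w that, of "\<lambda>_. u"] that by (simp add: Xv_def)
  have b: "bmeas (cE {Inl i} (ustat_kernel [0..<p]))" by (intro bmeas_cE bmeas_kernel)
  have "(\<lambda>u _. u) \<in> measurable borel Omega" by (rule measurable_OmegaI) simp
  from measurable_compose[OF this bmeas_measurable[OF b]]
  show "proj i \<in> borel_measurable borel" by (simp add: eq[abs_def])
  show "\<exists>B. \<forall>u. \<bar>proj i u\<bar> \<le> B" using b by (auto simp: bmeas_def eq)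
qed

lemma bmeas_proj: "i < p \<Longrightarrow> bmeas (\<lambda>\<omega>. proj i (Xv \<omega> v))"
proof -
  assume i: "i < p"
  obtain B where "\<And>u. \<bar>proj i u\<bar> \<le> B" using proj_bound[OF i] by blast
  moreover note [measurable] = proj_measurable[OF i]
  have "(\<lambda>\<omega>. proj i (Xv \<omega> v)) \<in> borel_measurable Omega" unfolding Xv_def by measurable
  ultimately show ?thesis by (intro bmeasI)
qed

lemma mean_proj:
  assumes i: "i < p" shows "(\<integral>u. proj i u \<partial>unif) = mean"
proof -
  have w: "[0..<p] \<in> words p p" by (auto simp: words_def)
  have "(\<integral>u. proj i u \<partial>unif) = (\<integral>\<omega>. cE {Inl i} (ustat_kernel [0..<p]) \<omega> \<partial>Omega)"
    using cE_kernel_vertex[OF w i] i by (simp add: integral_Xv[OF proj_measurable[OF i], symmetric])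
  also have "\<dots> = mean"
    by (simp add: integral_cE bmeas_kernel mean_kernel[OF w])
  finally show ?thesis .
qed

definition resid :: "nat list \<Rightarrow> (nat + nat \<times> nat \<Rightarrow> real) \<Rightarrow> real" where
  "resid \<beta> \<omega> = ustat_kernel \<beta> \<omega> - mean - (\<Sum>i<p. proj i (Xv \<omega> (\<beta> ! i)) - mean)"

lemma bmeas_resid: "bmeas (resid \<beta>)"
  unfolding resid_def[abs_def]
  by (intro bmeas_diff bmeas_sum bmeas_kernel bmeas_const bmeas_proj) simp

lemma resid_bound: obtains R where "0 \<le> R" "\<And>\<beta> \<omega>. \<bar>resid \<beta> \<omega>\<bar> \<le> R"
proof -
  obtain B where B: "\<And>\<beta> \<omega>. \<bar>ustat_kernel \<beta> \<omega>\<bar> \<le> B" using kernel_bound by blast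
  obtain P where P: "\<And>i u. i < p \<Longrightarrow> \<bar>proj i u\<bar> \<le> P i" using proj_bound by metis
  have "\<bar>resid \<beta> \<omega>\<bar> \<le> B + \<bar>mean\<bar> + (\<Sum>i<p. P i + \<bar>mean\<bar>)" for \<beta> \<omega>
  proof -
    have "\<bar>\<Sum>i<p. proj i (Xv \<omega> (\<beta> ! i)) - mean\<bar> \<le> (\<Sum>i<p. P i + \<bar>mean\<bar>)"
    proof (rule order_trans[OF sum_abs], rule sum_mono)
      fix i assume "i \<in> {..<p}"
      then show "\<bar>proj i (Xv \<omega> (\<beta> ! i)) - mean\<bar> \<le> P i + \<bar>mean\<bar>"
        using P[of i "Xv \<omega> (\<beta> ! i)"] by auto
    qed
    with B[of \<beta> \<omega>] show ?thesis unfolding resid_def by linarith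
  qed
  then show ?thesis by (intro that[of "\<bar>B + \<bar>mean\<bar> + (\<Sum>i<p. P i + \<bar>mean\<bar>)\<bar>"]) (auto intro: order_trans[OF _ abs_ge_self])
qed

lemma dep_resid:
  assumes b: "\<beta> \<in> words n p" shows "dep (coords (pairs p) \<beta>) (resid \<beta>)"
proof -
  have "dep (coords (pairs p) \<beta>) (\<lambda>\<omega>. proj i (Xv \<omega> (\<beta> ! i)))" if "i < p" for i
  proof (rule depI)
    fix \<omega> \<omega>' :: "nat + nat \<times> nat \<Rightarrow> real"
    assume eq: "\<And>c. c \<in> coords (pairs p) \<beta> \<Longrightarrow> \<omega> c = \<omega>' c"
    have "Inl (\<beta> ! i) \<in> coords (pairs p) \<beta>" using b that by (auto simp: coords_def words_def)
    then show "proj i (Xv \<omega> (\<beta> ! i)) = proj i (Xv \<omega>' (\<beta> ! i))" using eq by (simp add: Xv_def)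
  qed
  then show ?thesis
    unfolding resid_def[abs_def]
    by (intro dep_diff dep_sum dep_const dep_kernel[OF b]) auto
qed

text \<open>Given one letter, the kernel becomes its projection, which cancels the term of that
  letter, while every other projection averages to \<open>mean\<close> by
  \<open>mean_proj\<close>.\<close>

lemma cE_resid:
  assumes b: "\<beta> \<in> words n p" and C: "C = {} \<or> (\<exists>i<p. C = {Inl (\<beta> ! i)})"
  shows "cE C (resid \<beta>) \<omega> = 0"
proof -
  have indep: "cE C (\<lambda>\<omega>. proj j (Xv \<omega> (\<beta> ! j))) \<omega> = mean" if "j < p" "Inl (\<beta> ! j) \<notin> C" for j
    using that mean_proj[OF that(1)] integral_Xv[OF proj_measurable[OF that(1)]]
    by (simp add: cE_def Xv_def override_on_def)
  have same: "cE C (\<lambda>\<omega>. proj j (Xv \<omega> (\<beta> ! j))) \<omega> = proj j (Xv \<omega> (\<beta> ! j))" if "Inl (\<beta> ! j) \<in> C" for j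
    using that by (simp add: cE_def Xv_def override_on_def)
  have expand: "cE C (resid \<beta>) \<omega> = cE C (ustat_kernel \<beta>) \<omega> - mean - (\<Sum>j<p. cE C (\<lambda>\<omega>. proj j (Xv \<omega> (\<beta> ! j))) \<omega> - mean)"
  proof -
    have "cE C (resid \<beta>) \<omega> = cE C (\<lambda>\<omega>. ustat_kernel \<beta> \<omega> - mean) \<omega>
        - cE C (\<lambda>\<omega>. \<Sum>i<p. proj i (Xv \<omega> (\<beta> ! i)) - mean) \<omega>"
      unfolding resid_def[abs_def]
      by (rule cE_diff; intro bmeas_diff bmeas_sum bmeas_kernel bmeas_const bmeas_proj) simp
    also have "cE C (\<lambda>\<omega>. ustat_kernel \<beta> \<omega> - mean) \<omega> = cE C (ustat_kernel \<beta>) \<omega> - mean"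
      by (subst cE_diff[OF bmeas_kernel bmeas_const]) (simp add: cE_const)
    also have "cE C (\<lambda>\<omega>. \<Sum>i<p. proj i (Xv \<omega> (\<beta> ! i)) - mean) \<omega>
        = (\<Sum>j<p. cE C (\<lambda>\<omega>. proj j (Xv \<omega> (\<beta> ! j)) - mean) \<omega>)"
      by (rule cE_sum) (intro bmeas_diff bmeas_const bmeas_proj, simp)
    also have "\<dots> = (\<Sum>j<p. cE C (\<lambda>\<omega>. proj j (Xv \<omega> (\<beta> ! j))) \<omega> - mean)"
      by (intro sum.cong refl, subst cE_diff) (auto simp: cE_const intro: bmeas_proj)
    finally show ?thesis .
  qed
  from C show ?thesis
  proof
    assume "C = {}"
    then show ?thesis unfolding expand using indep by (simp add: cE_empty mean_kernel[OF b])
  next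
    assume "\<exists>i<p. C = {Inl (\<beta> ! i)}"
    then obtain i where i: "i < p" "C = {Inl (\<beta> ! i)}" by blast
    have "(\<Sum>j<p. cE C (\<lambda>\<omega>. proj j (Xv \<omega> (\<beta> ! j))) \<omega> - mean)
        = (\<Sum>j<p. if j = i then proj i (Xv \<omega> (\<beta> ! i)) - mean else 0)"
      by (intro sum.cong refl) (use indep same i words_nth_eq_iff[OF b _ i(1)] in auto)
    also have "\<dots> = proj i (Xv \<omega> (\<beta> ! i)) - mean" using i by (simp add: sum.delta)
    finally show ?thesis
      unfolding expand using cE_kernel_vertex[OF b i(1)] by (simp add: i(2))
  qed
qed

text \<open>A common coin would need two common letters, so the shared coordinates are at most one
  latent variable, and given it the residual is centred by \<open>cE_resid\<close>.\<close>

lemma resid_uncorrelated: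
  assumes b: "\<beta> \<in> words n p" "\<beta>' \<in> words n p" and "\<not> 2 \<le> card (set \<beta> \<inter> set \<beta>')"
  shows "(\<integral>\<omega>. resid \<beta> \<omega> * resid \<beta>' \<omega> \<partial>Omega) = 0"
proof (rule integral_mult_eq_0[OF bmeas_resid bmeas_resid dep_resid[OF b(1)] dep_resid[OF b(2)]])
  let ?C = "Inl ` (set \<beta> \<inter> set \<beta>') :: (nat + nat \<times> nat) set"
  have le1: "card (set \<beta> \<inter> set \<beta>') \<le> Suc 0" using assms(3) by simp
  have "edge_coord \<beta> e \<noteq> edge_coord \<beta>' e'" if e: "e \<in> pairs p" "e' \<in> pairs p" for e e'
  proof
    assume eq: "edge_coord \<beta> e = edge_coord \<beta>' e'"
    have m: "\<beta> ! fst e \<in> set \<beta>" "\<beta> ! snd e \<in> set \<beta>" "\<beta>' ! fst e' \<in> set \<beta>'" "\<beta>' ! snd e' \<in> set \<beta>'"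
      using e b by (auto simp: pairs_def words_def)
    have ne: "\<beta> ! fst e \<noteq> \<beta> ! snd e"
      using e words_nth_eq_iff[OF b(1), of "fst e" "snd e"] by (auto simp: pairs_def)
    have "{\<beta> ! fst e, \<beta> ! snd e} = {\<beta>' ! fst e', \<beta>' ! snd e'}"
      using eq by (auto simp: edge_coord_def min_def max_def split: if_splits)
    then have "\<beta> ! fst e \<in> set \<beta> \<inter> set \<beta>'" "\<beta> ! snd e \<in> set \<beta> \<inter> set \<beta>'"
      using m by (auto simp: doubleton_eq_iff)
    then show False using le1 ne by (subst (asm) card_le_Suc0_iff_eq) auto
  qed
  then have "edge_coord \<beta> ` pairs p \<inter> edge_coord \<beta>' ` pairs p = {}" by blast
  then show "coords (pairs p) \<beta> \<inter> coords (pairs p) \<beta>' \<subseteq> ?C"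
    unfolding coords_def by blast
  show "cE ?C (resid \<beta>) \<omega> = 0" for \<omega>
  proof (rule cE_resid[OF b(1)])
    consider "set \<beta> \<inter> set \<beta>' = {}" | v where "v \<in> set \<beta> \<inter> set \<beta>'" by blast
    then show "?C = {} \<or> (\<exists>i<p. ?C = {Inl (\<beta> ! i)})"
    proof cases
      case 2
      then have "set \<beta> \<inter> set \<beta>' = {v}" using le1 by (subst (asm) card_le_Suc0_iff_eq) auto
      moreover obtain i where "i < p" "v = \<beta> ! i" using 2 b by (auto simp: in_set_conv_nth words_def)
      ultimately show ?thesis by auto
    qed simp
  qed
qed

lemma resid_average_second_moment:
  obtains K where "0 \<le> K" "\<And>n. p \<le> n \<Longrightarrow> 2 \<le> n \<Longrightarrow>
    (\<integral>\<omega>. ((\<Sum>\<beta>\<in>words n p. resid \<beta> \<omega>) / real (card (words n p)))\<^sup>2 \<partial>Omega) \<le> K / (real n * (real n - 1))"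
proof -
  obtain R where R: "0 \<le> R" "\<And>\<beta> \<omega>. \<bar>resid \<beta> \<omega>\<bar> \<le> R" using resid_bound by blast
  show ?thesis
  proof (rule that[of "R\<^sup>2 * real (p ^ 4)"])
    fix n assume n: "p \<le> n" "2 \<le> n"
    show "(\<integral>\<omega>. ((\<Sum>\<beta>\<in>words n p. resid \<beta> \<omega>) / real (card (words n p)))\<^sup>2 \<partial>Omega)
        \<le> R\<^sup>2 * real (p ^ 4) / (real n * (real n - 1))"
    proof (rule second_moment_average[where bad = "\<lambda>\<beta> \<beta>'. 2 \<le> card (set \<beta> \<inter> set \<beta>')"])
      fix \<beta> assume "\<beta> \<in> words n p"
      from card_words_overlap2[OF n(1) this]
      have "real (card {\<beta>' \<in> words n p. 2 \<le> card (set \<beta> \<inter> set \<beta>')} * (n * (n - 1)))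
          \<le> real (p ^ 4 * card (words n p))"
        by (rule of_nat_mono)
      then show "real (card {\<beta>' \<in> words n p. 2 \<le> card (set \<beta> \<inter> set \<beta>')}) * (real n * (real n - 1))
          \<le> real (p ^ 4) * real (card (words n p))"
        using n by (simp add: of_nat_diff)
    qed (use n R words_nonempty bmeas_resid resid_uncorrelated in auto)
  qed simp
qed

text \<open>The projections, subtracted word by word, are regrouped by vertex with
  \<open>sum_words_nth\<close>; this exact identity leaves a sum of independent terms besides the
  residuals.\<close>

lemma average_kernel:
  assumes n: "p \<le> n" "0 < n"
  shows "(\<Sum>\<beta>\<in>words n p. ustat_kernel \<beta> \<omega>) / real (card (words n p)) - mean
    = (\<Sum>\<beta>\<in>words n p. resid \<beta> \<omega>) / real (card (words n p))
      + (\<Sum>v<n. \<Sum>i<p. proj i (Xv \<omega> v) - mean) / real n"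
proof -
  let ?N = "real (card (words n p))"
  have N: "?N > 0" using words_nonempty[OF n(1)] by (simp add: card_gt_0_iff)
  have "(\<Sum>\<beta>\<in>words n p. \<Sum>i<p. proj i (Xv \<omega> (\<beta> ! i)) - mean) / ?N
      = (\<Sum>i<p. (\<Sum>\<beta>\<in>words n p. proj i (Xv \<omega> (\<beta> ! i)) - mean) / ?N)"
    by (subst sum.swap) (simp add: sum_divide_distrib)
  also have "\<dots> = (\<Sum>i<p. (\<Sum>v<n. proj i (Xv \<omega> v) - mean) / real n)"
  proof (rule sum.cong[OF refl])
    fix i assume "i \<in> {..<p}"
    then show "(\<Sum>\<beta>\<in>words n p. proj i (Xv \<omega> (\<beta> ! i)) - mean) / ?N = (\<Sum>v<n. proj i (Xv \<omega> v) - mean) / real n"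
      using sum_words_nth[OF _ n(1), of i "\<lambda>v. proj i (Xv \<omega> v) - mean"] N n(2)
      by (subst frac_eq_eq) (auto simp: mult_ac)
  qed
  also have "\<dots> = (\<Sum>v<n. \<Sum>i<p. proj i (Xv \<omega> v) - mean) / real n"
    by (subst sum.swap) (simp add: sum_divide_distrib)
  finally have lin: "(\<Sum>\<beta>\<in>words n p. \<Sum>i<p. proj i (Xv \<omega> (\<beta> ! i)) - mean) / ?N
    = (\<Sum>v<n. \<Sum>i<p. proj i (Xv \<omega> v) - mean) / real n" .
  have "ustat_kernel \<beta> \<omega> = resid \<beta> \<omega> + mean + (\<Sum>i<p. proj i (Xv \<omega> (\<beta> ! i)) - mean)" for \<beta>
    by (simp add: resid_def)
  then have "(\<Sum>\<beta>\<in>words n p. ustat_kernel \<beta> \<omega>) / ?N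
      = (\<Sum>\<beta>\<in>words n p. resid \<beta> \<omega>) / ?N + mean
        + (\<Sum>\<beta>\<in>words n p. \<Sum>i<p. proj i (Xv \<omega> (\<beta> ! i)) - mean) / ?N"
    using words_nonempty[OF n(1)] by (simp add: sum.distrib add_divide_distrib)
  then show ?thesis by (simp add: lin)
qed

end

section \<open>The linearisation error\<close>

text \<open>Continuity is available on the cube only, so the composition is measured through the
  restricted Borel space; all vectors plugged in later stay in the cube.\<close>

lemma measurable_comp_unit_cube:
  fixes f :: "real ^ 'd \<Rightarrow> real" and v :: "'x \<Rightarrow> real ^ 'd"
  assumes f: "continuous_on (cbox 0 1) f" and v: "\<And>m. (\<lambda>x. v x $ m) \<in> borel_measurable N"
    and range: "\<And>x. v x \<in> cbox 0 1"
  shows "(\<lambda>x. f (v x)) \<in> borel_measurable N"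
proof -
  have "v \<in> borel_measurable N"
  proof (rule borel_measurable_euclidean_space[THEN iffD2], rule ballI)
    fix i :: "real ^ 'd" assume "i \<in> Basis"
    then obtain m where "i = axis m 1" by (auto simp: Basis_vec_def)
    then show "(\<lambda>x. v x \<bullet> i) \<in> borel_measurable N" using v[of m] by (simp add: inner_axis)
  qed
  then have "v \<in> measurable N (restrict_space borel (cbox 0 1))"
    by (rule measurable_restrict_space2[rotated]) (simp add: range)
  then show ?thesis
    by (rule measurable_compose[where g = f]) (rule borel_measurable_continuous_on_restrict[OF f])
qed

lemma continuous_unit_cube_bounded:
  fixes f :: "real ^ 'd \<Rightarrow> real"
  assumes "continuous_on (cbox 0 1) f"
  obtains B where "\<And>x. x \<in> cbox 0 1 \<Longrightarrow> \<bar>f x\<bar> \<le> B"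
proof -
  have "bounded (f ` cbox 0 1)"
    by (intro compact_imp_bounded compact_continuous_image assms compact_cbox)
  then show ?thesis using that by (auto simp: bounded_iff)
qed

lemma bmeas_comp_unit_cube:
  fixes f :: "real ^ 'd \<Rightarrow> real"
  assumes "continuous_on (cbox 0 1) f" "\<And>m. bmeas (\<lambda>\<omega>. v \<omega> $ m)" "\<And>\<omega>. v \<omega> \<in> cbox 0 1"
  shows "bmeas (\<lambda>\<omega>. f (v \<omega>))"
proof -
  obtain B where "\<And>x. x \<in> cbox 0 1 \<Longrightarrow> \<bar>f x\<bar> \<le> B"
    using continuous_unit_cube_bounded[OF assms(1)] by blast
  then show ?thesis
    by (rule bmeasI[OF measurable_comp_unit_cube[OF assms(1) bmeas_measurable[OF assms(2)] assms(3)]])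
      (rule assms(3))
qed

lemma average_in_unit_interval:
  fixes f :: "'i \<Rightarrow> real"
  assumes "\<And>i. i \<in> I \<Longrightarrow> 0 \<le> f i \<and> f i \<le> 1"
  shows "0 \<le> sum f I / real (card I)" "sum f I / real (card I) \<le> 1"
proof -
  show "0 \<le> sum f I / real (card I)" using assms by (intro divide_nonneg_nonneg sum_nonneg) auto
  show "sum f I / real (card I) \<le> 1"
    using sum_bounded_above[of I f 1] assms by (cases "card I = 0") (auto simp: divide_le_eq)
qed

section \<open>Concentration of the density of non-label edges\<close>

context graphon_motifs
begin

lemma t_tilde_unit_cube: "t_tilde_x W F p l x \<in> cbox 0 1"
  using t_tilde_bounds by (simp add: mem_box_cart)

lemma label_fun_comp_t_tilde:
  assumes "continuous_on (cbox 0 1) f" shows "label_fun k (\<lambda>x. f (t_tilde_x W F p l x) :: real)"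
proof -
  obtain B where "\<And>x. x \<in> cbox 0 1 \<Longrightarrow> \<bar>f x\<bar> \<le> B"
    using continuous_unit_cube_bounded[OF assms] by blast
  then have B: "\<bar>f (t_tilde_x W F p l x)\<bar> \<le> B" for x using t_tilde_unit_cube by blast
  show ?thesis
  proof (rule label_funI[OF _ B])
    show "(\<lambda>x. f (t_tilde_x W F p l x)) \<in> borel_measurable (cube k)"
      by (rule measurable_comp_unit_cube[OF assms label_fun_measurable[OF label_fun_t_tilde] t_tilde_unit_cube])
    fix x y :: "nat \<Rightarrow> real" assume "\<And>i. i < k \<Longrightarrow> x i = y i"
    from label_fun_cong[OF label_fun_t_tilde this]
    have "t_tilde_x W F p l x = t_tilde_x W F p l y" by (simp add: vec_eq_iff)
    then show "f (t_tilde_x W F p l x) = f (t_tilde_x W F p l y)" by simp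
  qed
qed

text \<open>Expressed through \<alpha> alone, as one factor shared by all extensions of \<alpha> and
  by all motifs: label i carries the letter \<open>\<alpha> ! pos l i\<close>.\<close>

definition label_edges :: "nat list \<Rightarrow> (nat + nat \<times> nat \<Rightarrow> real) \<Rightarrow> real" where
  "label_edges \<alpha> \<omega> = (\<Prod>(i,j)\<in>Elab F l. of_bool (Gedge W \<omega> (\<alpha> ! pos l i) (\<alpha> ! pos l j)))"

text \<open>What remains of \<open>t_inj\<close> after the label edges are factored out
  (\<open>t_inj_eq_mult\<close>). Unlike \<open>t_inj\<close>, it concentrates around
  \<open>t_tilde_x\<close> given the labels.\<close>

definition t_rest :: "nat \<Rightarrow> nat list \<Rightarrow> (nat + nat \<times> nat \<Rightarrow> real) \<Rightarrow> real ^ 'd" where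
  "t_rest n \<alpha> \<omega> = (\<chi> m. (\<Sum>\<beta>\<in>ext_words n p l \<alpha>. gprod W (edges (F m) - Elab F l) \<beta> \<omega>)
     / real (card (ext_words n p l \<alpha>)))"

lemma label_edges_cases: "label_edges \<alpha> \<omega> = 0 \<or> label_edges \<alpha> \<omega> = 1"
proof -
  have "(\<Prod>e\<in>A. of_bool (P e)) = (0::real) \<or> (\<Prod>e\<in>A. of_bool (P e)) = (1::real)" for A :: "(nat \<times> nat) set" and P
    by (induction A rule: infinite_finite_induct) auto
  then show ?thesis unfolding label_edges_def split_beta .
qed

lemma gprod_Elab_ext:
  assumes "\<beta> \<in> ext_words n p l \<alpha>" shows "gprod W (Elab F l) \<beta> \<omega> = label_edges \<alpha> \<omega>"
proof -
  have "\<beta> ! i = \<alpha> ! pos l i" if "i \<in> set l" for i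
    using assms that pos_l_less[OF that] nth_pos[OF distinct_l that] by (auto simp: ext_words_def)
  then show ?thesis
    unfolding gprod_def label_edges_def using Elab_labels by (intro prod.cong refl) auto
qed

lemma gprod_edges_ext:
  assumes "\<beta> \<in> ext_words n p l \<alpha>"
  shows "gprod W (edges (F m)) \<beta> \<omega> = label_edges \<alpha> \<omega> * gprod W (edges (F m) - Elab F l) \<beta> \<omega>"
  using prod.subset_diff[OF Elab_subset finite_edges(1)[of m], of "\<lambda>(i,j). of_bool (Gedge W \<omega> (\<beta> ! i) (\<beta> ! j)) :: real"]
  by (simp add: gprod_Elab_ext[OF assms, symmetric]) (simp add: gprod_def mult.commute)

lemma t_inj_eq:
  "t_inj (F m) p n l \<alpha> (Gedge W \<omega>) = (\<Sum>\<beta>\<in>ext_words n p l \<alpha>. gprod W (edges (F m)) \<beta> \<omega>)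
     / real (card (ext_words n p l \<alpha>))"
proof -
  have "gprod W (edges (F m)) \<beta> \<omega> = of_bool (\<forall>(i,j)\<in>edges (F m). Gedge W \<omega> (\<beta> ! i) (\<beta> ! j))" for \<beta>
  proof -
    have "(\<Prod>e\<in>A. of_bool (P e)) = (of_bool (\<forall>e\<in>A. P e) :: real)" if "finite A" for A :: "(nat \<times> nat) set" and P
      using that by (induction A) auto
    from this[OF finite_edges(1)] show ?thesis unfolding gprod_def split_beta by auto
  qed
  then show ?thesis
    by (simp add: t_inj_def of_bool_def sum.If_cases Int_def)
qed

lemma t_inj_eq_mult: "t_inj (F m) p n l \<alpha> (Gedge W \<omega>) = label_edges \<alpha> \<omega> * t_rest n \<alpha> \<omega> $ m"
  unfolding t_inj_eq by (simp add: t_rest_def gprod_edges_ext sum_distrib_left)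

lemma t_rest_unit_cube: "t_rest n \<alpha> \<omega> \<in> cbox 0 1"
  by (simp add: mem_box_cart t_rest_def average_in_unit_interval gprod_bounds)

lemma t_inj_unit_cube: "(\<chi> m. t_inj (F m) p n l \<alpha> (Gedge W \<omega>)) \<in> cbox 0 1"
  by (simp add: mem_box_cart t_inj_eq average_in_unit_interval gprod_bounds)

lemma bmeas_t_rest: "bmeas (\<lambda>\<omega>. t_rest n \<alpha> \<omega> $ m)"
  unfolding t_rest_def vec_lambda_beta by (intro bmeas_divide_const bmeas_sum bmeas_gprod W)

lemma bmeas_t_inj: "bmeas (\<lambda>\<omega>. t_inj (F m) p n l \<alpha> (Gedge W \<omega>))"
  unfolding t_inj_eq by (intro bmeas_divide_const bmeas_sum bmeas_gprod W)

lemma bmeas_label_edges: "bmeas (label_edges \<alpha>)"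
  unfolding label_edges_def[abs_def] split_beta by (intro bmeas_prod Gedge_measurable W)

definition word_pt :: "nat list \<Rightarrow> (nat + nat \<times> nat \<Rightarrow> real) \<Rightarrow> nat \<Rightarrow> real" where
  "word_pt \<alpha> \<omega> = (\<lambda>i. Xv \<omega> (\<alpha> ! i))"

lemma label_fun_label_pt:
  assumes "label_fun k f" "\<beta> \<in> ext_words n p l \<alpha>"
  shows "f (label_pt l \<beta> \<omega>) = f (word_pt \<alpha> \<omega>)"
  by (rule label_fun_cong[OF assms(1)]) (use assms(2) in \<open>auto simp: label_pt_def word_pt_def ext_words_def\<close>)

lemma bmeas_word_pt:
  assumes f: "label_fun k f" and \<alpha>: "\<alpha> \<in> words n k" shows "bmeas (\<lambda>\<omega>. f (word_pt \<alpha> \<omega>))"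
proof -
  have "f (label_pt [0..<k] \<alpha> \<omega>) = f (word_pt \<alpha> \<omega>)" for \<omega>
    by (rule label_fun_cong[OF f]) (simp add: label_pt_def word_pt_def)
  then show ?thesis using bmeas_label_fun[OF f, of "[0..<k]" \<alpha>] by simp
qed

text \<open>Two extensions meeting only in \<alpha> share no coin of these edges: a non-label edge
  has an unlabelled endpoint, whose letter lies outside \<alpha>. Given the labels each summand is
  centred, so such pairs are uncorrelated, and \<open>card_ext_words_overlap\<close> counts the
  others.\<close>

lemma t_rest_second_moment:
  assumes \<alpha>: "\<alpha> \<in> words n k" and n: "p < n"
  shows "(\<integral>\<omega>. (t_rest n \<alpha> \<omega> $ m - t_tilde_x W F p l (word_pt \<alpha> \<omega>) $ m)\<^sup>2 \<partial>Omega)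
    \<le> real (p * p) / real (n - k)"
proof -
  let ?I = "ext_words n p l \<alpha>"
  let ?E = "edges (F m) - Elab F l"
  let ?f = "\<lambda>\<beta> \<omega>. gprod W ?E \<beta> \<omega> - t_tilde_x W F p l (label_pt l \<beta> \<omega>) $ m"
  have E: "?E \<subseteq> pairs p" using edges_pairs by auto
  have card: "0 < card ?I" using card_ext_words_pos[OF l \<alpha>] n by simp
  have kn: "k < n" using words_length_le[OF l] n by simp
  have w: "\<beta> \<in> words n p" "label_coords l \<beta> = Inl ` set \<alpha>" "set \<alpha> \<subseteq> set \<beta>" if "\<beta> \<in> ?I" for \<beta>
  proof -
    show 1: "\<beta> \<in> words n p" using that ext_words_subset by blast
    have eq: "map ((!) \<beta>) l = \<alpha>" using that unfolding ext_words_eq[OF l \<alpha>] by simp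
    then show "label_coords l \<beta> = Inl ` set \<alpha>" by (simp only: label_coords_def)
    show "set \<alpha> \<subseteq> set \<beta>" using 1 set_l unfolding eq[symmetric] by (auto simp: words_def)
  qed
  have bm: "bmeas (?f \<beta>)" for \<beta>
    by (intro bmeas_diff bmeas_gprod W bmeas_label_fun[OF label_fun_t_tilde])
  have avg: "t_rest n \<alpha> \<omega> $ m - t_tilde_x W F p l (word_pt \<alpha> \<omega>) $ m = (\<Sum>\<beta>\<in>?I. ?f \<beta> \<omega>) / real (card ?I)" for \<omega>
    using card card_gt_0_iff[of ?I] by (simp add: t_rest_def sum_subtractf label_fun_label_pt[OF label_fun_t_tilde] diff_divide_distrib)
  have "(\<integral>\<omega>. ((\<Sum>\<beta>\<in>?I. ?f \<beta> \<omega>) / real (card ?I))\<^sup>2 \<partial>Omega) \<le> 1\<^sup>2 * real (p * p) / real (n - k)"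
  proof (rule second_moment_average[where bad = "\<lambda>\<beta> \<beta>'. \<not> set \<beta> \<inter> set \<beta>' \<subseteq> set \<alpha>"])
    show "?I \<noteq> {}" using card by auto
    show "bmeas (?f \<beta>)" for \<beta> by (rule bm)
    show "\<bar>?f \<beta> \<omega>\<bar> \<le> 1" for \<beta> \<omega>
      using gprod_bounds[of W ?E \<beta> \<omega>] t_tilde_bounds[of "label_pt l \<beta> \<omega>" m] by linarith
    show "0 < real (n - k)" using kn by simp
    fix \<beta> assume b: "\<beta> \<in> ?I"
    have "card {\<beta>' \<in> ?I. \<not> set \<beta> \<inter> set \<beta>' \<subseteq> set \<alpha>} * (n - k) \<le> p * p * card ?I"
      by (rule card_ext_words_overlap[OF l \<alpha> _ b]) (use n in simp)
    then show "real (card {\<beta>' \<in> ?I. \<not> set \<beta> \<inter> set \<beta>' \<subseteq> set \<alpha>}) * real (n - k) \<le> real (p * p) * real (card ?I)"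
      unfolding of_nat_mult[symmetric] by (rule of_nat_mono)
    fix \<beta>' assume b': "\<beta>' \<in> ?I" and "\<not> \<not> set \<beta> \<inter> set \<beta>' \<subseteq> set \<alpha>"
    then have sub: "set \<beta> \<inter> set \<beta>' \<subseteq> set \<alpha>" by simp
    have dep: "dep (coords ?E \<beta>) (?f \<beta>)" if "\<beta> \<in> ?I" for \<beta>
    proof (rule dep_diff)
      show "dep (coords ?E \<beta>) (gprod W ?E \<beta>)"
        by (rule dep_gprod[OF _ E]) (use w(1)[OF that] in \<open>simp add: words_def\<close>)
      show "dep (coords ?E \<beta>) (\<lambda>\<omega>. t_tilde_x W F p l (label_pt l \<beta> \<omega>) $ m)"
        by (rule dep_mono[OF dep_label_fun])
          (use label_fun_t_tilde w[OF that] in \<open>auto simp: coords_def\<close>)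
    qed
    show "(\<integral>\<omega>. ?f \<beta> \<omega> * ?f \<beta>' \<omega> \<partial>Omega) = 0"
    proof (rule integral_mult_eq_0[OF bm bm dep[OF b] dep[OF b']])
      have "edge_coord \<beta> e \<noteq> edge_coord \<beta>' e'" if e: "e \<in> ?E" "e' \<in> ?E" for e e'
      proof
        assume eq: "edge_coord \<beta> e = edge_coord \<beta>' e'"
        obtain i j where ij: "e = (i, j)" by (metis surj_pair)
        have lt: "i < p" "j < p" using e(1) ij E by (auto simp: pairs_def)
        have "fst e' < p" "snd e' < p" using e(2) E by (auto simp: pairs_def)
        then have m: "\<beta> ! i \<in> set \<beta>" "\<beta> ! j \<in> set \<beta>" "\<beta>' ! fst e' \<in> set \<beta>'" "\<beta>' ! snd e' \<in> set \<beta>'"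
          using lt w(1)[OF b] w(1)[OF b'] by (auto simp: words_def)
        have "{\<beta> ! i, \<beta> ! j} = {\<beta>' ! fst e', \<beta>' ! snd e'}"
          using eq ij by (auto simp: edge_coord_def min_def max_def split: if_splits)
        then have "\<beta> ! i \<in> set \<alpha>" "\<beta> ! j \<in> set \<alpha>"
          using m sub by (auto simp: doubleton_eq_iff)
        \<comment> \<open>As \<beta> has distinct letters, only label positions carry letters of
          \<alpha>; both endpoints would be labels, against \<open>edges_not_Elab\<close>.\<close>
        moreover have "q \<in> set l" if q: "q < p" "\<beta> ! q \<in> set \<alpha>" for q
        proof -
          have "map ((!) \<beta>) l = \<alpha>" using b unfolding ext_words_eq[OF l \<alpha>] by simp
          then obtain q' where "q' \<in> set l" "\<beta> ! q = \<beta> ! q'" using q(2) by auto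
          moreover have "q' < p" using set_l \<open>q' \<in> set l\<close> by auto
          ultimately show ?thesis using words_nth_eq_iff[OF w(1)[OF b] q(1)] by auto
        qed
        ultimately show False using edges_not_Elab e(1) ij lt by blast
      qed
      then have "edge_coord \<beta> ` ?E \<inter> edge_coord \<beta>' ` ?E = {}" by blast
      then show "coords ?E \<beta> \<inter> coords ?E \<beta>' \<subseteq> label_coords l \<beta>"
        unfolding coords_def w(2)[OF b] using sub by blast
      show "cE (label_coords l \<beta>) (?f \<beta>) \<omega> = 0" for \<omega>
        using cE_diff[OF bmeas_gprod[OF W] bmeas_label_fun[OF label_fun_t_tilde]]
          cE_gprod_labels(3)[OF w(1)[OF b]]
          cE_eq_self[OF dep_label_fun[of l "\<lambda>x. t_tilde_x W F p l x $ m"]] label_fun_t_tilde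
        by simp
    qed
  qed simp
  then show ?thesis unfolding avg by simp
qed

end

section \<open>Decomposition of the statistic, L1 error and limit\<close>

locale graphon_clt = graphon_motifs W F p k l
  for W :: "real \<Rightarrow> real \<Rightarrow> real" and F :: "'d::finite \<Rightarrow> nat \<Rightarrow> nat \<Rightarrow> bool"
    and p k :: nat and l :: "nat list" +
  fixes g :: "real ^ 'd \<Rightarrow> real" and nabla :: "real ^ 'd \<Rightarrow> real ^ 'd" and B :: real
  assumes g_cont: "continuous_on (cbox 0 1) g" and nabla_cont: "continuous_on (cbox 0 1) nabla"
    and B: "0 \<le> B"
    and taylor: "\<And>x y. x \<in> cbox 0 1 \<Longrightarrow> y \<in> cbox 0 1 \<Longrightarrow>
      \<bar>g y - g x - nabla x \<bullet> (y - x)\<bar> \<le> B * (norm (y - x))\<^sup>2"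
begin

text \<open>After g(A y) = g(0) + A (g(y) - g(0)), these two functions are the constant and linear
  Taylor coefficients of the factor g(y) - g(0) at \<open>t_tilde_x\<close>.\<close>

sublocale graphon_kernel W F p k l "\<lambda>x. g (t_tilde_x W F p l x) - g 0" "\<lambda>x. nabla (t_tilde_x W F p l x)"
proof
  show "label_fun k (\<lambda>x. g (t_tilde_x W F p l x) - g 0)"
    by (intro label_fun_diff label_fun_const label_fun_comp_t_tilde g_cont)
  show "label_fun k (\<lambda>x. nabla (t_tilde_x W F p l x) $ m)" for m
    by (rule label_fun_comp_t_tilde) (intro continuous_intros nabla_cont)
qed

text \<open>When a label edge is missing, \<open>t_inj\<close> is zero and \<open>g\<close> is
  exactly \<open>g 0\<close> there, so the Taylor error has to carry the factor
  \<open>label_edges\<close>.\<close>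

definition rem :: "nat \<Rightarrow> nat list \<Rightarrow> (nat + nat \<times> nat \<Rightarrow> real) \<Rightarrow> real" where
  "rem n \<alpha> \<omega> = (let x = t_tilde_x W F p l (word_pt \<alpha> \<omega>) in
     label_edges \<alpha> \<omega> * (g (t_rest n \<alpha> \<omega>) - g x - nabla x \<bullet> (t_rest n \<alpha> \<omega> - x)))"

lemma rem_bound:
  "\<bar>rem n \<alpha> \<omega>\<bar> \<le> B * (\<Sum>m\<in>UNIV. (t_rest n \<alpha> \<omega> $ m - t_tilde_x W F p l (word_pt \<alpha> \<omega>) $ m)\<^sup>2)"
proof -
  let ?x = "t_tilde_x W F p l (word_pt \<alpha> \<omega>)" and ?y = "t_rest n \<alpha> \<omega>"
  have "\<bar>rem n \<alpha> \<omega>\<bar> \<le> \<bar>g ?y - g ?x - nabla ?x \<bullet> (?y - ?x)\<bar>"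
    using label_edges_cases[of \<alpha> \<omega>] by (auto simp: rem_def Let_def)
  also have "\<dots> \<le> B * (norm (?y - ?x))\<^sup>2"
    by (intro taylor t_rest_unit_cube t_tilde_unit_cube)
  also have "(norm (?y - ?x))\<^sup>2 = (\<Sum>m\<in>UNIV. (?y $ m - ?x $ m)\<^sup>2)"
    by (simp add: norm_vec_def L2_set_def sum_nonneg)
  finally show ?thesis .
qed

lemma bmeas_rem:
  assumes "\<alpha> \<in> words n k" shows "bmeas (rem n \<alpha>)"
proof -
  have x: "bmeas (\<lambda>\<omega>. f (t_tilde_x W F p l (word_pt \<alpha> \<omega>)))" if "continuous_on (cbox 0 1) f" for f
    by (rule bmeas_word_pt[OF label_fun_comp_t_tilde[OF that] assms])
  have y: "bmeas (\<lambda>\<omega>. g (t_rest n \<alpha> \<omega>))"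
    by (rule bmeas_comp_unit_cube[OF g_cont bmeas_t_rest t_rest_unit_cube])
  have n: "continuous_on (cbox 0 1) (\<lambda>x. nabla x $ m)" "continuous_on (cbox 0 1) (\<lambda>x::real^'d. x $ m)" for m
    by (intro continuous_intros nabla_cont)+
  show ?thesis
    unfolding rem_def[abs_def] Let_def inner_vec_def inner_real_def vector_minus_component
    by (intro bmeas_mult bmeas_diff bmeas_sum bmeas_label_edges y x[OF g_cont] x[OF n(1)] x[OF n(2)] bmeas_t_rest)
qed

text \<open>As \<open>label_edges\<close> is 0 or 1, g(A y) = g(0) + A (g(y) - g(0)) with y =
  \<open>t_rest\<close>. Expanding g(y) at the label point leaves \<open>rem\<close>, and the part
  affine in y is an average of kernels over the extensions.\<close>

lemma g_t_inj_eq: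
  assumes \<alpha>: "\<alpha> \<in> words n k" and n: "p \<le> n"
  shows "g (\<chi> m. t_inj (F m) p n l \<alpha> (Gedge W \<omega>)) = g 0 + rem n \<alpha> \<omega>
    + (\<Sum>\<beta>\<in>ext_words n p l \<alpha>. ustat_kernel \<beta> \<omega>) / real (card (ext_words n p l \<alpha>))"
proof -
  let ?I = "ext_words n p l \<alpha>"
  let ?x = "t_tilde_x W F p l (word_pt \<alpha> \<omega>)" and ?y = "t_rest n \<alpha> \<omega>" and ?A = "label_edges \<alpha> \<omega>"
  have card: "0 < real (card ?I)" using card_ext_words_pos[OF l \<alpha> n] by simp
  then have ne: "?I \<noteq> {}" by auto
  have y: "(\<Sum>\<beta>\<in>?I. gprod W (edges (F m) - Elab F l) \<beta> \<omega>) = real (card ?I) * ?y $ m" for m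
    using card unfolding t_rest_def vec_lambda_beta by simp
  have "t_tilde_x W F p l (label_pt l \<beta> \<omega>) = ?x" if "\<beta> \<in> ?I" for \<beta>
    using label_fun_label_pt[OF label_fun_t_tilde that] by (simp add: vec_eq_iff)
  then have "(\<Sum>\<beta>\<in>?I. ustat_kernel \<beta> \<omega>) = (\<Sum>\<beta>\<in>?I. (g ?x - g 0) * ?A
      + (\<Sum>m\<in>UNIV. nabla ?x $ m * (?A * gprod W (edges (F m) - Elab F l) \<beta> \<omega>) - (nabla ?x $ m * ?x $ m) * ?A))"
    by (intro sum.cong refl) (simp add: ustat_kernel_def gprod_Elab_ext gprod_edges_ext)
  also have "\<dots> = real (card ?I) * ((g ?x - g 0) * ?A)
      + (\<Sum>m\<in>UNIV. nabla ?x $ m * (?A * (\<Sum>\<beta>\<in>?I. gprod W (edges (F m) - Elab F l) \<beta> \<omega>))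
          - real (card ?I) * ((nabla ?x $ m * ?x $ m) * ?A))"
    by (simp add: sum.distrib sum_subtractf sum_distrib_left sum.swap[of _ UNIV ?I])
  also have "\<dots> = real (card ?I) * ((g ?x - g 0) * ?A
        + (\<Sum>m\<in>UNIV. nabla ?x $ m * (?A * ?y $ m) - (nabla ?x $ m * ?x $ m) * ?A))"
    by (simp only: y distrib_left sum_distrib_left right_diff_distrib mult_ac)
  finally have "(\<Sum>\<beta>\<in>?I. ustat_kernel \<beta> \<omega>) / real (card ?I) = (g ?x - g 0) * ?A
      + (\<Sum>m\<in>UNIV. nabla ?x $ m * (?A * ?y $ m) - (nabla ?x $ m * ?x $ m) * ?A)"
    using ne by simp
  also have "(\<Sum>m\<in>UNIV. nabla ?x $ m * (?A * ?y $ m) - (nabla ?x $ m * ?x $ m) * ?A)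
      = ?A * (nabla ?x \<bullet> (?y - ?x))"
    by (simp add: inner_vec_def sum_distrib_left algebra_simps)
  finally have avg: "(\<Sum>\<beta>\<in>?I. ustat_kernel \<beta> \<omega>) / real (card ?I)
      = ?A * (g ?x - g 0 + nabla ?x \<bullet> (?y - ?x))" by (simp add: algebra_simps)
  have "g (\<chi> m. t_inj (F m) p n l \<alpha> (Gedge W \<omega>)) = g 0 + ?A * (g ?y - g 0)"
  proof -
    have "(\<chi> m. t_inj (F m) p n l \<alpha> (Gedge W \<omega>)) = ?A *\<^sub>R ?y"
      by (simp add: vec_eq_iff t_inj_eq_mult)
    then show ?thesis using label_edges_cases[of \<alpha> \<omega>] by auto
  qed
  then show ?thesis unfolding avg by (simp add: rem_def Let_def algebra_simps)
qed

lemma Gamma_eq: "Gamma W F p l g = mean + g 0"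
proof -
  have int: "integrable (cube k) (\<lambda>x. t_hat_x W F l x * g (t_tilde_x W F p l x))"
    "integrable (cube k) (t_hat_x W F l)"
    by (intro label_fun_integrable label_fun_mult label_fun_t_hat label_fun_comp_t_tilde g_cont)+
  have "mean = (\<integral>x. t_hat_x W F l x * g (t_tilde_x W F p l x) - g 0 * t_hat_x W F l x \<partial>cube k)"
    unfolding mean_def by (simp add: algebra_simps)
  also have "\<dots> = (\<integral>x. t_hat_x W F l x * g (t_tilde_x W F p l x) \<partial>cube k) - g 0 * t_hat W F l"
    using int by (simp add: t_hat_def)
  finally show ?thesis by (simp add: Gamma_def algebra_simps)
qed

lemma Gamma_n_eq:
  assumes n: "p < n"
  shows "Gamma_n W F p l g n \<omega> - Gamma W F p l g
    = (\<Sum>\<alpha>\<in>words n k. rem n \<alpha> \<omega>) / real (card (words n k))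
      + (\<Sum>\<beta>\<in>words n p. resid \<beta> \<omega>) / real (card (words n p))
      + (\<Sum>v<n. \<Sum>i<p. proj i (Xv \<omega> v) - mean) / real n"
proof -
  let ?K = "real (card (words n k))" and ?P = "real (card (words n p))"
  obtain \<beta>0 where b0: "\<beta>0 \<in> words n p" using words_nonempty[of p n] n by auto
  then have wk: "words n k \<noteq> {}" using map_nth_words[OF l] by blast
  then have K: "?K \<noteq> 0" by simp
  \<comment> \<open>Each \<alpha> has the same number of extensions, so the nested averages merge
    into one.\<close>
  have ext: "(\<Sum>\<alpha>\<in>words n k. (\<Sum>\<beta>\<in>ext_words n p l \<alpha>. ustat_kernel \<beta> \<omega>) / real (card (ext_words n p l \<alpha>))) / ?K
      = (\<Sum>\<beta>\<in>words n p. ustat_kernel \<beta> \<omega>) / ?P"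
  proof -
    have "(\<Sum>\<alpha>\<in>words n k. (\<Sum>\<beta>\<in>ext_words n p l \<alpha>. ustat_kernel \<beta> \<omega>) / real (card (ext_words n p l \<alpha>))) / ?K
        = (\<Sum>\<alpha>\<in>words n k. (\<Sum>\<beta>\<in>ext_words n p l \<alpha>. ustat_kernel \<beta> \<omega>) / ?P)"
      unfolding sum_divide_distrib
      by (intro sum.cong refl) (use n in \<open>simp add: card_words_eq_mult[OF l] mult.commute\<close>)
    also have "\<dots> = (\<Sum>\<beta>\<in>words n p. ustat_kernel \<beta> \<omega>) / ?P"
      by (simp add: sum_divide_distrib[symmetric] sum_ext_words[OF l])
    finally show ?thesis .
  qed
  have "Gamma_n W F p l g n \<omega> = (\<Sum>\<alpha>\<in>words n k. g 0 + rem n \<alpha> \<omega>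
      + (\<Sum>\<beta>\<in>ext_words n p l \<alpha>. ustat_kernel \<beta> \<omega>) / real (card (ext_words n p l \<alpha>))) / ?K"
    unfolding Gamma_n_def len_l using g_t_inj_eq n by (intro arg_cong2[of _ _ _ _ "(/)"] sum.cong) auto
  also have "\<dots> = g 0 + (\<Sum>\<alpha>\<in>words n k. rem n \<alpha> \<omega>) / ?K + (\<Sum>\<beta>\<in>words n p. ustat_kernel \<beta> \<omega>) / ?P"
    using wk by (simp add: sum.distrib add_divide_distrib ext[symmetric])
  finally show ?thesis
    using average_kernel[of n \<omega>] n by (simp add: Gamma_eq)
qed

lemma integrable_proj:
  assumes "i < p" shows "integrable unif (proj i)"
proof -
  obtain D where "\<And>u. \<bar>proj i u\<bar> \<le> D" using proj_bound[OF assms] by blast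
  then show ?thesis
    using proj_measurable[OF assms]
    by (intro unif.integrable_const_bound[of _ D]) (auto cong: measurable_cong_sets)
qed

lemma integral_sum_proj:
  "integrable unif (\<lambda>u. \<Sum>i<p. proj i u - mean)" "(\<integral>u. (\<Sum>i<p. proj i u - mean) \<partial>unif) = 0"
proof -
  have int: "integrable unif (\<lambda>u. proj i u - mean)" if "i < p" for i
    by (rule Bochner_Integration.integrable_diff[OF integrable_proj[OF that]]) simp
  then show "integrable unif (\<lambda>u. \<Sum>i<p. proj i u - mean)"
    by (intro Bochner_Integration.integrable_sum) simp
  have "(\<integral>u. (\<Sum>i<p. proj i u - mean) \<partial>unif) = (\<Sum>i<p. \<integral>u. proj i u - mean \<partial>unif)"
    by (rule Bochner_Integration.integral_sum) (simp only: int lessThan_iff)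
  also have "\<dots> = (\<Sum>i<p. 0)"
  proof (rule sum.cong[OF refl])
    fix i assume "i \<in> {..<p}"
    then show "(\<integral>u. proj i u - mean \<partial>unif) = 0"
      using unif.prob_space mean_proj[of i] integrable_proj[of i]
      by (simp add: Bochner_Integration.integral_diff)
  qed
  finally show "(\<integral>u. (\<Sum>i<p. proj i u - mean) \<partial>unif) = 0" by simp
qed

lemma sum_proj_eq_Ufun:
  "(\<Sum>i<p. proj i u - mean) = Ufun W F p l g nabla u - (\<integral>v. Ufun W F p l g nabla v \<partial>unif)"
proof -
  \<comment> \<open>Collects everything that does not depend on u; its value is found by comparing
    means at the end.\<close>
  define c where "c = (\<Sum>i\<in>{..<p} - set l. mean
       - (\<integral>x. (\<Sum>m\<in>UNIV. (nabla (t_tilde_x W F p l x) $ m * t_tilde_x W F p l x $ m) * t_hat_x W F l x) \<partial>cube k))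
     - real p * mean"
  have eq: "(\<Sum>i<p. proj i u - mean) = Ufun W F p l g nabla u + c" for u
  proof -
    have "(\<Sum>i<p. proj i u) = (\<Sum>i\<in>{..<p} - set l. proj i u) + (\<Sum>i\<in>set l. proj i u)"
      by (rule sum.subset_diff[OF set_l]) simp
    also have "(\<Sum>i\<in>set l. proj i u) = (\<Sum>i\<in>set l. \<integral>x. t_hat_x W F l (x(pos l i := u))
          * (g (t_tilde_x W F p l (x(pos l i := u))) - g 0) \<partial>cube k)"
      by (intro sum.cong refl) (simp add: proj_def mult.commute)
    also have "\<dots> = (\<Sum>j<k. \<integral>x. t_hat_x W F l (x(j := u))
          * (g (t_tilde_x W F p l (x(j := u))) - g 0) \<partial>cube k)"
    proof (rule sum.reindex_bij_witness[where j = "pos l" and i = "(!) l"])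
      show "pos l (l ! j) = j" if "j \<in> {..<k}" for j using that pos_nth[OF distinct_l] by simp
    qed (use nth_pos[OF distinct_l] pos_l_less l_nth in auto)
    finally show ?thesis
      by (simp add: sum_subtractf Ufun_def c_def proj_def sum.distrib inner_vec_def mult.commute
          right_diff_distrib)
  qed
  \<comment> \<open>The centred projections integrate to zero, so the mean of \<open>Ufun\<close>
    can only be -c.\<close>
  have "(\<integral>u. (\<Sum>i<p. proj i u - mean) - c \<partial>unif) = - c"
    using integral_sum_proj unif.prob_space by (simp add: Bochner_Integration.integral_diff)
  moreover have "(\<lambda>u. (\<Sum>i<p. proj i u - mean) - c) = Ufun W F p l g nabla"
    using eq by (simp add: fun_eq_iff)
  ultimately have "(\<integral>u. Ufun W F p l g nabla u \<partial>unif) = - c" by simp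
  then show ?thesis using eq[of u] by simp
qed

lemma bmeas_Gamma_n: "bmeas (Gamma_n W F p l g n)"
  unfolding Gamma_n_def[abs_def]
  by (intro bmeas_divide_const bmeas_sum bmeas_comp_unit_cube[OF g_cont])
    (simp_all add: bmeas_t_inj t_inj_unit_cube)

text \<open>The threshold gives p < n together with n - k >= n / 2 and n - 1 >= n / 2, whence the
  factors 2. Both errors are of order 1/n before multiplication by sqrt n.\<close>

lemma L1_error:
  obtains K where "\<And>n. 2 * p + 2 \<le> n \<Longrightarrow>
    (\<integral>\<omega>. \<bar>sqrt (real n) * (Gamma_n W F p l g n \<omega> - Gamma W F p l g)
        - (\<Sum>v<n. \<Sum>i<p. proj i (Xv \<omega> v) - mean) / sqrt (real n)\<bar> \<partial>Omega) \<le> K / sqrt (real n)"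
proof -
  obtain K0 where K0: "0 \<le> K0" "\<And>n. p \<le> n \<Longrightarrow> 2 \<le> n \<Longrightarrow>
    (\<integral>\<omega>. ((\<Sum>\<beta>\<in>words n p. resid \<beta> \<omega>) / real (card (words n p)))\<^sup>2 \<partial>Omega) \<le> K0 / (real n * (real n - 1))"
    using resid_average_second_moment by blast
  define K1 where "K1 = B * (real CARD('d) * real (p * p))"
  have "0 \<le> K1" using B by (simp add: K1_def)
  show ?thesis
  \<comment> \<open>\<open>2 * K1\<close> comes from the Taylor remainder, \<open>1 / 2 + K0\<close>
    from the AM-GM step for the residual average.\<close>
  proof (rule that[of "2 * K1 + 1 / 2 + K0"])
    fix n assume n: "2 * p + 2 \<le> n"
    define s where "s = sqrt (real n)"
    have s: "0 < s" "s * s = real n" using n by (auto simp: s_def)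
    let ?D = "\<lambda>\<omega>. (\<Sum>\<alpha>\<in>words n k. \<bar>rem n \<alpha> \<omega>\<bar>) / real (card (words n k))"
    let ?R = "\<lambda>\<omega>. (\<Sum>\<beta>\<in>words n p. resid \<beta> \<omega>) / real (card (words n p))"
    let ?Z = "\<lambda>\<omega>. \<Sum>v<n. \<Sum>i<p. proj i (Xv \<omega> v) - mean"
    have kp: "k \<le> p" by (rule words_length_le[OF l])
    have bZ: "bmeas ?Z" by (intro bmeas_sum bmeas_diff bmeas_proj bmeas_const) simp
    have bD: "bmeas ?D" by (intro bmeas_divide_const bmeas_sum bmeas_abs bmeas_rem)
    have bR: "bmeas ?R" by (intro bmeas_divide_const bmeas_sum bmeas_resid)
    have lin: "(\<integral>\<omega>. s * d \<omega> + (1 / s + c * r \<omega>) / 2 \<partial>Omega)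
        = s * (\<integral>\<omega>. d \<omega> \<partial>Omega) + (1 / s + c * (\<integral>\<omega>. r \<omega> \<partial>Omega)) / 2"
      if "integrable Omega d" "integrable Omega r" for d r and c :: real
      using that by simp
    have "\<bar>s * (Gamma_n W F p l g n \<omega> - Gamma W F p l g) - ?Z \<omega> / s\<bar>
        \<le> s * ?D \<omega> + (1 / s + s * real n * (?R \<omega>)\<^sup>2) / 2" for \<omega>
    proof -
      have Z: "?Z \<omega> / s = s * (?Z \<omega> / real n)"
        unfolding s(2)[symmetric] using s(1) by simp
      have split: "s * (Gamma_n W F p l g n \<omega> - Gamma W F p l g) - ?Z \<omega> / s
          = s * ((\<Sum>\<alpha>\<in>words n k. rem n \<alpha> \<omega>) / real (card (words n k))) + s * ?R \<omega>"
        unfolding Z using Gamma_n_eq[of n \<omega>] n by (simp add: algebra_simps)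
      have 1: "\<bar>s * ((\<Sum>\<alpha>\<in>words n k. rem n \<alpha> \<omega>) / real (card (words n k)))\<bar> \<le> s * ?D \<omega>"
        unfolding abs_mult abs_divide abs_of_nat abs_of_pos[OF s(1)]
        using s(1) by (intro mult_left_mono divide_right_mono sum_abs) auto
      \<comment> \<open>AM-GM in place of Cauchy-Schwarz for integrals: the square of 1 - s^2 a,
        divided by 2 s, is nonnegative. The weights are balanced for a second moment of order
        1/n^2.\<close>
      have "s * a \<le> (1 / s + s * real n * a\<^sup>2) / 2" for a
      proof -
        have "0 \<le> (1 - s * s * a)\<^sup>2 / (2 * s)" using s by simp
        also have "\<dots> = (1 / s + s * (s * s) * a\<^sup>2) / 2 - s * a"
          using s(1) by (simp add: power2_eq_square field_simps)
        finally show ?thesis using s by simp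
      qed
      from this[of "\<bar>?R \<omega>\<bar>"]
      have 2: "\<bar>s * ?R \<omega>\<bar> \<le> (1 / s + s * real n * (?R \<omega>)\<^sup>2) / 2"
        using s(1) by (simp only: abs_mult abs_of_pos power2_abs)
      show ?thesis
        unfolding split by (rule order_trans[OF abs_triangle_ineq add_mono[OF 1 2]])
    qed
    then have "(\<integral>\<omega>. \<bar>s * (Gamma_n W F p l g n \<omega> - Gamma W F p l g) - ?Z \<omega> / s\<bar> \<partial>Omega)
        \<le> (\<integral>\<omega>. s * ?D \<omega> + (1 / s + s * real n * (?R \<omega>)\<^sup>2) / 2 \<partial>Omega)"
      by (intro integral_mono bmeas_integrable bmeas_abs bmeas_diff bmeas_add bmeas_mult
          bmeas_divide_const bmeas_const bmeas_power bmeas_Gamma_n bZ bD bR)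
    also have "\<dots> = s * (\<integral>\<omega>. ?D \<omega> \<partial>Omega) + (1 / s + s * real n * (\<integral>\<omega>. (?R \<omega>)\<^sup>2 \<partial>Omega)) / 2"
      by (rule lin[OF bmeas_integrable[OF bD] bmeas_integrable[OF bmeas_power[OF bR]]])
    also have "\<dots> \<le> s * (2 * K1 / real n) + (1 / s + s * real n * (K0 * 2 / (real n)\<^sup>2)) / 2"
    proof -
      have "(\<integral>\<omega>. ?D \<omega> \<partial>Omega) = (\<Sum>\<alpha>\<in>words n k. \<integral>\<omega>. \<bar>rem n \<alpha> \<omega>\<bar> \<partial>Omega) / real (card (words n k))"
        by (simp add: Bochner_Integration.integral_sum bmeas_integrable bmeas_abs bmeas_rem)
      also have "\<dots> \<le> (\<Sum>\<alpha>\<in>words n k. 2 * K1 / real n) / real (card (words n k))"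
      proof (intro divide_right_mono sum_mono)
        fix \<alpha> assume \<alpha>: "\<alpha> \<in> words n k"
        have bq: "bmeas (\<lambda>\<omega>. (t_rest n \<alpha> \<omega> $ m - t_tilde_x W F p l (word_pt \<alpha> \<omega>) $ m)\<^sup>2)" for m
          by (intro bmeas_power bmeas_diff bmeas_t_rest bmeas_word_pt[OF label_fun_t_tilde \<alpha>])
        have "(\<integral>\<omega>. \<bar>rem n \<alpha> \<omega>\<bar> \<partial>Omega)
            \<le> (\<integral>\<omega>. B * (\<Sum>m\<in>UNIV. (t_rest n \<alpha> \<omega> $ m - t_tilde_x W F p l (word_pt \<alpha> \<omega>) $ m)\<^sup>2) \<partial>Omega)"
          by (intro integral_mono rem_bound bmeas_integrable bmeas_abs bmeas_rem[OF \<alpha>] bmeas_mult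
              bmeas_const bmeas_sum bq)
        also have "\<dots> = B * (\<Sum>m\<in>UNIV. \<integral>\<omega>. (t_rest n \<alpha> \<omega> $ m - t_tilde_x W F p l (word_pt \<alpha> \<omega>) $ m)\<^sup>2 \<partial>Omega)"
          by (simp add: Bochner_Integration.integral_sum bmeas_integrable bq)
        also have "\<dots> \<le> B * (\<Sum>m\<in>(UNIV::'d set). real (p * p) / real (n - k))"
          using n by (intro mult_left_mono sum_mono t_rest_second_moment[OF \<alpha>] B) simp
        also have "\<dots> = K1 / real (n - k)" by (simp add: K1_def)
        also have "\<dots> \<le> K1 / (real n / 2)"
          using n kp \<open>0 \<le> K1\<close> by (intro divide_left_mono) (auto simp: of_nat_diff)
        finally show "(\<integral>\<omega>. \<bar>rem n \<alpha> \<omega>\<bar> \<partial>Omega) \<le> 2 * K1 / real n" by (simp add: mult.commute)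
      qed simp
      \<comment> \<open>The case of cardinality zero is settled by the convention that division by
        zero gives 0.\<close>
      also have "\<dots> \<le> 2 * K1 / real n" using \<open>0 \<le> K1\<close> by (cases "card (words n k) = 0") auto
      finally have 1: "(\<integral>\<omega>. ?D \<omega> \<partial>Omega) \<le> 2 * K1 / real n" .
      have "(\<integral>\<omega>. (?R \<omega>)\<^sup>2 \<partial>Omega) \<le> K0 / (real n * (real n - 1))" using K0(2)[of n] n by simp
      also have "\<dots> \<le> K0 / (real n * (real n / 2))"
        using n K0(1) by (intro divide_left_mono mult_left_mono) auto
      also have "\<dots> = K0 * 2 / (real n)\<^sup>2" by (simp add: power2_eq_square)
      finally have 2: "(\<integral>\<omega>. (?R \<omega>)\<^sup>2 \<partial>Omega) \<le> K0 * 2 / (real n)\<^sup>2" .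
      show ?thesis
        using 1 2 s(1) by (intro add_mono mult_left_mono divide_right_mono) auto
    qed
    also have "\<dots> = (2 * K1 + 1 / 2 + K0) / s"
      unfolding s(2)[symmetric] using s(1) by (simp add: field_simps power2_eq_square)
    finally show "(\<integral>\<omega>. \<bar>sqrt (real n) * (Gamma_n W F p l g n \<omega> - Gamma W F p l g)
        - ?Z \<omega> / sqrt (real n)\<bar> \<partial>Omega) \<le> (2 * K1 + 1 / 2 + K0) / sqrt (real n)"
      unfolding s_def .
  qed
qed

theorem Gamma_n_central_limit:
  "weak_conv_m (\<lambda>n. distr Omega borel (\<lambda>\<omega>. sqrt (real n) * (Gamma_n W F p l g n \<omega> - Gamma W F p l g)))
     (normal_law (sigma2 W F p l g nabla))"
proof -
  define \<theta> where "\<theta> u = (\<Sum>i<p. proj i u - mean)" for u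
  have "\<exists>B. \<forall>u. \<bar>\<theta> u\<bar> \<le> B"
  proof -
    obtain P where P: "\<And>i u. i < p \<Longrightarrow> \<bar>proj i u\<bar> \<le> P i" using proj_bound by metis
    have "\<bar>\<theta> u\<bar> \<le> (\<Sum>i<p. P i + \<bar>mean\<bar>)" for u
      unfolding \<theta>_def
    proof (rule order_trans[OF sum_abs], rule sum_mono)
      fix i assume "i \<in> {..<p}"
      then show "\<bar>proj i u - mean\<bar> \<le> P i + \<bar>mean\<bar>" using P[of i u] by auto
    qed
    then show ?thesis by blast
  qed
  then obtain D where D: "\<And>u. \<bar>\<theta> u\<bar> \<le> D" by blast
  have m\<theta>: "\<theta> \<in> borel_measurable borel"
    unfolding \<theta>_def[abs_def] by (intro borel_measurable_sum borel_measurable_diff proj_measurable) auto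
  have b\<theta>: "bmeas (\<lambda>\<omega>. \<theta> (Xv \<omega> v))" for v
    unfolding \<theta>_def by (intro bmeas_sum bmeas_diff bmeas_proj bmeas_const) simp
  have \<theta>: "\<theta> u = Ufun W F p l g nabla u - (\<integral>v. Ufun W F p l g nabla v \<partial>unif)" for u
    unfolding \<theta>_def by (rule sum_proj_eq_Ufun)
  have mean0: "(\<integral>u. \<theta> u \<partial>unif) = 0"
    unfolding \<theta>_def by (rule integral_sum_proj)
  let ?Y = "\<lambda>n \<omega>. sqrt (real n) * (Gamma_n W F p l g n \<omega> - Gamma W F p l g)"
  let ?Z = "\<lambda>n \<omega>. (\<Sum>v<n. \<theta> (Xv \<omega> v)) / sqrt (real n)"
  have bY: "bmeas (?Y n)" and bZ: "bmeas (?Z n)" for n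
    by (intro bmeas_mult bmeas_diff bmeas_const bmeas_Gamma_n bmeas_divide_const bmeas_sum b\<theta>)+
  show ?thesis
  proof (rule Omega.weak_conv_m_L1_perturb[where Z = ?Z])
    show "?Y n \<in> borel_measurable Omega" "?Z n \<in> borel_measurable Omega" for n
      using bY bZ bmeas_measurable by blast+
    show "integrable Omega (\<lambda>\<omega>. \<bar>?Y n \<omega> - ?Z n \<omega>\<bar>)" for n
      by (intro bmeas_integrable bmeas_abs bmeas_diff bY bZ)
    obtain K where K: "\<And>n. 2 * p + 2 \<le> n \<Longrightarrow> (\<integral>\<omega>. \<bar>?Y n \<omega> - ?Z n \<omega>\<bar> \<partial>Omega) \<le> K / sqrt (real n)"
      using L1_error unfolding \<theta>_def by blast
    show "(\<lambda>n. \<integral>\<omega>. \<bar>?Y n \<omega> - ?Z n \<omega>\<bar> \<partial>Omega) \<longlonglongrightarrow> 0"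
    proof (rule tendsto_sandwich[OF _ _ tendsto_const])
      show "\<forall>\<^sub>F n in sequentially. 0 \<le> (\<integral>\<omega>. \<bar>?Y n \<omega> - ?Z n \<omega>\<bar> \<partial>Omega)" by simp
      show "\<forall>\<^sub>F n in sequentially. (\<integral>\<omega>. \<bar>?Y n \<omega> - ?Z n \<omega>\<bar> \<partial>Omega) \<le> K / sqrt (real n)"
        using K eventually_sequentially by blast
      have "filterlim (\<lambda>n. sqrt (real n)) at_top sequentially"
        by (rule filterlim_compose[OF sqrt_at_top filterlim_real_sequentially])
      then show "(\<lambda>n. K / sqrt (real n)) \<longlonglongrightarrow> 0"
        by (rule real_tendsto_divide_at_top[OF tendsto_const])
    qed
    have "sigma2 W F p l g nabla = (\<integral>u. (\<theta> u)\<^sup>2 \<partial>unif)"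
      by (simp add: sigma2_def \<theta>)
    then show "weak_conv_m (\<lambda>n. distr Omega borel (?Z n)) (normal_law (sigma2 W F p l g nabla))"
      using Omega_central_limit_theorem[OF m\<theta> D mean0] by simp
    show "real_distribution (normal_law (sigma2 W F p l g nabla))"
      by (rule real_distribution_normal_law) (simp add: sigma2_def)
  qed
qed

end

text \<open>Regularity up to the boundary of the cube is expressed on an open neighbourhood
  \<open>S\<close>, where \<open>g\<close> has gradient \<open>nabla\<close> and continuous Hessian
  \<open>H\<close>. The cube itself is compact and convex, which yields the uniform Taylor
  bound.\<close>

theorem theorem3p5:
  fixes W :: "real \<Rightarrow> real \<Rightarrow> real"
    and F :: "'d::finite \<Rightarrow> nat \<Rightarrow> nat \<Rightarrow> bool"
    and p :: nat
    and l :: "nat list"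
    and g :: "real ^ 'd \<Rightarrow> real"
    and nabla :: "real ^ 'd \<Rightarrow> real ^ 'd"
    and H :: "real ^ 'd \<Rightarrow> real ^ 'd ^ 'd"
    and S :: "(real ^ 'd) set"
  assumes "graphon W"
    and "p \<ge> 1"
    and "\<And>m. simple_graph p (F m)"
    and "l \<in> Mwords p"
    and "compatible F l"
    and "open S" and "cbox 0 1 \<subseteq> S"
    and "\<And>x. x \<in> S \<Longrightarrow> (g has_derivative (\<lambda>h. nabla x \<bullet> h)) (at x)"
    and "\<And>x. x \<in> S \<Longrightarrow> (nabla has_derivative (\<lambda>h. H x *v h)) (at x)"
    and "continuous_on S H"
  shows "weak_conv_m
           (\<lambda>n. distr Omega borel (\<lambda>\<omega>. sqrt (real n) * (Gamma_n W F p l g n \<omega> - Gamma W F p l g)))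
           (normal_law (sigma2 W F p l g nabla))"
proof -
  obtain B where B: "0 \<le> B" "\<And>x y. x \<in> cbox 0 1 \<Longrightarrow> y \<in> cbox 0 1 \<Longrightarrow>
      \<bar>g y - g x - nabla x \<bullet> (y - x)\<bar> \<le> B * (norm (y - x))\<^sup>2"
    using taylor_quadratic_bound[OF convex_box(1) compact_cbox assms(7-10)] by blast
  have cont: "continuous_on (cbox 0 1) g" "continuous_on (cbox 0 1) nabla"
    using assms(7-9) by (auto intro!: continuous_at_imp_continuous_on intro: has_derivative_continuous)
  interpret graphon_clt W F p "length l" l g nabla B
    using assms(1,3,4,5) B cont by unfold_locales (auto simp: Mwords_def words_def)
  show ?thesis by (rule Gamma_n_central_limit)
qed

end
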